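(* Let $f:\mathbb{R}\to\mathbb{R}$ be a Borel function. There exist sequences of real numbers $\{c_n\}$ (with $c_n\ne0$) and $\{d_n\}$ such that $$\lim_{n\to\infty}\mathcal{L}\Big(c_n^{-1}\Big(\sum_{k=1}^n f(a_k)-d_n\Big)\Big)=\mathcal{N}(0,1)$$ if and only if the function $x\mapsto \mathrm{E}\big[f^2(a_1)I_{[|f(a_1)|\le x]}\big]$ is slowly varying in the sense of Karamata. Moreover, if the latter condition is satisfied, one can take $d_n=n\,\mathrm{E}[f(a_1)]$ (i.e. the convergence holds with this choice of $d_n$ and some sequence $\{c_n\}$).
   Context: For irrational $x\in(0,1]$, $a_n(x)\in\mathbb{N}=\{1,2,\ldots\}$, $n\ge1$, denote the partial quotients (digits) of the simple non-terminating continued fraction expansion $x=\cfrac{1}{a_1(x)+\cfrac{1}{a_2(x)+\cdots}}$. The sequence $\{a_n\}$ is regarded as a random sequence on the probability space $((0,1],\mathcal{B},\mathrm{P})$, where $\mathcal{B}$ is the Borel $\sigma$-field of $(0,1]$ and $\mathrm{P}$ is the Gauss measure $\mathrm{P}(A)=\frac{1}{\ln 2}\int_A\frac{dx}{1+x}$. $\mathrm{E}$ denotes expectation with respect to $\mathrm{P}$, $I_{[\cdot]}$ the indicator of an event, $\mathcal{L}(Z)$ the law (under $\mathrm{P}$) of a random variable $Z$, $\mathcal{N}(0,1)$ the standard normal law, and limits of laws are in the sense of weak convergence. A (measurable, eventually positive) function $\ell$ is slowly varying in the sense of Karamata if $\ell(\lambda x)/\ell(x)\to1$ as $x\to\infty$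 for every $\lambda>0$.
   Formalization: The formal theorem assumes in addition that f is not equal to one nonzero constant on all positive integers; for such f the truncated moment is slowly varying but the sum is deterministic, so the claim as stated fails. *)

theory Defs
  imports "HOL-Probability.Probability"
begin

text \<open>\<open>cf_frac a k n\<close> is the finite continued fraction
  \<open>1 / (a k + 1 / (a (k + 1) + \<dots> + 1 / a (k + n - 1)))\<close>, which has \<open>n\<close> levels.\<close>

primrec cf_frac :: "(nat \<Rightarrow> nat) \<Rightarrow> nat \<Rightarrow> nat \<Rightarrow> real" where
  "cf_frac a k 0 = 0"
| "cf_frac a k (Suc n) = 1 / (real (a k) + cf_frac a (Suc k) n)"

text \<open>Partial quotients are indexed from \<open>1\<close>; the entry \<open>a 0\<close> is the integer part, which is
  \<open>0\<close> for irrational \<open>x\<close> in \<open>(0, 1]\<close>.\<close>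

definition is_cf_expansion :: "(nat \<Rightarrow> nat) \<Rightarrow> real \<Rightarrow> bool" where
  "is_cf_expansion a x \<longleftrightarrow> a 0 = 0 \<and> (\<forall>k\<ge>1. a k \<ge> 1) \<and> (\<lambda>n. cf_frac a 1 n) \<longlonglongrightarrow> x"

text \<open>For rational \<open>x\<close> there is no infinite expansion and the value is unspecified; this concerns a
  countable, hence null, set only.\<close>

definition cf_digit :: "nat \<Rightarrow> real \<Rightarrow> nat" where
  "cf_digit k x = (THE a. is_cf_expansion a x) k"

lemma cf_frac_bounds:
  assumes "\<And>j. j \<ge> k \<Longrightarrow> a j \<ge> 1"
  shows "0 \<le> cf_frac a k n \<and> cf_frac a k n \<le> 1"
  using assms
proof (induction n arbitrary: k)
  case (Suc n)
  have "0 \<le> cf_frac a (Suc k) n" using Suc.IH[of "Suc k"] Suc.prems by simp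
  moreover have "1 \<le> real (a k)" using Suc.prems[of k] by simp
  ultimately show ?case by simp
qed simp

lemma cf_tail_limit:
  fixes x :: real
  assumes pos: "\<And>j. j \<ge> k \<Longrightarrow> a j \<ge> 1"
    and lim: "(\<lambda>n. cf_frac a k n) \<longlonglongrightarrow> x" and irr: "x \<notin> \<rat>"
  shows "(\<lambda>n. cf_frac a (Suc k) n) \<longlonglongrightarrow> frac (1 / x)" "a k = nat \<lfloor>1 / x\<rfloor>" "frac (1 / x) \<notin> \<rat>"
proof -
  let ?y = "1 / x - real (a k)"
  have x0: "x \<noteq> 0" using irr by auto
  have ak: "1 \<le> real (a k)" using pos[of k] by simp
  have bd: "0 \<le> cf_frac a (Suc k) n \<and> cf_frac a (Suc k) n \<le> 1" for n
    using pos by (intro cf_frac_bounds) simp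
  have "(\<lambda>n. cf_frac a k (Suc n)) \<longlonglongrightarrow> x" using lim by (rule LIMSEQ_Suc)
  then have "(\<lambda>n. 1 / cf_frac a k (Suc n) - real (a k)) \<longlonglongrightarrow> ?y"
    using x0 by (intro tendsto_intros)
  moreover have "1 / cf_frac a k (Suc n) - real (a k) = cf_frac a (Suc k) n" for n
    using bd[of n] ak by simp
  ultimately have y: "(\<lambda>n. cf_frac a (Suc k) n) \<longlonglongrightarrow> ?y" by simp
  have "0 \<le> ?y" using y bd by (intro LIMSEQ_le_const[OF y]) auto
  moreover have "?y \<le> 1" using y bd by (intro LIMSEQ_le_const2[OF y]) auto
  moreover have irr': "?y \<notin> \<rat>"
  proof
    assume "?y \<in> \<rat>"
    then have "?y + real (a k) \<in> \<rat>" by (intro Rats_add) auto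
    then have "inverse (1 / x) \<in> \<rat>" by (intro Rats_inverse) simp
    then show False using irr by simp
  qed
  moreover have "?y \<noteq> 1" using irr' by (metis Rats_1)
  ultimately have "0 \<le> ?y" "?y < 1" by auto
  then have fl: "\<lfloor>1 / x\<rfloor> = int (a k)" by (intro floor_unique) auto
  then have fr: "frac (1 / x) = ?y" by (simp add: frac_def)
  show "(\<lambda>n. cf_frac a (Suc k) n) \<longlonglongrightarrow> frac (1 / x)" using y fr by simp
  show "a k = nat \<lfloor>1 / x\<rfloor>" using fl by simp
  show "frac (1 / x) \<notin> \<rat>" using irr' fr by simp
qed

lemma is_cf_expansion_digit:
  assumes "is_cf_expansion a x" "x \<notin> \<rat>"
  shows "a (Suc k) = nat \<lfloor>1 / ((\<lambda>y. frac (1 / y)) ^^ k) x\<rfloor>"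
proof -
  have pos: "a j \<ge> 1" if "j \<ge> Suc k" for j k
    using assms(1) that by (auto simp: is_cf_expansion_def)
  have "(\<lambda>n. cf_frac a (Suc k) n) \<longlonglongrightarrow> ((\<lambda>y. frac (1 / y)) ^^ k) x \<and> ((\<lambda>y. frac (1 / y)) ^^ k) x \<notin> \<rat>"
  proof (induction k)
    case 0
    show ?case using assms by (simp add: is_cf_expansion_def)
  next
    case (Suc k)
    show ?case
      using cf_tail_limit(1,3)[of "Suc k" a "((\<lambda>y. frac (1 / y)) ^^ k) x"] pos[where k = k] Suc by simp
  qed
  then show ?thesis by (intro cf_tail_limit(2)[OF pos]) auto
qed

lemma cf_two_step:
  fixes a b y z :: real
  assumes "a \<ge> 1" "b \<ge> 1" "y \<ge> 0" "z \<ge> 0"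
  shows "\<bar>1 / (a + 1 / (b + y)) - 1 / (a + 1 / (b + z))\<bar> \<le> \<bar>y - z\<bar> / 4"
proof -
  let ?p = "a * (b + y) + 1" and ?q = "a * (b + z) + 1"
  have "1 * 1 \<le> a * (b + y)" "1 * 1 \<le> a * (b + z)" using assms by (intro mult_mono; simp)+
  then have p: "?p \<ge> 2" and q: "?q \<ge> 2" by auto
  have eq: "1 / (a + 1 / (b + t)) = (b + t) / (a * (b + t) + 1)" if "t \<ge> 0" for t
    using that assms by (simp add: field_simps)
  have "1 / (a + 1 / (b + y)) - 1 / (a + 1 / (b + z)) = (y - z) / (?p * ?q)"
    unfolding eq[OF assms(3)] eq[OF assms(4)] using p q
    by (subst diff_frac_eq) (auto simp: algebra_simps)
  moreover have "2 * 2 \<le> ?p * ?q" using p q by (intro mult_mono) auto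
  moreover from this have "\<bar>y - z\<bar> / (?p * ?q) \<le> \<bar>y - z\<bar> / 4"
    by (intro divide_left_mono) auto
  moreover have "\<bar>(y - z) / (?p * ?q)\<bar> = \<bar>y - z\<bar> / (?p * ?q)"
    using p q by (subst abs_divide) (simp add: abs_mult)
  ultimately show ?thesis by simp
qed

lemma ex1_cf_expansion:
  assumes x: "x \<in> {0<..1}" "x \<notin> \<rat>"
  shows "\<exists>!a. is_cf_expansion a x"
proof (rule ex_ex1I)
  define r where "r k = ((\<lambda>y. frac (1 / y)) ^^ (k - 1)) x" for k
  define a where "a k = (if k = 0 then 0 else nat \<lfloor>1 / r k\<rfloor>)" for k
  have r_Suc: "r (Suc k) = frac (1 / r k)" if "k \<ge> 1" for k
    using that by (cases k) (auto simp: r_def)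
  have r: "0 < r k \<and> r k \<le> 1 \<and> r k \<notin> \<rat>" if "k \<ge> 1" for k
    using that
  proof (induction k rule: nat_induct_at_least)
    case base
    show ?case using x by (simp add: r_def)
  next
    case (Suc k)
    have irr: "1 / r k \<notin> \<rat>"
    proof
      assume "1 / r k \<in> \<rat>"
      then have "inverse (1 / r k) \<in> \<rat>" by (rule Rats_inverse)
      then show False using Suc by simp
    qed
    have "frac (1 / r k) \<notin> \<rat>"
    proof
      assume "frac (1 / r k) \<in> \<rat>"
      then have "frac (1 / r k) + of_int \<lfloor>1 / r k\<rfloor> \<in> \<rat>" by (intro Rats_add) auto
      then show False using irr by (simp add: frac_def)
    qed
    moreover from this have "frac (1 / r k) \<noteq> 0" by (metis Rats_0)
    ultimately show ?case
      using frac_ge_0[of "1 / r k"] frac_lt_1[of "1 / r k"] r_Suc[OF Suc.hyps] by simp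
  qed
  have a: "a k \<ge> 1" if "k \<ge> 1" for k
  proof -
    have "1 \<le> 1 / r k" using r[OF that] by simp
    then have "1 \<le> \<lfloor>1 / r k\<rfloor>" by (simp add: le_floor_iff)
    then have "nat 1 \<le> nat \<lfloor>1 / r k\<rfloor>" by (rule nat_mono)
    then show ?thesis using that by (simp add: a_def)
  qed
  have step: "r k = 1 / (real (a k) + r (Suc k))" if "k \<ge> 1" for k
    using r[OF that] r_Suc[OF that] that by (simp add: a_def frac_def)
  have err: "\<bar>r k - cf_frac a k n\<bar> \<le> (1 / 2) ^ n * 2" if "k \<ge> 1" for k n
    using that
  proof (induction n arbitrary: k rule: induct_nat_012)
    case (ge2 n)
    have "r k = 1 / (real (a k) + 1 / (real (a (Suc k)) + r (Suc (Suc k))))"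
      using step[of k] step[of "Suc k"] ge2.prems by simp
    then have "\<bar>r k - cf_frac a k (Suc (Suc n))\<bar> \<le> \<bar>r (Suc (Suc k)) - cf_frac a (Suc (Suc k)) n\<bar> / 4"
      using cf_two_step[of "a k" "a (Suc k)" "r (Suc (Suc k))" "cf_frac a (Suc (Suc k)) n"]
        a[of k] a[of "Suc k"] ge2.prems r[of "Suc (Suc k)"] cf_frac_bounds[of "Suc (Suc k)" a n] a
      by simp
    also have "\<dots> \<le> (1 / 2) ^ n * 2 / 4" using ge2.IH(1)[of "Suc (Suc k)"] by simp
    finally show ?case by simp
  next
    case 1
    have "0 \<le> cf_frac a k (Suc 0) \<and> cf_frac a k (Suc 0) \<le> 1"
      using a 1 by (intro cf_frac_bounds) simp
    then have "\<bar>r k - cf_frac a k (Suc 0)\<bar> \<le> 1" using r[OF 1] by linarith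
    then show ?case by simp
  qed (use r in fastforce)
  have "(\<lambda>n. (1 / 2 :: real) ^ n * 2) \<longlonglongrightarrow> 0"
    by (intro tendsto_mult_left_zero LIMSEQ_power_zero) simp
  then have "(\<lambda>n. cf_frac a 1 n - r 1) \<longlonglongrightarrow> 0"
    by (rule Lim_null_comparison[rotated]) (use err[of 1] in \<open>simp add: abs_minus_commute\<close>)
  then have "(\<lambda>n. cf_frac a 1 n) \<longlonglongrightarrow> x"
    by (subst (asm) LIM_zero_iff) (simp add: r_def)
  then show "\<exists>a. is_cf_expansion a x"
    using a by (intro exI[of _ a]) (auto simp: is_cf_expansion_def a_def)
next
  fix a b assume ab: "is_cf_expansion a x" "is_cf_expansion b x"
  show "a = b"
  proof
    fix k show "a k = b k"
      using ab is_cf_expansion_digit[OF ab(1) x(2)] is_cf_expansion_digit[OF ab(2) x(2)]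
      by (cases k) (auto simp: is_cf_expansion_def)
  qed
qed

lemma cf_digit_eq:
  assumes "x \<in> {0<..1}" "x \<notin> \<rat>"
  shows "cf_digit (Suc k) x = nat \<lfloor>1 / ((\<lambda>y. frac (1 / y)) ^^ k) x\<rfloor>"
  unfolding cf_digit_def
  by (rule is_cf_expansion_digit[OF theI'[OF ex1_cf_expansion[OF assms]] assms(2)])

definition gauss_measure :: "real measure" where
  "gauss_measure = density (restrict_space lborel {0<..1}) (\<lambda>x. ennreal (1 / (ln 2 * (1 + x))))"

lemma space_gauss_measure: "space gauss_measure = {0<..1}"
  by (simp add: gauss_measure_def space_restrict_space)

lemma sets_gauss_measure: "sets gauss_measure = sets (restrict_space borel {0<..1})"
  by (simp add: gauss_measure_def sets_restrict_space)

lemma prob_space_gauss_measure: "prob_space gauss_measure"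
proof
  have [measurable]: "(\<lambda>x::real. ennreal (1 / (ln 2 * (1 + x)))) \<in> borel_measurable (restrict_space lborel {0<..1})"
    by (intro measurable_restrict_space1) measurable
  have "emeasure gauss_measure (space gauss_measure)
      = (\<integral>\<^sup>+x. ennreal (1 / (ln 2 * (1 + x))) \<partial>restrict_space lborel {0<..1})"
    unfolding gauss_measure_def
    by (subst emeasure_density)
       (auto simp: space_restrict_space sets_restrict_space intro!: nn_integral_cong)
  also have "\<dots> = (\<integral>\<^sup>+x. ennreal (1 / (ln 2 * (1 + x))) * indicator {0<..1} x \<partial>lborel)"
    by (subst nn_integral_restrict_space) auto
  also have "\<dots> = (\<integral>\<^sup>+x. ennreal (1 / (ln 2 * (1 + x))) * indicator {0..1} x \<partial>lborel)"
    by (intro nn_integral_cong_AE AE_I[where N = "{0}"]) (auto simp: indicator_def)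
  also have "\<dots> = ennreal (inverse (ln 2) * ln (1 + 1) - inverse (ln 2) * ln (1 + 0))"
    by (rule nn_integral_FTC_Icc[where F = "\<lambda>x. inverse (ln 2) * ln (1 + x)"])
       (auto intro!: derivative_eq_intros simp: divide_inverse)
  finally show "emeasure gauss_measure (space gauss_measure) = 1" by simp
qed

lemma measurable_cf_digit [measurable]:
  assumes "k \<ge> 1"
  shows "cf_digit k \<in> measurable gauss_measure (count_space UNIV)"
proof (rule measurable_discrete_difference[where X = "\<rat> \<inter> {0<..1}"])
  have "(\<lambda>x::real. nat \<lfloor>1 / ((\<lambda>y. frac (1 / y)) ^^ (k - 1)) x\<rfloor>) \<in> measurable borel (count_space UNIV)"
  proof -
    have [measurable]: "((\<lambda>y::real. frac (1 / y)) ^^ j) \<in> borel_measurable borel" for j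
    proof (induction j)
      case (Suc j)
      note Suc [measurable]
      have "(\<lambda>x. frac (1 / ((\<lambda>y::real. frac (1 / y)) ^^ j) x)) \<in> borel_measurable borel"
        unfolding frac_def by measurable
      then show ?case by (simp add: comp_def)
    qed (simp add: id_def)
    show ?thesis by measurable
  qed
  then show "(\<lambda>x. nat \<lfloor>1 / ((\<lambda>y. frac (1 / y)) ^^ (k - 1)) x\<rfloor>) \<in> measurable gauss_measure (count_space UNIV)"
    by (subst measurable_cong_sets[OF sets_gauss_measure refl]) (rule measurable_restrict_space1)
  show "countable (\<rat> \<inter> {0<..1} :: real set)"
    using countable_rat by (rule countable_Int1)
  show "{x} \<in> sets gauss_measure" if "x \<in> \<rat> \<inter> {0<..1}" for x
    using that by (auto simp: sets_gauss_measure sets_restrict_space_iff)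
  show "nat \<lfloor>1 / ((\<lambda>y. frac (1 / y)) ^^ (k - 1)) x\<rfloor> = cf_digit k x"
    if "x \<in> space gauss_measure" "x \<notin> \<rat> \<inter> {0<..1}" for x
    using that cf_digit_eq[of x "k - 1"] assms by (auto simp: space_gauss_measure)
qed auto

definition slowly_varying :: "(real \<Rightarrow> real) \<Rightarrow> bool" where
  "slowly_varying l \<longleftrightarrow> l \<in> borel_measurable borel \<and> eventually (\<lambda>x. l x > 0) at_top \<and>
     (\<forall>c>0. ((\<lambda>x. l (c * x) / l x) \<longlongrightarrow> 1) at_top)"

definition trunc_moment2 :: "(real \<Rightarrow> real) \<Rightarrow> real \<Rightarrow> real" where
  "trunc_moment2 f t = (\<integral>x. (f (real (cf_digit 1 x)))\<^sup>2
     * indicat_real {y. \<bar>f (real (cf_digit 1 y))\<bar> \<le> t} x \<partial>gauss_measure)"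

definition normalized_law :: "(real \<Rightarrow> real) \<Rightarrow> (nat \<Rightarrow> real) \<Rightarrow> (nat \<Rightarrow> real) \<Rightarrow> nat \<Rightarrow> real measure" where
  "normalized_law f c d n = distr gauss_measure borel
     (\<lambda>x. inverse (c n) * ((\<Sum>k=1..n. f (real (cf_digit k x))) - d n))"

end

theory Submission
  imports Defs "HOL-Real_Asymp.Real_Asymp"
begin

text \<open>
  The Gauss--Kuzmin operator \<open>L g(s) = \<Sum>n. p n s * g (1 / (s + n + 1))\<close> contracts Lipschitz constants
  by the factor \<open>7/8\<close>, so Poisson equations \<open>h - L h = v\<close> with centred Lipschitz right-hand side are
  solvable.  The characteristic function of the \<open>n\<close>-th partial sum is the integral of \<open>L_u\<^sup>n 1\<close>, where
  \<open>L_u\<close> is \<open>L\<close> with the digit weights \<open>u = e\<^bsup>itf\<^esup>\<close>; an approximate eigenfunction of \<open>L_u\<close> close to \<open>1\<close>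
  with eigenvalue \<open>\<lambda>\<close> therefore shows that it is close to \<open>\<lambda>\<^sup>n\<close>.

  If \<open>f(a\<^sub>1)\<close> has infinite variance, a first-order Poisson correction gives \<open>\<lambda> = \<phi>(t) = E e\<^bsup>itf(a\<^sub>1)\<^esup>\<close> with
  an error that is negligible uniformly in \<open>n\<close> as \<open>t\<close> tends to \<open>0\<close>.  The problem is thus reduced to the
  powers \<open>\<phi>(t)\<^sup>n\<close>, that is, to the classical theorem for independent summands: slow variation is used
  in a Taylor expansion of \<open>\<phi>\<close>, and conversely the identity
  \<open>2 (1 - cos y)\<^sup>2 = 4 (1 - cos y) - (1 - cos 2y)\<close> turns the quadratic behaviour of \<open>1 - \<bar>\<phi>\<bar>\<^sup>2\<close> into
  negligibility of the tails.  If the variance is finite, slow variation is automatic, and a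
  second-order Poisson correction gives \<open>\<lambda> = 1 - t\<^sup>2 \<sigma>\<^sup>2 / 2 + o(t\<^sup>2)\<close>, where \<open>\<sigma>\<^sup>2 > 0\<close> because a
  vanishing martingale difference would force \<open>f\<close> to be constant, as one sees at the fixed points of
  the inverse branches.
\<close>

section \<open>The Gauss--Kuzmin operator\<close>

text \<open>Two quantities compete as \<open>t\<close> tends to 0: the linear size
  \<open>\<eta> = E |e^(itX) - 1|\<close> of the perturbation, where \<open>X = f(a_1)\<close>, and
  the quadratic size \<open>1 - |\<phi>|^2\<close>. The first Poisson correction leaves an
  eigenvalue error of order \<open>\<eta>^2\<close>, which accumulates over \<open>n\<close> steps
  to at most a multiple of \<open>\<eta>^2 / (1 - |\<phi>|^2)\<close>. With an infinite second
  moment this quotient tends to 0, so correlations between digits are invisible for every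
  \<open>n\<close> at once. With a finite variance \<open>\<eta>^2\<close> and
  \<open>1 - |\<phi>|^2\<close> are in general both of order \<open>t^2\<close>: correlations enter
  the limiting variance, and this is why that case needs a second correction and its own positivity
  argument. Although \<open>f\<close> may be unbounded, no truncation of it is needed for the
  operator: averaging over the digit turns an integrable digit function into a Lipschitz function of
  the state, to which the contraction applies. In the converse neither the centring nor the growth
  of the normalising constants is known. Moduli remove the former, and the latter is derived from
  the decay of \<open>|\<phi>|^n\<close>.\<close>

definition gk_weight :: "nat \<Rightarrow> real \<Rightarrow> real" where
  "gk_weight n s = (1 + s) / ((s + n + 1) * (s + n + 2))"

text \<open>Inverse branch of the Gauss map \<open>x \<mapsto> frac (1 / x)\<close> for first
  partial quotient \<open>n + 1\<close>. With \<rho> the Gauss density and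
  \<open>b = gk_branch n\<close>, the weight \<open>gk_weight n s\<close> equals
  \<open>|b'(s)| \<rho>(b(s)) / \<rho>(s)\<close>, so the operator below is the transfer operator
  normalised to fix constants.\<close>

definition gk_branch :: "nat \<Rightarrow> real \<Rightarrow> real" where
  "gk_branch n s = 1 / (s + n + 1)"

text \<open>The coefficient \<open>a\<close> multiplies by a function of the digit:
  \<open>a = 1\<close> gives the transfer operator, \<open>a n = e^(it F n)\<close> its
  perturbation, and \<open>a = F\<close> or \<open>a = F^2 / 2\<close> the coefficients in the
  expansion of that perturbation in powers of \<open>it\<close>.\<close>

definition gk_op :: "(nat \<Rightarrow> 'a) \<Rightarrow> (real \<Rightarrow> 'a) \<Rightarrow> real \<Rightarrow> 'a::{real_normed_field,banach}" where
  "gk_op a g s = (\<Sum>n. of_real (gk_weight n s) * (a n * g (gk_branch n s)))"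

text \<open>The reference state 0 is an arbitrary choice, since weights at different states agree up
  to constant factors. \<open>gauss_integral_digit\<close> and
  \<open>wsummable_if_integrable\<close> identify the condition with integrability of
  \<open>a (gk_digit x)\<close> under the Gauss measure.\<close>

definition wsummable :: "(nat \<Rightarrow> 'a::real_normed_vector) \<Rightarrow> bool" where
  "wsummable a \<longleftrightarrow> summable (\<lambda>n. gk_weight n 0 * norm (a n))"

definition wnorm :: "(nat \<Rightarrow> 'a::real_normed_vector) \<Rightarrow> real" where
  "wnorm a = (\<Sum>n. gk_weight n 0 * norm (a n))"

section \<open>Elementary estimates for weights and branches\<close>

lemma gk_weight_pos: "s \<ge> 0 \<Longrightarrow> gk_weight n s > 0"
  by (simp add: gk_weight_def)

lemma gk_weight_nonneg: "s \<ge> 0 \<Longrightarrow> gk_weight n s \<ge> 0"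
  by (simp add: gk_weight_def)

lemma gk_weight_sums:
  assumes "s \<ge> 0" shows "(\<lambda>n. gk_weight n s) sums 1"
proof -
  \<comment> \<open>Probability, at state \<open>s\<close>, of a shifted digit at least
    \<open>n\<close>; its successive differences are the weights.\<close>
  let ?T = "\<lambda>n. (1 + s) / (s + real n + 1)"
  have "?T \<longlonglongrightarrow> 0" by real_asymp
  then have "(\<lambda>n. ?T n - ?T (Suc n)) sums (?T 0 - 0)" by (rule telescope_sums')
  moreover have "?T n - ?T (Suc n) = gk_weight n s" for n
  proof -
    have "s + real n + 1 > 0" "s + real n + 2 > 0" using assms by auto
    then show ?thesis unfolding gk_weight_def by (simp add: divide_simps) (simp add: algebra_simps)
  qed
  moreover have "?T 0 - 0 = 1" using assms by (simp add: add.commute)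
  ultimately show ?thesis by (simp only:)
qed

lemma gk_weight_le:
  assumes "s \<in> {0..1}" shows "gk_weight n s \<le> 2 * gk_weight n 0"
proof -
  have "(1 + s) / ((s + n + 1) * (s + n + 2)) \<le> 2 / ((0 + real n + 1) * (0 + n + 2))"
    using assms by (intro frac_le mult_mono) auto
  also have "\<dots> = 2 * gk_weight n 0" by (simp add: gk_weight_def)
  finally show ?thesis by (simp add: gk_weight_def)
qed

lemma gk_weight_ge:
  assumes "s \<in> {0..1}" shows "gk_weight n 0 \<le> 2 * gk_weight n s"
proof -
  have frac: "1 / C \<le> B / A" if "A \<le> B * C" "A > 0" "C > 0" for A B C :: real
    using that by (simp add: field_simps)
  have "(s + n + 1) * (s + n + 2) \<le> ((1 + s) * (n + 1)) * (2 * (real n + 2))"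
    using assms by (intro mult_mono) (auto simp: algebra_simps)
  then have "(s + n + 1) * (s + n + 2) \<le> (2 * (1 + s)) * ((n + 1) * (real n + 2))"
    by (simp only: mult_ac)
  moreover have "(s + n + 1) * (s + n + 2) > 0" "(n + 1) * (real n + 2) > 0"
    using assms by (auto intro!: mult_pos_pos)
  ultimately have "1 / ((n + 1) * (real n + 2)) \<le> 2 * (1 + s) / ((s + n + 1) * (s + n + 2))"
    using frac[of "(s + n + 1) * (s + n + 2)" "2 * (1 + s)" "(n + 1) * (real n + 2)"]
    by (simp add: add.commute)
  then show ?thesis by (simp add: gk_weight_def add.commute)
qed

lemma gk_weight_lipschitz:
  assumes "s \<in> {0..1}" "r \<in> {0..1}"
  shows "\<bar>gk_weight n s - gk_weight n r\<bar> \<le> 6 * gk_weight n 0 * \<bar>s - r\<bar>"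
proof -
  \<comment> \<open>Factoring the weight as \<open>(1 + s) * al s\<close> separates two effects: the
    prefactor contributes \<open>al 0\<close>, and \<open>al\<close> contributes twice its own
    Lipschitz constant \<open>5 / 2 * al 0\<close>. Together this is the factor 6.\<close>
  define al where "al t = 1 / ((t + real n + 1) * (t + real n + 2))" for t :: real
  have al0: "0 \<le> al t" "al t \<le> al 0" if "t \<in> {0..1}" for t
    using that unfolding al_def by (auto intro!: frac_le mult_mono)
  have "al s - al r = (r - s) * ((r + s + 2 * real n + 3) * al r) * al s"
  proof -
    have "s + real n + 1 \<noteq> 0" "s + real n + 2 \<noteq> 0" "r + real n + 1 \<noteq> 0" "r + real n + 2 \<noteq> 0"
      using assms by auto
    then show ?thesis unfolding al_def
      by (simp add: divide_simps) (simp add: algebra_simps)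
  qed
  then have "\<bar>al s - al r\<bar> = \<bar>s - r\<bar> * ((r + s + 2 * real n + 3) * al r) * al s"
    using al0[OF assms(1)] al0[OF assms(2)] assms by (simp add: abs_mult abs_minus_commute)
  also have "\<dots> \<le> \<bar>s - r\<bar> * (5 / 2) * al 0"
  proof -
    have "(r + s + 2 * real n + 3) * al r \<le> (2 * real n + 5) * al 0"
      using assms al0[OF assms(2)] by (intro mult_mono) auto
    also have "\<dots> \<le> 5 / 2"
    proof -
      have "2 * (2 * real n + 5) \<le> 5 * ((real n + 1) * (real n + 2))" by (simp add: algebra_simps)
      then show ?thesis by (simp add: al_def divide_le_eq)
    qed
    finally show ?thesis using assms al0[OF assms(1)] al0[OF assms(2)] by (intro mult_mono) auto
  qed
  finally have d: "\<bar>al s - al r\<bar> \<le> \<bar>s - r\<bar> * (5 / 2) * al 0" .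
  have "gk_weight n s - gk_weight n r = (s - r) * al s + (1 + r) * (al s - al r)"
    by (simp add: gk_weight_def al_def algebra_simps add_divide_distrib diff_divide_distrib)
  then have "\<bar>gk_weight n s - gk_weight n r\<bar> \<le> \<bar>s - r\<bar> * al s + (1 + r) * \<bar>al s - al r\<bar>"
    using al0[OF assms(1)] assms by (simp add: order.trans[OF abs_triangle_ineq] abs_mult)
  also have "\<dots> \<le> \<bar>s - r\<bar> * al 0 + 2 * (\<bar>s - r\<bar> * (5 / 2) * al 0)"
    using d assms al0[OF assms(1)] by (intro add_mono mult_mono) auto
  finally show ?thesis by (simp add: al_def gk_weight_def)
qed

lemma gk_branch_in: "s \<in> {0..1} \<Longrightarrow> gk_branch n s \<in> {0..1}"
  by (auto simp: gk_branch_def)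

lemma gk_branch_diff:
  assumes "s \<in> {0..1}" "r \<in> {0..1}"
  shows "\<bar>gk_branch n s - gk_branch n r\<bar> = \<bar>s - r\<bar> / ((s + n + 1) * (r + n + 1))"
proof -
  have "s + real n + 1 > 0" "r + real n + 1 > 0" using assms by auto
  moreover from this have "gk_branch n s - gk_branch n r = (r - s) / ((s + n + 1) * (r + n + 1))"
    unfolding gk_branch_def by (simp add: divide_simps)
  ultimately show ?thesis by (simp add: abs_mult abs_minus_commute)
qed

lemma gk_branch_lipschitz:
  assumes "s \<in> {0..1}" "r \<in> {0..1}"
  shows "\<bar>gk_branch n s - gk_branch n r\<bar> \<le> \<bar>s - r\<bar>"
proof -
  have "1 * 1 \<le> (s + n + 1) * (r + real n + 1)" using assms by (intro mult_mono) auto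
  then show ?thesis unfolding gk_branch_diff[OF assms]
    by (simp add: divide_le_eq mult_le_cancel_left1)
qed

section \<open>Digit coefficients and boundedness of the operator\<close>

lemma wnorm_nonneg: "wsummable a \<Longrightarrow> wnorm a \<ge> 0"
  unfolding wnorm_def wsummable_def by (intro suminf_nonneg) (auto simp: gk_weight_nonneg)

lemma wsummable_bounded:
  assumes "\<And>n. norm (a n) \<le> B" shows "wsummable a"
  unfolding wsummable_def
proof (rule summable_comparison_test')
  show "summable (\<lambda>n. gk_weight n 0 * B)"
    using gk_weight_sums[of 0] by (intro summable_mult2) (auto simp: sums_iff)
  show "norm (gk_weight n 0 * norm (a n)) \<le> gk_weight n 0 * B" for n
    using assms gk_weight_nonneg[of 0 n] by (auto simp: abs_mult intro!: mult_left_mono)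
qed

lemma wsummable_add:
  assumes "wsummable a" "wsummable b"
  shows "wsummable (\<lambda>n. a n + b n)"
  unfolding wsummable_def
proof (rule summable_comparison_test'[OF summable_add[OF assms[unfolded wsummable_def]]])
  fix n
  have "gk_weight n 0 * norm (a n + b n) \<le> gk_weight n 0 * (norm (a n) + norm (b n))"
    by (intro mult_left_mono norm_triangle_ineq gk_weight_nonneg) simp
  then show "norm (gk_weight n 0 * norm (a n + b n)) \<le> gk_weight n 0 * norm (a n) + gk_weight n 0 * norm (b n)"
    using gk_weight_nonneg[of 0 n] by (simp add: abs_mult algebra_simps)
qed

lemma wsummable_mult:
  fixes c :: "'a::real_normed_div_algebra"
  shows "wsummable a \<Longrightarrow> wsummable (\<lambda>n. c * a n)"
  unfolding wsummable_def norm_mult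
  by (drule summable_mult[of _ "norm c"]) (simp add: mult_ac)

lemma wsummable_comparison:
  assumes "wsummable b" "\<And>n. norm (a n) \<le> norm (b n)"
  shows "wsummable a"
  unfolding wsummable_def
  by (rule summable_comparison_test'[OF assms(1)[unfolded wsummable_def], where N = 0])
     (use assms(2) gk_weight_nonneg[of 0] in \<open>auto simp: abs_mult intro!: mult_left_mono\<close>)

lemma gk_op_term:
  fixes a :: "nat \<Rightarrow> 'a::{real_normed_field,banach}"
  assumes "s \<in> {0..1}" "\<And>r. r \<in> {0..1} \<Longrightarrow> norm (g r) \<le> B"
  shows "norm (of_real (gk_weight n s) * (a n * g (gk_branch n s))) \<le> (2 * B) * (gk_weight n 0 * norm (a n))"
proof -
  have "norm (of_real (gk_weight n s) * (a n * g (gk_branch n s))) = gk_weight n s * (norm (a n) * norm (g (gk_branch n s)))"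
    using assms(1) gk_weight_nonneg[of s n] by (simp add: norm_mult)
  also have "\<dots> \<le> (2 * gk_weight n 0) * (norm (a n) * B)"
    using assms gk_weight_le[OF assms(1)] gk_branch_in[OF assms(1)] gk_weight_nonneg[of 0 n]
    by (intro mult_mono) auto
  finally show ?thesis by (simp add: mult_ac)
qed

lemma gk_op_summable:
  fixes a :: "nat \<Rightarrow> 'a::{real_normed_field,banach}"
  assumes "wsummable a" "s \<in> {0..1}" "\<And>r. r \<in> {0..1} \<Longrightarrow> norm (g r) \<le> B"
  shows "summable (\<lambda>n. norm (of_real (gk_weight n s) * (a n * g (gk_branch n s))))"
    "summable (\<lambda>n. of_real (gk_weight n s) * (a n * g (gk_branch n s)))"
proof -
  show "summable (\<lambda>n. norm (of_real (gk_weight n s) * (a n * g (gk_branch n s))))"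
    by (rule summable_comparison_test'[where N = 0, OF summable_mult[OF assms(1)[unfolded wsummable_def], of "2 * B"]])
       (unfold real_norm_def abs_norm_cancel, rule gk_op_term[OF assms(2,3)])
  then show "summable (\<lambda>n. of_real (gk_weight n s) * (a n * g (gk_branch n s)))"
    by (rule summable_norm_cancel)
qed

lemma gk_op_bound:
  fixes a :: "nat \<Rightarrow> 'a::{real_normed_field,banach}"
  assumes "wsummable a" "s \<in> {0..1}" "\<And>r. r \<in> {0..1} \<Longrightarrow> norm (g r) \<le> B"
  shows "norm (gk_op a g s) \<le> 2 * B * wnorm a"
proof -
  have "norm (gk_op a g s) \<le> (\<Sum>n. (2 * B) * (gk_weight n 0 * norm (a n)))"
    unfolding gk_op_def
    by (intro norm_suminf_le gk_op_term assms(2,3) summable_mult assms(1)[unfolded wsummable_def])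
  also have "\<dots> = 2 * B * wnorm a"
    using assms(1) by (simp add: wnorm_def wsummable_def suminf_mult)
  finally show ?thesis .
qed

text \<open>The weights at each state sum to exactly 1, so no constant is lost and the bound
  survives arbitrarily many iterations. \<open>gk_op_bound\<close>, which allows unbounded
  \<open>a\<close>, would lose a factor at each application.\<close>

lemma gk_op_contraction_sup:
  fixes a :: "nat \<Rightarrow> 'a::{real_normed_field,banach}"
  assumes "\<And>n. norm (a n) \<le> 1" "s \<in> {0..1}" "\<And>r. r \<in> {0..1} \<Longrightarrow> norm (g r) \<le> B"
  shows "norm (gk_op a g s) \<le> B"
proof -
  have B: "B \<ge> 0" using assms(3) norm_ge_zero by (metis atLeastAtMost_iff order.trans order_refl zero_le_one)
  have "norm (gk_op a g s) \<le> (\<Sum>n. gk_weight n s * B)"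
    unfolding gk_op_def
  proof (rule norm_suminf_le)
    fix n
    have "norm (of_real (gk_weight n s) * (a n * g (gk_branch n s)))
        = gk_weight n s * (norm (a n) * norm (g (gk_branch n s)))"
      using assms(2) gk_weight_nonneg[of s n] by (simp add: norm_mult)
    also have "\<dots> \<le> gk_weight n s * (1 * B)"
      using assms gk_branch_in[OF assms(2)] gk_weight_nonneg[of s n] B
      by (intro mult_mono mult_nonneg_nonneg) auto
    finally show "norm (of_real (gk_weight n s) * (a n * g (gk_branch n s))) \<le> gk_weight n s * B" by simp
  qed (use gk_weight_sums[of s] assms(2) in \<open>auto simp: sums_iff intro!: summable_mult2\<close>)
  also have "\<dots> = B"
    using gk_weight_sums[of s] assms(2) by (simp add: sums_iff suminf_mult2[symmetric])
  finally show ?thesis .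
qed

lemma gk_op_add:
  fixes a :: "nat \<Rightarrow> 'a::{real_normed_field,banach}"
  assumes "wsummable a" "s \<in> {0..1}"
    "\<And>r. r \<in> {0..1} \<Longrightarrow> norm (g r) \<le> B" "\<And>r. r \<in> {0..1} \<Longrightarrow> norm (h r) \<le> B'"
  shows "gk_op a (\<lambda>r. g r + h r) s = gk_op a g s + gk_op a h s"
  unfolding gk_op_def
  by (subst suminf_add[OF gk_op_summable(2)[OF assms(1,2,3)] gk_op_summable(2)[OF assms(1,2,4)]])
     (simp_all add: algebra_simps)

lemma gk_op_cmult:
  fixes a :: "nat \<Rightarrow> 'a::{real_normed_field,banach}"
  assumes "wsummable a" "s \<in> {0..1}" "\<And>r. r \<in> {0..1} \<Longrightarrow> norm (g r) \<le> B"
  shows "gk_op a (\<lambda>r. c * g r) s = c * gk_op a g s" "gk_op (\<lambda>n. c * a n) g s = c * gk_op a g s"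
  unfolding gk_op_def
  by (subst suminf_mult[OF gk_op_summable(2)[OF assms], symmetric]; simp add: mult_ac)+

lemma gk_op_add_weight:
  fixes a :: "nat \<Rightarrow> 'a::{real_normed_field,banach}"
  assumes "wsummable a" "wsummable b" "s \<in> {0..1}" "\<And>r. r \<in> {0..1} \<Longrightarrow> norm (g r) \<le> B"
  shows "gk_op (\<lambda>n. a n + b n) g s = gk_op a g s + gk_op b g s"
  unfolding gk_op_def
  by (subst suminf_add[OF gk_op_summable(2)[OF assms(1,3,4)] gk_op_summable(2)[OF assms(2,3,4)]])
     (simp_all add: algebra_simps)

lemma gk_op_one_const:
  fixes c :: "'a::{real_normed_field,banach}"
  assumes "s \<in> {0..1}"
  shows "gk_op (\<lambda>_. 1) (\<lambda>_. c) s = c"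
proof -
  have "(\<lambda>n. of_real (gk_weight n s) * c) sums (of_real 1 * c)"
    using gk_weight_sums[of s] assms by (intro sums_mult2 sums_of_real) auto
  then show ?thesis by (simp add: gk_op_def sums_iff)
qed

text \<open>Only weights and branches depend on the state: the former vary with constant 6, the
  latter do not expand distances and carry weights at most doubled. The coefficient enters through
  \<open>wnorm a\<close> alone, so averaging an unbounded digit function yields a Lipschitz
  function.\<close>

lemma gk_op_lipschitz:
  fixes a :: "nat \<Rightarrow> 'a::{real_normed_field,banach}"
  assumes a: "wsummable a" and B: "\<And>r. r \<in> {0..1} \<Longrightarrow> norm (g r) \<le> B" and g: "C-lipschitz_on {0..1} g"
  shows "((6 * B + 2 * C) * wnorm a)-lipschitz_on {0..1} (gk_op a g)"
proof (rule lipschitz_onI)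
  have C: "C \<ge> 0" using g by (rule lipschitz_on_nonneg)
  have B0: "B \<ge> 0" using B norm_ge_zero by (metis atLeastAtMost_iff order.trans order_refl zero_le_one)
  show "0 \<le> (6 * B + 2 * C) * wnorm a" using C B0 wnorm_nonneg[OF a] by simp
  fix s r :: real assume s: "s \<in> {0..1}" and r: "r \<in> {0..1}"
  let ?f = "\<lambda>s n. of_real (gk_weight n s) * (a n * g (gk_branch n s))"
  have "norm (?f s n - ?f r n) \<le> (6 * B + 2 * C) * \<bar>s - r\<bar> * (gk_weight n 0 * norm (a n))" for n
  proof -
    have "?f s n - ?f r n = of_real (gk_weight n s - gk_weight n r) * (a n * g (gk_branch n s))
      + of_real (gk_weight n r) * (a n * (g (gk_branch n s) - g (gk_branch n r)))"
      by (simp add: algebra_simps)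
    also have "norm \<dots> \<le> \<bar>gk_weight n s - gk_weight n r\<bar> * (norm (a n) * norm (g (gk_branch n s)))
       + gk_weight n r * (norm (a n) * norm (g (gk_branch n s) - g (gk_branch n r)))"
      using r gk_weight_nonneg[of r n] by (intro order.trans[OF norm_triangle_ineq]) (simp add: norm_mult flip: of_real_diff)
    also have "\<dots> \<le> (6 * gk_weight n 0 * \<bar>s - r\<bar>) * (norm (a n) * B) + (2 * gk_weight n 0) * (norm (a n) * (C * \<bar>s - r\<bar>))"
    proof (intro add_mono mult_mono mult_nonneg_nonneg)
      have "norm (g (gk_branch n s) - g (gk_branch n r)) \<le> C * \<bar>gk_branch n s - gk_branch n r\<bar>"
        using lipschitz_onD[OF g gk_branch_in[OF s] gk_branch_in[OF r]] by (simp add: dist_norm)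
      also have "\<dots> \<le> C * \<bar>s - r\<bar>" using gk_branch_lipschitz[OF s r] C by (intro mult_left_mono)
      finally show "norm (g (gk_branch n s) - g (gk_branch n r)) \<le> C * \<bar>s - r\<bar>" .
    qed (use gk_weight_lipschitz[OF s r] gk_weight_le[OF r] B[OF gk_branch_in[OF s]] gk_weight_nonneg[of 0] C B0 in auto)
    finally show ?thesis by (simp add: algebra_simps)
  qed
  then have "norm (\<Sum>n. ?f s n - ?f r n) \<le> (\<Sum>n. (6 * B + 2 * C) * \<bar>s - r\<bar> * (gk_weight n 0 * norm (a n)))"
    using a by (intro norm_suminf_le summable_mult) (auto simp: wsummable_def)
  also have "\<dots> = (6 * B + 2 * C) * \<bar>s - r\<bar> * wnorm a"
    using a by (subst suminf_mult) (auto simp: wsummable_def wnorm_def)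
  finally show "dist (gk_op a g s) (gk_op a g r) \<le> (6 * B + 2 * C) * wnorm a * dist s r"
    unfolding gk_op_def dist_norm
    by (subst suminf_diff[OF gk_op_summable(2)[OF a s B] gk_op_summable(2)[OF a r B]])
       (auto simp: mult_ac real_norm_def)
qed

section \<open>Contraction of Lipschitz constants\<close>

lemma cubes_suminf_bound:
  "summable (\<lambda>n. 1 / (real n + 2) ^ 3)" "(\<Sum>n. 1 / (real n + 2) ^ 3) \<le> 1 / 4"
proof -
  let ?T = "\<lambda>n. 1 / (2 * (real n + 1) * (real n + 2))"
  have T: "(\<lambda>n. ?T n - ?T (Suc n)) sums (?T 0 - 0)"
    by (rule telescope_sums') real_asymp
  \<comment> \<open>\<open>1 / ((n + 1) (n + 2) (n + 3))\<close> telescopes, and it dominates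
    \<open>1 / (n + 2)^3\<close> because \<open>(n + 1) (n + 3) \<le> (n + 2)^2\<close>; the total
    is \<open>?T 0 = 1 / 4\<close>.\<close>
  have le: "1 / (real n + 2) ^ 3 \<le> ?T n - ?T (Suc n)" for n
  proof -
    have "?T n - ?T (Suc n) = 1 / ((real n + 1) * (real n + 2) * (real n + 3))"
      by (simp add: divide_simps) (simp add: algebra_simps)
    moreover have "(real n + 1) * (real n + 2) * (real n + 3) \<le> (real n + 2) ^ 3"
      by (simp add: power3_eq_cube algebra_simps)
    ultimately show ?thesis by (simp add: frac_le)
  qed
  show s: "summable (\<lambda>n. 1 / (real n + 2) ^ 3)"
    by (rule summable_comparison_test'[OF sums_summable[OF T], where N = 0]) (use le in auto)
  show "(\<Sum>n. 1 / (real n + 2) ^ 3) \<le> 1 / 4"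
    using suminf_le[OF le s sums_summable[OF T]] sums_unique[OF T] by simp
qed

lemma abel_summation:
  fixes D :: "nat \<Rightarrow> 'a::real_normed_field"
  assumes "D 0 = 0"
  shows "(\<Sum>n<Suc N. (D (Suc n) - D n) * G n) = D (Suc N) * G N - (\<Sum>n<N. D (Suc n) * (G (Suc n) - G n))"
  using assms by (induction N) (auto simp: algebra_simps)

text \<open>The kernel is a quantile coupling: \<open>(1 + s) / (s + n + 1)\<close> is the probability that the digit
  exceeds \<open>n\<close>, it is increasing in \<open>s\<close>, and summation by parts moves the difference of the two
  digit laws onto the increments of \<open>g\<close> between neighbouring branches.\<close>

lemma gk_op_contraction:
  fixes g :: "real \<Rightarrow> 'a::{real_normed_field,banach}"
  assumes g: "C-lipschitz_on {0..1} g"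
  shows "(7 / 8 * C)-lipschitz_on {0..1} (gk_op (\<lambda>_. 1) g)"
proof (rule lipschitz_onI)
  have C: "C \<ge> 0" using g by (rule lipschitz_on_nonneg)
  then show "0 \<le> 7 / 8 * C" by simp
  have gd: "norm (g x - g y) \<le> C * \<bar>x - y\<bar>" if "x \<in> {0..1}" "y \<in> {0..1}" for x y
    using lipschitz_onD[OF g that] by (simp add: dist_norm)
  have gb: "norm (g x) \<le> norm (g 0) + C" if "x \<in> {0..1}" for x
  proof -
    have "norm (g x) \<le> norm (g 0) + norm (g x - g 0)" by (metis add.commute diff_add_cancel norm_triangle_ineq)
    also have "\<dots> \<le> norm (g 0) + C * 1"
      using that C by (intro add_left_mono order.trans[OF gd] mult_left_mono) auto
    finally show ?thesis by simp
  qed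
  have one: "wsummable (\<lambda>_. 1 :: 'a)" by (rule wsummable_bounded[of _ 1]) simp
  have *: "norm (gk_op (\<lambda>_. 1) g s - gk_op (\<lambda>_. 1) g r) \<le> 7 / 8 * C * (r - s)"
    if s: "s \<in> {0..1}" and r: "r \<in> {0..1}" and sr: "s \<le> r" for s r
  proof -
    let ?w = gk_weight and ?b = gk_branch
    have sums: "(\<lambda>n. of_real (?w n s) * g (?b n s)) sums gk_op (\<lambda>_. 1) g s"
      "(\<lambda>n. of_real (?w n r) * g (?b n r)) sums gk_op (\<lambda>_. 1) g r"
      using gk_op_summable(2)[where g = g, OF one s gb] gk_op_summable(2)[where g = g, OF one r gb]
      by (simp_all add: gk_op_def summable_sums)
    have w1: "(\<lambda>n. ?w n s) sums 1" using gk_weight_sums[of s] s by simp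
    \<comment> \<open>First contribution: same digit law, different branch points. As
      \<open>s \<le> r\<close>, these are at distance at most
      \<open>(r - s) / (s + n + 1)^2\<close>.\<close>
    have bd: "norm (of_real (?w n s) * (g (?b n s) - g (?b n r))) \<le> ?w n s * (C * (r - s) * (1 / (s + n + 1)\<^sup>2))" for n
    proof -
      have "norm (g (?b n s) - g (?b n r)) \<le> C * (\<bar>s - r\<bar> / ((s + n + 1) * (r + n + 1)))"
        using gd[OF gk_branch_in[OF s, of n] gk_branch_in[OF r, of n]] by (simp only: gk_branch_diff[OF s r])
      also have "\<dots> \<le> C * (\<bar>s - r\<bar> / ((s + n + 1) * (s + n + 1)))"
        using C s r sr by (intro mult_left_mono divide_left_mono) (auto intro!: mult_pos_pos)
      also have "\<dots> = C * (r - s) * (1 / (s + n + 1)\<^sup>2)" using sr by (simp add: power2_eq_square)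
      finally have "gk_weight n s * norm (g (?b n s) - g (?b n r)) \<le> gk_weight n s * (C * (r - s) * (1 / (s + n + 1)\<^sup>2))"
        using gk_weight_nonneg[of s n] s by (intro mult_left_mono) auto
      then show ?thesis using gk_weight_nonneg[of s n] s by (simp add: norm_mult)
    qed
    \<comment> \<open>Majorant of the contraction factors: at most 1 on the branch
      \<open>n = 0\<close> and at most \<open>1 / 4\<close> on all others. As branch 0 has weight
      \<open>1 / (s + 2) \<le> 1 / 2\<close>, the average factor is at most
      \<open>3 / 8 + 1 / 4 = 5 / 8\<close>.\<close>
    define e where "e n = (if n = 0 then 3 / 4 * ?w 0 s else 0) + 1 / 4 * ?w n s" for n
    have e: "e sums (3 / 4 * ?w 0 s + 1 / 4 * 1)"
      unfolding e_def using w1 sums_single[of 0 "\<lambda>_. 3 / 4 * ?w 0 s"] by (intro sums_add sums_mult) (simp_all add: eq_commute)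
    have bd2: "?w n s * (C * (r - s) * (1 / (s + n + 1)\<^sup>2)) \<le> C * (r - s) * e n" for n
    proof -
      have "?w n s * (1 / (s + n + 1)\<^sup>2) \<le> e n"
      proof (cases n)
        case 0
        then have "1 / (s + n + 1)\<^sup>2 \<le> 1" using s by (simp add: divide_le_eq)
        then have "?w n s * (1 / (s + n + 1)\<^sup>2) \<le> ?w n s * 1"
          using gk_weight_nonneg[of s n] s by (intro mult_left_mono) auto
        then show ?thesis using 0 by (simp add: e_def)
      next
        case (Suc m)
        have "2\<^sup>2 \<le> (s + n + 1)\<^sup>2" using s Suc by (intro power_mono) auto
        then have "1 / (s + n + 1)\<^sup>2 \<le> 1 / 4" using s by (intro frac_le) auto
        then have "?w n s * (1 / (s + n + 1)\<^sup>2) \<le> ?w n s * (1 / 4)"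
          using gk_weight_nonneg[of s n] s by (intro mult_left_mono) auto
        then show ?thesis using Suc by (simp add: e_def)
      qed
      then have "C * (r - s) * (?w n s * (1 / (s + n + 1)\<^sup>2)) \<le> C * (r - s) * e n"
        using C sr by (intro mult_left_mono) auto
      then show ?thesis by (simp add: mult_ac)
    qed
    have e58: "3 / 4 * ?w 0 s + 1 / 4 * 1 \<le> 5 / 8"
    proof -
      have "?w 0 s = 1 / (s + 2)" using s by (simp add: gk_weight_def add.commute)
      also have "\<dots> \<le> 1 / 2" using s by (intro frac_le) auto
      finally show ?thesis by simp
    qed
    have bound1: "norm (of_real (?w n s) * (g (?b n s) - g (?b n r))) \<le> C * (r - s) * e n" for n
      using bd[of n] bd2[of n] by (rule order.trans)
    have sum_e: "summable (\<lambda>n. C * (r - s) * e n)" using e by (intro summable_mult) (auto simp: sums_iff)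
    have s1: "summable (\<lambda>n. of_real (?w n s) * (g (?b n s) - g (?b n r)))"
      by (rule summable_comparison_test'[OF sum_e bound1])
    have p1: "norm (\<Sum>n. of_real (?w n s) * (g (?b n s) - g (?b n r))) \<le> C * (r - s) * (5 / 8)"
    proof -
      have "norm (\<Sum>n. of_real (?w n s) * (g (?b n s) - g (?b n r))) \<le> (\<Sum>n. C * (r - s) * e n)"
        by (rule norm_suminf_le[OF bound1 sum_e])
      also have "\<dots> = C * (r - s) * (3 / 4 * ?w 0 s + 1 / 4 * 1)"
        using e by (simp add: suminf_mult sums_iff)
      also have "\<dots> \<le> C * (r - s) * (5 / 8)" using e58 C sr by (intro mult_left_mono) auto
      finally show ?thesis .
    qed
    \<comment> \<open>Difference, between the states \<open>r\<close> and \<open>s\<close>, of the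
      probabilities of a shifted digit at least \<open>n\<close>. Hence \<open>D 0 = 0\<close>, and
      the increments of \<open>D\<close> are differences of weights.\<close>
    define D where "D n = real n * (r - s) / ((s + n + 1) * (r + n + 1))" for n
    have D: "D (Suc n) - D n = ?w n s - ?w n r" for n
    proof -
      have D_eq: "D m = (1 + r) / (r + m + 1) - (1 + s) / (s + m + 1)" for m
      proof -
        have "s + real m + 1 \<noteq> 0" "r + real m + 1 \<noteq> 0" using s r by auto
        then show ?thesis unfolding D_def by (simp add: divide_simps) (simp add: algebra_simps)
      qed
      have w_eq: "?w n t = (1 + t) / (t + n + 1) - (1 + t) / (t + Suc n + 1)" if "t \<in> {0..1}" for t
      proof -
        have "t + real n + 1 \<noteq> 0" "t + real n + 2 \<noteq> 0" using that by auto
        then show ?thesis unfolding gk_weight_def by (simp add: divide_simps) (simp add: algebra_simps)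
      qed
      show ?thesis unfolding D_eq w_eq[OF s] w_eq[OF r] by simp
    qed
    define G where "G n = g (?b n r)" for n
    \<comment> \<open>Second contribution: same branch points, different digit laws. Neighbouring
      branch points are at most \<open>1 / ((n + 1) (n + 2))\<close> apart, which against
      \<open>D (Suc n)\<close> leaves inverse cubes of total at most \<open>1 / 4\<close>; with
      \<open>5 / 8\<close> this makes \<open>7 / 8\<close>.\<close>
    have Dle: "D (Suc n) * norm (G (Suc n) - G n) \<le> C * (r - s) * (1 / (real n + 2) ^ 3)" for n
    proof -
      have "norm (G (Suc n) - G n) \<le> C * \<bar>?b (Suc n) r - ?b n r\<bar>"
        unfolding G_def by (rule gd[OF gk_branch_in[OF r] gk_branch_in[OF r]])
      also have "\<bar>?b (Suc n) r - ?b n r\<bar> = 1 / ((r + n + 1) * (r + n + 2))"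
      proof -
        have "r + real n + 1 > 0" "r + real n + 2 > 0" using r by auto
        then have "?b (Suc n) r - ?b n r = - 1 / ((r + n + 1) * (r + n + 2))"
          unfolding gk_branch_def by (simp add: divide_simps)
        then show ?thesis using \<open>r + real n + 1 > 0\<close> \<open>r + real n + 2 > 0\<close> by simp
      qed
      also have "\<dots> \<le> 1 / ((real n + 1) * (real n + 2))" using r by (intro frac_le mult_mono) auto
      finally have 1: "norm (G (Suc n) - G n) \<le> C * (1 / ((real n + 1) * (real n + 2)))" using C by (simp add: mult_left_mono)
      have frac4: "x * d / (y * y) * (C * (1 / (x * y))) = C * d * (1 / y ^ 3)" if "x \<noteq> 0" "y \<noteq> 0" for x y d :: real
        using that by (simp add: power3_eq_cube divide_simps)
      have 2: "D (Suc n) \<le> (real n + 1) * (r - s) / ((real n + 2) * (real n + 2))"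
        unfolding D_def using s r sr by (intro frac_le mult_mono) auto
      have "D (Suc n) * norm (G (Suc n) - G n)
        \<le> ((real n + 1) * (r - s) / ((real n + 2) * (real n + 2))) * (C * (1 / ((real n + 1) * (real n + 2))))"
        using 1 2 sr by (intro mult_mono) auto
      also have "\<dots> = C * (r - s) * (1 / (real n + 2) ^ 3)"
        using frac4[of "real n + 1" "real n + 2" "r - s"] by simp
      finally show ?thesis .
    qed
    have D0: "D n \<ge> 0" for n unfolding D_def using s r sr by simp
    \<comment> \<open>Summation by parts on a finite sum leaves the boundary term
      \<open>D (Suc N) * G N\<close>. It is kept explicit and disappears only in the limit, because
      \<open>D\<close> tends to 0.\<close>
    have partial: "norm (\<Sum>n<Suc N. of_real (D (Suc n) - D n) * G n)
        \<le> D (Suc N) * (norm (g 0) + C) + C * (r - s) * (1 / 4)" for N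
    proof -
      have "norm (\<Sum>n<Suc N. of_real (D (Suc n) - D n) * G n)
        = norm (of_real (D (Suc N)) * G N - (\<Sum>n<N. of_real (D (Suc n)) * (G (Suc n) - G n)))"
        using abel_summation[of "\<lambda>n. of_real (D n)" G N] by (simp add: D_def)
      also have "\<dots> \<le> norm (of_real (D (Suc N)) * G N) + norm (\<Sum>n<N. of_real (D (Suc n)) * (G (Suc n) - G n))"
        by (rule norm_triangle_ineq4)
      also have "\<dots> \<le> D (Suc N) * (norm (g 0) + C) + (\<Sum>n<N. C * (r - s) * (1 / (real n + 2) ^ 3))"
      proof (intro add_mono)
        show "norm (of_real (D (Suc N)) * G N) \<le> D (Suc N) * (norm (g 0) + C)"
          using D0 gb[OF gk_branch_in[OF r]] by (auto simp: norm_mult G_def intro!: mult_left_mono)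
        show "norm (\<Sum>n<N. of_real (D (Suc n)) * (G (Suc n) - G n)) \<le> (\<Sum>n<N. C * (r - s) * (1 / (real n + 2) ^ 3))"
          using Dle D0 by (intro sum_norm_le) (simp add: norm_mult)
      qed
      also have "(\<Sum>n<N. C * (r - s) * (1 / (real n + 2) ^ 3)) \<le> C * (r - s) * (1 / 4)"
      proof -
        have "(\<Sum>n<N. 1 / (real n + 2) ^ 3) \<le> 1 / 4"
          using sum_le_suminf[OF cubes_suminf_bound(1), of "{..<N}"] cubes_suminf_bound(2) by simp
        then have "C * (r - s) * (\<Sum>n<N. 1 / (real n + 2) ^ 3) \<le> C * (r - s) * (1 / 4)"
          using C sr by (intro mult_left_mono) auto
        then show ?thesis by (simp add: sum_distrib_left)
      qed
      finally show ?thesis by simp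
    qed
    have s2: "(\<lambda>n. of_real (D (Suc n) - D n) * G n) sums
       (gk_op (\<lambda>_. 1) g s - gk_op (\<lambda>_. 1) g r - (\<Sum>n. of_real (?w n s) * (g (?b n s) - g (?b n r))))"
    proof -
      have "of_real (D (Suc n) - D n) * G n = of_real (?w n s) * g (?b n s) - of_real (?w n r) * g (?b n r)
        - of_real (?w n s) * (g (?b n s) - g (?b n r))" for n
        by (simp add: D G_def algebra_simps)
      then show ?thesis
        using sums_diff[OF sums_diff[OF sums] summable_sums[OF s1]] by simp
    qed
    let ?R = "gk_op (\<lambda>_. 1) g s - gk_op (\<lambda>_. 1) g r - (\<Sum>n. of_real (?w n s) * (g (?b n s) - g (?b n r)))"
    have "norm ?R \<le> 0 * (norm (g 0) + C) + C * (r - s) * (1 / 4)"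
    proof (rule LIMSEQ_le)
      have "(\<lambda>N. \<Sum>n<Suc N. of_real (D (Suc n) - D n) * G n) \<longlonglongrightarrow> ?R"
        using s2 unfolding sums_def by (rule LIMSEQ_Suc)
      then show "(\<lambda>N. norm (\<Sum>n<Suc N. of_real (D (Suc n) - D n) * G n)) \<longlonglongrightarrow> norm ?R"
        by (rule tendsto_norm)
      have "(\<lambda>N. D (Suc N)) \<longlonglongrightarrow> 0" unfolding D_def by real_asymp
      then show "(\<lambda>N. D (Suc N) * (norm (g 0) + C) + C * (r - s) * (1 / 4)) \<longlonglongrightarrow> 0 * (norm (g 0) + C) + C * (r - s) * (1 / 4)"
        by (intro tendsto_intros)
    qed (use partial in blast)
    moreover have "gk_op (\<lambda>_. 1) g s - gk_op (\<lambda>_. 1) g r = ?R + (\<Sum>n. of_real (?w n s) * (g (?b n s) - g (?b n r)))" by simp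
    ultimately have "norm (gk_op (\<lambda>_. 1) g s - gk_op (\<lambda>_. 1) g r) \<le> C * (r - s) * (1 / 4) + C * (r - s) * (5 / 8)"
      using p1 norm_triangle_ineq[of ?R "\<Sum>n. of_real (?w n s) * (g (?b n s) - g (?b n r))"] by simp
    moreover have "x * (1 / 4) + x * (5 / 8) = 7 / 8 * x" for x :: real by simp
    ultimately show ?thesis by (simp only: mult.assoc)
  qed
  fix s r :: real assume "s \<in> {0..1}" "r \<in> {0..1}"
  then show "dist (gk_op (\<lambda>_. 1) g s) (gk_op (\<lambda>_. 1) g r) \<le> 7 / 8 * C * dist s r"
    using *[of s r] *[of r s] by (cases "s \<le> r") (auto simp: dist_norm norm_minus_commute)
qed

section \<open>Change of variables for the Gauss measure\<close>

lemma nn_integral_gauss_measure: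
  assumes [measurable]: "F \<in> borel_measurable borel"
  shows "(\<integral>\<^sup>+x. F x \<partial>gauss_measure)
    = (\<integral>\<^sup>+x. F x * ennreal (1 / (ln 2 * (1 + x))) * indicator {0<..1} x \<partial>lborel)"
proof -
  have [measurable]: "(\<lambda>x::real. ennreal (1 / (ln 2 * (1 + x)))) \<in> borel_measurable (restrict_space lborel {0<..1})"
    "F \<in> borel_measurable (restrict_space lborel {0<..1})"
    by (intro measurable_restrict_space1; measurable)+
  have "(\<integral>\<^sup>+x. F x \<partial>gauss_measure) = (\<integral>\<^sup>+x. ennreal (1 / (ln 2 * (1 + x))) * F x \<partial>restrict_space lborel {0<..1})"
    unfolding gauss_measure_def by (rule nn_integral_density; measurable)
  then show ?thesis by (simp only: nn_integral_restrict_space sets_lborel) (simp add: nn_integral_restrict_space mult.commute)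
qed

lemma measurable_gk_weight [measurable]: "gk_weight n \<in> borel_measurable borel"
  unfolding gk_weight_def by measurable

lemma measurable_gk_branch [measurable]: "gk_branch n \<in> borel_measurable borel"
  unfolding gk_branch_def by measurable

lemma nn_integral_gauss_branch:
  assumes [measurable]: "A \<in> sets borel"
  shows "(\<integral>\<^sup>+s. ennreal (gk_weight n s) * indicator A (gk_branch n s) \<partial>gauss_measure)
    = (\<integral>\<^sup>+x. indicator {1 / (real n + 2)<..1 / (real n + 1)} x * indicator A x \<partial>gauss_measure)"
proof -
  define f where "f x = (indicator A x :: ennreal) * ennreal (1 / (ln 2 * (1 + x)))" for x :: real
  have [measurable]: "f \<in> borel_measurable borel" unfolding f_def by measurable
  \<comment> \<open>The inverse branch is decreasing, whereas the substitution rule wants an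
    increasing map; hence the parameter \<open>r = 1 - s\<close>, undone further on by an affine
    reflection.\<close>
  let ?g = "\<lambda>r. 1 / (real n + 2 - r)" and ?g' = "\<lambda>r. 1 / (real n + 2 - r)\<^sup>2"
  have "(\<integral>\<^sup>+x. indicator {1 / (real n + 2)<..1 / (real n + 1)} x * indicator A x \<partial>gauss_measure)
    = (\<integral>\<^sup>+x. f x * indicator {?g 0..?g 1} x \<partial>lborel)"
    unfolding f_def
  proof (subst nn_integral_gauss_measure, measurable, rule nn_integral_cong_AE, rule AE_mp[OF AE_lborel_singleton[of "?g 0"]], rule AE_I2, rule impI)
    fix x :: real assume x: "x \<noteq> ?g 0"
    have g01: "?g 0 = 1 / (real n + 2)" "?g 1 = 1 / (real n + 1)" by simp_all
    have "0 < 1 / (real n + 2)" "1 / (real n + 1) \<le> 1" by auto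
    then have "x \<in> {1 / (real n + 2)<..1 / (real n + 1)} \<and> x \<in> {0<..1} \<longleftrightarrow> x \<in> {?g 0..?g 1}"
      using x unfolding g01 greaterThanAtMost_iff atLeastAtMost_iff by (smt (verit))
    then have "indicator {1 / (real n + 2)<..1 / (real n + 1)} x * indicator {0<..1} x = (indicator {?g 0..?g 1} x :: ennreal)"
      unfolding indicator_def by (auto simp: add.commute)
    note eq = this
    have "p * q * r * t = q * r * (p * t)" for p q r t :: ennreal by (simp only: mult_ac)
    from this[of "indicator {1 / (real n + 2)<..1 / (real n + 1)} x" "indicator A x" "ennreal (1 / (ln 2 * (1 + x)))" "indicator {0<..1} x", unfolded eq]
    show "indicator {1 / (real n + 2)<..1 / (real n + 1)} x * indicator A x * ennreal (1 / (ln 2 * (1 + x))) * indicator {0<..1} x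
      = indicator A x * ennreal (1 / (ln 2 * (1 + x))) * indicator {?g 0..?g 1} x"
      .
  qed
  also have "\<dots> = (\<integral>\<^sup>+r. f (?g r) * ennreal (?g' r) * indicator {0..1} r \<partial>lborel)"
  proof (rule nn_integral_substitution_aux)
    show "(?g has_real_derivative ?g' x) (at x)" if "x \<in> {0..1}" for x
      using that by (auto intro!: derivative_eq_intros simp: power2_eq_square)
    show "continuous_on {0..1} ?g'" by (intro continuous_intros) auto
  qed auto
  also have "\<dots> = (\<integral>\<^sup>+s. f (?g (1 + -1 * s)) * ennreal (?g' (1 + -1 * s)) * indicator {0..1} (1 + -1 * s) \<partial>lborel)"
    by (subst nn_integral_real_affine[where c = "-1" and t = 1]) auto
  also have "\<dots> = (\<integral>\<^sup>+s. (ennreal (gk_weight n s) * indicator A (gk_branch n s)) * ennreal (1 / (ln 2 * (1 + s))) * indicator {0<..1} s \<partial>lborel)"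
  proof (intro nn_integral_cong_AE AE_I[where N = "{0}"] subsetI)
    fix s assume s: "s \<in> {s \<in> space lborel. f (?g (1 + -1 * s)) * ennreal (?g' (1 + -1 * s)) * indicator {0..1} (1 + -1 * s)
       \<noteq> (ennreal (gk_weight n s) * indicator A (gk_branch n s)) * ennreal (1 / (ln 2 * (1 + s))) * indicator {0<..1} s}"
    show "s \<in> {0}"
    proof (rule ccontr)
      assume s0: "s \<notin> {0}"
      have "s \<in> {0<..1}" using s s0 by (cases "0 < s"; cases "s \<le> 1") (auto simp: indicator_def)
      then have pos: "s + real n + 1 > 0" "s + real n + 2 > 0" "s > 0" by auto
      have eq: "?g (1 + -1 * s) = gk_branch n s" by (simp add: gk_branch_def algebra_simps)
      \<comment> \<open>Density at the branch point times the Jacobian equals weight times density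
        at \<open>s\<close>; this identity dictates the form of \<open>gk_weight\<close>.\<close>
      have "1 / (ln 2 * (1 + gk_branch n s)) * ?g' (1 + -1 * s) = gk_weight n s * (1 / (ln 2 * (1 + s)))"
      proof -
        have "1 + gk_branch n s = (s + n + 2) / (s + n + 1)"
          unfolding gk_branch_def using pos by (simp add: field_simps)
        note e1 = this
        have e2: "?g' (1 + -1 * s) = 1 / (s + n + 1)\<^sup>2" by (simp add: algebra_simps)
        have e3: "1 / (L * (q / p)) * (1 / p\<^sup>2) = d / (p * q) * (1 / (L * d))"
          if "p > 0" "q > 0" "d > 0" "L > 0" for p q d L :: real
          using that by (simp add: power2_eq_square divide_simps)
        show ?thesis unfolding gk_weight_def e1 e2 by (rule e3) (use pos in auto)
      qed
      moreover have "1 / (ln 2 * (1 + gk_branch n s)) \<ge> 0" using pos by (simp add: gk_branch_def)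
      moreover have "gk_weight n s \<ge> 0" using pos by (simp add: gk_weight_def)
      ultimately have "ennreal (1 / (ln 2 * (1 + gk_branch n s))) * ennreal (?g' (1 + -1 * s))
          = ennreal (gk_weight n s) * ennreal (1 / (ln 2 * (1 + s)))"
        by (metis ennreal_mult' mult.commute)
      then have "f (?g (1 + -1 * s)) * ennreal (?g' (1 + -1 * s)) = ennreal (gk_weight n s) * indicator A (gk_branch n s) * ennreal (1 / (ln 2 * (1 + s)))"
        unfolding eq f_def by (metis mult.commute mult.left_commute)
      then show False using s \<open>s \<in> {0<..1}\<close> by (auto simp: indicator_def)
    qed
  qed auto
  also have "\<dots> = (\<integral>\<^sup>+s. ennreal (gk_weight n s) * indicator A (gk_branch n s) \<partial>gauss_measure)"
    by (rule nn_integral_gauss_measure[symmetric]) measurable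
  finally show ?thesis by simp
qed

lemma measurable_gauss_measure:
  "F \<in> measurable borel N \<Longrightarrow> F \<in> measurable gauss_measure N"
  by (subst measurable_cong_sets[OF sets_gauss_measure refl]) (rule measurable_restrict_space1)

lemma measurable_gk_op [measurable]:
  fixes g :: "real \<Rightarrow> 'a::{real_normed_field,banach,second_countable_topology}"
  assumes [measurable]: "g \<in> borel_measurable borel"
  shows "gk_op a g \<in> borel_measurable borel"
  unfolding gk_op_def by measurable

lemma AE_gauss_measure_neq: "AE x in gauss_measure. x \<noteq> c"
proof (cases "c \<in> {0<..1}")
  case True
  have "emeasure gauss_measure {c} = (\<integral>\<^sup>+x. indicator {c} x \<partial>gauss_measure)"
    using True by (subst nn_integral_indicator) (auto simp: sets_gauss_measure sets_restrict_space_iff)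
  also have "\<dots> = (\<integral>\<^sup>+x. indicator {c} x * ennreal (1 / (ln 2 * (1 + x))) * indicator {0<..1} x \<partial>lborel)"
    by (rule nn_integral_gauss_measure) measurable
  also have "\<dots> = (\<integral>\<^sup>+x. 0 \<partial>(lborel :: real measure))"
    by (intro nn_integral_cong_AE AE_I[where N = "{c}"]) (auto simp: indicator_def)
  finally have "emeasure gauss_measure {c} = 0" by simp
  then show ?thesis using True
    by (intro AE_I[where N = "{c}"]) (auto simp: sets_gauss_measure sets_restrict_space_iff)
next
  case False
  then show ?thesis by (intro AE_I2) (auto simp: space_gauss_measure)
qed

text \<open>The indicator identity of \<open>nn_integral_gauss_branch\<close> is recast as an
  equality of image measures, so that integrability and Bochner integrals of vector-valued functions
  transfer at one stroke.\<close>

lemma distr_gauss_branch: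
  "distr (density gauss_measure (\<lambda>s. ennreal (gk_weight n s))) borel (gk_branch n)
    = distr (density gauss_measure (indicator {1 / (real n + 2)<..1 / (real n + 1)})) borel (\<lambda>x. x)" (is "?L = ?R")
proof (rule measure_eqI)
  have m: "gk_branch n \<in> measurable gauss_measure borel" "(\<lambda>x. x) \<in> measurable gauss_measure borel"
    "(\<lambda>s. ennreal (gk_weight n s)) \<in> borel_measurable gauss_measure"
    "indicator {1 / (real n + 2)<..1 / (real n + 1)} \<in> borel_measurable gauss_measure"
    by (rule measurable_gauss_measure; measurable)+
  fix A assume "A \<in> sets ?L"
  then have A[measurable]: "A \<in> sets borel" by simp
  have "emeasure ?L A = (\<integral>\<^sup>+s. ennreal (gk_weight n s) * indicator (gk_branch n -` A \<inter> space gauss_measure) s \<partial>gauss_measure)"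
    using measurable_sets[OF m(1) A] m(1,3) by (subst emeasure_distr) (simp_all add: emeasure_density)
  also have "\<dots> = (\<integral>\<^sup>+s. ennreal (gk_weight n s) * indicator A (gk_branch n s) \<partial>gauss_measure)"
    by (intro nn_integral_cong) (auto simp: indicator_def)
  also have "\<dots> = (\<integral>\<^sup>+x. indicator {1 / (real n + 2)<..1 / (real n + 1)} x * indicator A x \<partial>gauss_measure)"
    by (rule nn_integral_gauss_branch) fact
  also have "\<dots> = (\<integral>\<^sup>+x. indicator {1 / (real n + 2)<..1 / (real n + 1)} x * indicator ((\<lambda>x. x) -` A \<inter> space gauss_measure) x \<partial>gauss_measure)"
    by (intro nn_integral_cong) (auto simp: indicator_def)
  also have "\<dots> = emeasure ?R A"
    using measurable_sets[OF m(2) A] m(2,4) by (subst emeasure_distr) (simp_all add: emeasure_density)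
  finally show "emeasure ?L A = emeasure ?R A" .
qed simp

lemma gauss_integral_branch:
  fixes H :: "real \<Rightarrow> 'a::{banach,second_countable_topology}"
  assumes H: "H \<in> borel_measurable borel"
  shows "integrable gauss_measure (\<lambda>x. indicator {1 / (real n + 2)<..1 / (real n + 1)} x *\<^sub>R H x)
      \<longleftrightarrow> integrable gauss_measure (\<lambda>s. gk_weight n s *\<^sub>R H (gk_branch n s))"
    and "(\<integral>x. indicator {1 / (real n + 2)<..1 / (real n + 1)} x *\<^sub>R H x \<partial>gauss_measure)
      = (\<integral>s. gk_weight n s *\<^sub>R H (gk_branch n s) \<partial>gauss_measure)"
proof -
  let ?I = "{1 / (real n + 2)<..1 / (real n + 1)}"
  note [measurable] = H
  have m: "gk_branch n \<in> measurable gauss_measure borel" "(\<lambda>x. x) \<in> measurable gauss_measure borel"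
    "H \<in> measurable gauss_measure borel" "(\<lambda>s. H (gk_branch n s)) \<in> measurable gauss_measure borel"
    "gk_weight n \<in> borel_measurable gauss_measure"
    "(indicator ?I :: real \<Rightarrow> real) \<in> borel_measurable gauss_measure"
    by (rule measurable_gauss_measure; measurable)+
  have nn: "AE s in gauss_measure. 0 \<le> gk_weight n s"
    by (intro AE_I2) (auto simp: space_gauss_measure intro!: gk_weight_nonneg)
  have ind: "indicator ?I = (\<lambda>x. ennreal (indicator ?I x))" by (auto simp: indicator_def)
  note eq = distr_gauss_branch[of n, unfolded ind]
  have 1: "integrable (distr (density gauss_measure (\<lambda>s. ennreal (gk_weight n s))) borel (gk_branch n)) H
    \<longleftrightarrow> integrable gauss_measure (\<lambda>s. gk_weight n s *\<^sub>R H (gk_branch n s))"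
    using m nn H integrable_density[OF m(4,5) nn] by (subst integrable_distr_eq) auto
  have 2: "integrable (distr (density gauss_measure (\<lambda>x. ennreal (indicator ?I x))) borel (\<lambda>x. x)) H
    \<longleftrightarrow> integrable gauss_measure (\<lambda>x. indicator ?I x *\<^sub>R H x)"
    using m H integrable_density[OF m(3,6)] by (subst integrable_distr_eq) auto
  show "integrable gauss_measure (\<lambda>x. indicator ?I x *\<^sub>R H x) \<longleftrightarrow> integrable gauss_measure (\<lambda>s. gk_weight n s *\<^sub>R H (gk_branch n s))"
    using 1 2 eq by simp
  have 3: "(\<integral>x. H x \<partial>distr (density gauss_measure (\<lambda>s. ennreal (gk_weight n s))) borel (gk_branch n))
    = (\<integral>s. gk_weight n s *\<^sub>R H (gk_branch n s) \<partial>gauss_measure)"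
    using m nn H integral_density[OF m(4,5) nn] by (subst integral_distr) auto
  have 4: "(\<integral>x. H x \<partial>distr (density gauss_measure (\<lambda>x. ennreal (indicator ?I x))) borel (\<lambda>x. x))
    = (\<integral>x. indicator ?I x *\<^sub>R H x \<partial>gauss_measure)"
    using m H integral_density[OF m(3,6)] by (subst integral_distr) auto
  show "(\<integral>x. indicator ?I x *\<^sub>R H x \<partial>gauss_measure) = (\<integral>s. gk_weight n s *\<^sub>R H (gk_branch n s) \<partial>gauss_measure)"
    using 3 4 eq by simp
qed

text \<open>Digits are shifted by one here: \<open>gk_digit x = n\<close> means that the first partial quotient
  is \<open>n + 1\<close>.\<close>

definition gk_digit :: "real \<Rightarrow> nat" where "gk_digit x = nat \<lfloor>1 / x\<rfloor> - 1"

lemma measurable_gk_digit [measurable]: "gk_digit \<in> measurable borel (count_space UNIV)"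
  unfolding gk_digit_def by measurable

lemma gk_digit_eq_iff:
  assumes "x \<in> {0<..1}"
  shows "x \<in> {1 / (real n + 2)<..1 / (real n + 1)} \<longleftrightarrow> gk_digit x = n"
proof -
  have x: "x > 0" "1 / x \<ge> 1" using assms by auto
  then have fl: "\<lfloor>1 / x\<rfloor> \<ge> 1" by (simp add: le_floor_iff)
  have "x \<in> {1 / (real n + 2)<..1 / (real n + 1)} \<longleftrightarrow> real n + 1 \<le> 1 / x \<and> 1 / x < real n + 2"
    using x by (auto simp: field_simps)
  also have "\<dots> \<longleftrightarrow> \<lfloor>1 / x\<rfloor> = int n + 1" by (subst floor_eq_iff) auto
  also have "\<dots> \<longleftrightarrow> gk_digit x = n" using fl unfolding gk_digit_def by linarith
  finally show ?thesis .
qed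

text \<open>At \<open>s = 1\<close> the number \<open>1 / gk_branch n s\<close> is the integer
  \<open>n + 2\<close> and the floor jumps; that point is a null set and is discarded where the
  lemma is applied.\<close>

lemma gk_digit_branch:
  assumes "s \<in> {0<..<1}"
  shows "gk_digit (gk_branch n s) = n" "frac (1 / gk_branch n s) = s"
proof -
  have *: "1 / gk_branch n s = real_of_int (int n + 1) + s" by (simp add: gk_branch_def)
  have f: "\<lfloor>1 / gk_branch n s\<rfloor> = int n + 1" unfolding * using assms by (intro floor_unique) auto
  show "gk_digit (gk_branch n s) = n" unfolding gk_digit_def f by simp
  show "frac (1 / gk_branch n s) = s" unfolding frac_def f unfolding * by simp
qed

text \<open>Duality between composition with the Gauss map and \<open>gk_op\<close>: on the cylinder
  where the digit is \<open>n\<close>, substituting \<open>x = gk_branch n s\<close> turns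
  \<open>frac (1 / x)\<close> into \<open>s\<close>, and summation over \<open>n\<close> assembles
  the operator. Weighted summability of \<open>a\<close> justifies both exchanges of sum and
  integral.\<close>

lemma gauss_integral_op:
  fixes a :: "nat \<Rightarrow> 'a::{real_normed_field,banach,second_countable_topology}"
  assumes a: "wsummable a" and g[measurable]: "g \<in> borel_measurable borel" and G[measurable]: "G \<in> borel_measurable borel"
    and gB: "\<And>x. x \<in> {0..1} \<Longrightarrow> norm (g x) \<le> B" and GB: "\<And>x. norm (G x) \<le> B'"
  shows "integrable gauss_measure (\<lambda>x. a (gk_digit x) * g x * G (frac (1 / x)))"
    and "(\<integral>x. a (gk_digit x) * g x * G (frac (1 / x)) \<partial>gauss_measure) = (\<integral>s. gk_op a g s * G s \<partial>gauss_measure)"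
proof -
  interpret prob_space gauss_measure by (rule prob_space_gauss_measure)
  let ?I = "\<lambda>n. {1 / (real n + 2)<..1 / (real n + 1)}"
  define H where "H x = a (gk_digit x) * g x * G (frac (1 / x))" for x
  have [measurable]: "H \<in> borel_measurable borel" unfolding H_def frac_def by measurable
  define h where "h n x = indicator (?I n) x *\<^sub>R H x" for n x
  define k where "k n s = of_real (gk_weight n s) * (a n * g (gk_branch n s)) * G s" for n s
  have kint: "AE s in gauss_measure. gk_weight n s *\<^sub>R H (gk_branch n s) = k n s" for n
    using AE_gauss_measure_neq[of 1] AE_space
  proof eventually_elim
    case (elim s)
    then show ?case using gk_digit_branch[of s n] by (simp add: H_def k_def space_gauss_measure scaleR_conv_of_real)
  qed
  have [measurable]: "k n \<in> borel_measurable borel" for n unfolding k_def by measurable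
  have B': "B' \<ge> 0" by (rule order.trans[OF norm_ge_zero GB[of 0]])
  have B: "B \<ge> 0" by (rule order.trans[OF norm_ge_zero gB[of 0]]) simp
  have kb: "norm (k n s) \<le> 2 * B * (gk_weight n 0 * norm (a n)) * B'" if "s \<in> {0..1}" for n s
    using gk_op_term[where a = a and n = n, OF that gB] GB[of s] B gk_weight_nonneg[of 0 n]
    unfolding k_def norm_mult[of _ "G s"] by (intro mult_mono) auto
  have ki: "integrable gauss_measure (k n)" for n
    by (intro integrable_const_bound[where B = "2 * B * (gk_weight n 0 * norm (a n)) * B'"] AE_I2 kb measurable_gauss_measure)
       (auto simp: space_gauss_measure)
  have hi: "integrable gauss_measure (h n)" for n
    unfolding h_def
  proof (subst gauss_integral_branch)
    show "integrable gauss_measure (\<lambda>s. gk_weight n s *\<^sub>R H (gk_branch n s))"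
      using ki[of n] by (rule integrable_cong_AE_imp) (use kint[of n] in \<open>auto intro!: measurable_gauss_measure\<close>)
  qed measurable
  have h_int: "(\<integral>x. h n x \<partial>gauss_measure) = (\<integral>s. k n s \<partial>gauss_measure)" for n
    unfolding h_def
    by (subst gauss_integral_branch(2), measurable, rule integral_cong_AE)
       (use kint[of n] in \<open>auto intro!: measurable_gauss_measure\<close>)
  have hn_int: "(\<integral>x. norm (h n x) \<partial>gauss_measure) = (\<integral>s. norm (k n s) \<partial>gauss_measure)" for n
  proof -
    have "(\<integral>x. norm (h n x) \<partial>gauss_measure) = (\<integral>x. indicator (?I n) x *\<^sub>R norm (H x) \<partial>gauss_measure)"
      unfolding h_def by (intro Bochner_Integration.integral_cong) (auto simp: indicator_def)
    also have "\<dots> = (\<integral>s. norm (k n s) \<partial>gauss_measure)"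
    proof (subst gauss_integral_branch(2), measurable, rule integral_cong_AE)
      show "AE s in gauss_measure. gk_weight n s *\<^sub>R norm (H (gk_branch n s)) = norm (k n s)"
        using kint[of n] AE_space
      proof eventually_elim
        case (elim s)
        have "norm (k n s) = norm (gk_weight n s *\<^sub>R H (gk_branch n s))" by (simp only: elim(1))
        then show ?case using gk_weight_nonneg[of s n] elim(2) by (simp add: space_gauss_measure)
      qed
    qed (auto intro!: measurable_gauss_measure)
    finally show ?thesis .
  qed
  have sumk: "summable (\<lambda>n. \<integral>s. norm (k n s) \<partial>gauss_measure)"
  proof (rule summable_comparison_test')
    show "summable (\<lambda>n. 2 * B * (gk_weight n 0 * norm (a n)) * B')"
      using a unfolding wsummable_def by (intro summable_mult2 summable_mult)
    have "(\<integral>s. norm (k n s) \<partial>gauss_measure) \<le> (\<integral>s. 2 * B * (gk_weight n 0 * norm (a n)) * B' \<partial>gauss_measure)" for n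
      using ki[of n] by (intro integral_mono kb) (auto simp: space_gauss_measure)
    then show "norm (\<integral>s. norm (k n s) \<partial>gauss_measure) \<le> 2 * B * (gk_weight n 0 * norm (a n)) * B'" for n
      by (simp add: prob_space)
  qed
  have hsum: "(\<lambda>n. h n x) sums H x" "summable (\<lambda>n. norm (h n x))" if "x \<in> {0<..1}" for x
  proof -
    have "h n x = (if n = gk_digit x then H x else 0)" for n
      using gk_digit_eq_iff[OF that, of n] by (auto simp: h_def)
    then show "(\<lambda>n. h n x) sums H x" "summable (\<lambda>n. norm (h n x))"
      using sums_single[of "gk_digit x" "\<lambda>_. H x"] sums_single[of "gk_digit x" "\<lambda>_. norm (H x)"]
      by (simp_all add: if_distrib[of norm] sums_iff cong: if_cong)
  qed
  have AE1: "AE x in gauss_measure. summable (\<lambda>n. norm (h n x))"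
    by (intro AE_I2 hsum(2)) (auto simp: space_gauss_measure)
  have "integrable gauss_measure (\<lambda>x. \<Sum>n. h n x)"
    by (rule integrable_suminf[OF hi AE1]) (unfold hn_int, rule sumk)
  then show "integrable gauss_measure (\<lambda>x. a (gk_digit x) * g x * G (frac (1 / x)))"
    by (rule Bochner_Integration.integrable_cong[OF refl, THEN iffD1, rotated])
       (use hsum(1) in \<open>auto simp: space_gauss_measure sums_iff H_def\<close>)
  have ksum: "summable (\<lambda>n. norm (k n s))" "(\<Sum>n. k n s) = gk_op a g s * G s" if "s \<in> {0<..1}" for s
  proof -
    have s: "s \<in> {0..1}" using that by auto
    show "summable (\<lambda>n. norm (k n s))"
      using gk_op_summable(1)[where g = g, OF a s gB] unfolding k_def norm_mult[of _ "G s"] by (intro summable_mult2)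
    show "(\<Sum>n. k n s) = gk_op a g s * G s"
      using gk_op_summable(2)[where g = g, OF a s gB] unfolding k_def gk_op_def by (rule suminf_mult2[symmetric])
  qed
  have "(\<integral>x. a (gk_digit x) * g x * G (frac (1 / x)) \<partial>gauss_measure) = (\<integral>x. (\<Sum>n. h n x) \<partial>gauss_measure)"
    by (intro Bochner_Integration.integral_cong) (use hsum(1) in \<open>auto simp: space_gauss_measure sums_iff H_def\<close>)
  also have "\<dots> = (\<Sum>n. \<integral>x. h n x \<partial>gauss_measure)"
    by (rule integral_suminf[OF hi AE1]) (unfold hn_int, rule sumk)
  also have "\<dots> = (\<Sum>n. \<integral>s. k n s \<partial>gauss_measure)" by (simp only: h_int)
  also have "\<dots> = (\<integral>s. (\<Sum>n. k n s) \<partial>gauss_measure)"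
    by (rule integral_suminf[symmetric, OF ki _ sumk]) (intro AE_I2 ksum(1), simp add: space_gauss_measure)
  also have "\<dots> = (\<integral>s. gk_op a g s * G s \<partial>gauss_measure)"
    by (intro Bochner_Integration.integral_cong refl ksum(2)) (simp add: space_gauss_measure)
  finally show "(\<integral>x. a (gk_digit x) * g x * G (frac (1 / x)) \<partial>gauss_measure) = (\<integral>s. gk_op a g s * G s \<partial>gauss_measure)" .
qed

section \<open>Poisson equation and approximate eigenfunctions\<close>

lemma lipschitz_on_bounded:
  fixes g :: "real \<Rightarrow> 'a::real_normed_vector"
  assumes "C-lipschitz_on {0..1} g" "s \<in> {0..1}"
  shows "norm (g s) \<le> norm (g 0) + C"
proof -
  have "norm (g s - g 0) \<le> C * \<bar>s - 0\<bar>" using lipschitz_onD[OF assms, of 0] by (simp add: dist_norm)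
  also have "\<dots> \<le> C * 1" using assms lipschitz_on_nonneg[OF assms(1)] by (intro mult_left_mono) auto
  finally show ?thesis using norm_triangle_sub[of "g s" "g 0"] by simp
qed

lemma integrable_gauss_bounded:
  fixes g :: "real \<Rightarrow> 'a::{banach,second_countable_topology}"
  assumes "g \<in> borel_measurable borel" "\<And>s. s \<in> {0..1} \<Longrightarrow> norm (g s) \<le> B"
  shows "integrable gauss_measure g"
proof -
  interpret prob_space gauss_measure by (rule prob_space_gauss_measure)
  show ?thesis using assms
    by (intro integrable_const_bound[where B = B] AE_I2 measurable_gauss_measure) (auto simp: space_gauss_measure)
qed

text \<open>\<open>g s\<close> is the average of \<open>g s - g r\<close> over \<open>r\<close>, and
  \<open>{0..1}\<close> has diameter 1. For centred functions, decay of Lipschitz constants thus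
  becomes decay in the supremum norm.\<close>

lemma lipschitz_mean_zero_bound:
  fixes g :: "real \<Rightarrow> 'a::{banach,second_countable_topology}"
  assumes m: "g \<in> borel_measurable borel" and g: "C-lipschitz_on {0..1} g"
    and z: "(\<integral>x. g x \<partial>gauss_measure) = 0" and s: "s \<in> {0..1}"
  shows "norm (g s) \<le> C"
proof -
  interpret prob_space gauss_measure by (rule prob_space_gauss_measure)
  have C: "C \<ge> 0" using g by (rule lipschitz_on_nonneg)
  have i: "integrable gauss_measure g" by (rule integrable_gauss_bounded[OF m lipschitz_on_bounded[OF g]])
  then have "g s = (\<integral>r. g s - g r \<partial>gauss_measure)" by (simp add: z prob_space)
  also have "norm \<dots> \<le> (\<integral>r. C \<partial>gauss_measure)"
  proof (rule order.trans[OF integral_norm_bound integral_mono])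
    fix r assume "r \<in> space gauss_measure"
    then have r: "r \<in> {0..1}" by (auto simp: space_gauss_measure)
    have "norm (g s - g r) \<le> C * \<bar>s - r\<bar>" using lipschitz_onD[OF g s r] by (simp add: dist_norm)
    also have "\<dots> \<le> C * 1" using s r C by (intro mult_left_mono) auto
    finally show "norm (g s - g r) \<le> C" by simp
  qed (use i in auto)
  also have "\<dots> = C" by (simp add: prob_space)
  finally show ?thesis .
qed

lemma wsummable_one: "wsummable (\<lambda>_. 1 :: 'a::real_normed_algebra_1)"
  by (rule wsummable_bounded[where B = 1]) simp

text \<open>Invariance of the Gauss measure in dual form; it keeps the iterates of a centred
  function centred.\<close>

lemma gauss_integral_op_one:
  fixes g :: "real \<Rightarrow> 'a::{real_normed_field,banach,second_countable_topology}"
  assumes "g \<in> borel_measurable borel" "\<And>x. x \<in> {0..1} \<Longrightarrow> norm (g x) \<le> B"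
  shows "(\<integral>s. gk_op (\<lambda>_. 1) g s \<partial>gauss_measure) = (\<integral>x. g x \<partial>gauss_measure)"
  using gauss_integral_op(2)[where G = "\<lambda>_. 1" and B' = 1, OF wsummable_one assms(1) _ assms(2)] by simp

text \<open>Neumann series over the iterates \<open>L^j v\<close>: they stay centred, so their
  Lipschitz constants and their suprema are both at most \<open>(7 / 8)^j * C\<close>, and the
  geometric series sums to \<open>8 * C\<close>.\<close>

lemma poisson_equation:
  fixes v :: "real \<Rightarrow> 'a::{real_normed_field,banach,second_countable_topology}"
  assumes m: "v \<in> borel_measurable borel" and v: "C-lipschitz_on {0..1} v"
    and z: "(\<integral>x. v x \<partial>gauss_measure) = 0"
  obtains h where "h \<in> borel_measurable borel" "(8 * C)-lipschitz_on {0..1} h"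
    "\<And>s. s \<in> {0..1} \<Longrightarrow> norm (h s) \<le> 8 * C"
    "\<And>s. s \<in> {0..1} \<Longrightarrow> gk_op (\<lambda>_. 1) h s = h s - v s"
proof
  let ?L = "gk_op (\<lambda>_. 1 :: 'a)"
  define V where "V j = (?L ^^ j) v" for j
  have C: "C \<ge> 0" using v by (rule lipschitz_on_nonneg)
  have V_Suc: "V (Suc j) = ?L (V j)" for j by (simp add: V_def)
  have V: "V j \<in> borel_measurable borel \<and> ((7 / 8) ^ j * C)-lipschitz_on {0..1} (V j) \<and> (\<integral>x. V j x \<partial>gauss_measure) = 0" for j
  proof (induction j)
    case 0
    show ?case using m v z by (simp add: V_def)
  next
    case (Suc j)
    have "(\<integral>x. V (Suc j) x \<partial>gauss_measure) = 0"
      using Suc gauss_integral_op_one[of "V j", OF _ lipschitz_on_bounded] unfolding V_Suc by metis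
    moreover have "((7 / 8) ^ Suc j * C)-lipschitz_on {0..1} (V (Suc j))"
      using gk_op_contraction[of "(7 / 8) ^ j * C" "V j"] Suc unfolding V_Suc by (simp add: mult_ac)
    ultimately show ?case using Suc unfolding V_Suc by auto
  qed
  note Vm[measurable] = V[THEN conjunct1] and Vl = V[THEN conjunct2, THEN conjunct1]
  have Vb: "norm (V j s) \<le> (7 / 8) ^ j * C" if "s \<in> {0..1}" for j s
    using V[of j] that by (intro lipschitz_mean_zero_bound) auto
  have geo: "(\<lambda>j. (7 / 8 :: real) ^ j * K) sums (8 * K)" for K
    using sums_mult2[OF geometric_sums[of "7 / 8 :: real"], of K] by simp
  define h where "h s = (\<Sum>j. V j s)" for s
  show "h \<in> borel_measurable borel" unfolding h_def by measurable
  have sn: "summable (\<lambda>j. norm (V j s))" if "s \<in> {0..1}" for s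
    by (rule summable_comparison_test'[OF sums_summable[OF geo], where N = 0]) (use Vb[OF that] in simp)
  then have sV: "summable (\<lambda>j. V j s)" if "s \<in> {0..1}" for s
    using that by (blast intro: summable_norm_cancel)
  show hb: "norm (h s) \<le> 8 * C" if "s \<in> {0..1}" for s
    unfolding h_def using norm_suminf_le[OF Vb[OF that] sums_summable[OF geo]] sums_unique[OF geo, of C] by simp
  show "(8 * C)-lipschitz_on {0..1} h"
  proof (rule lipschitz_onI)
    fix s r :: real assume s: "s \<in> {0..1}" and r: "r \<in> {0..1}"
    have "norm (V j s - V j r) \<le> (7 / 8) ^ j * (C * \<bar>s - r\<bar>)" for j
      using lipschitz_onD[OF Vl s r, of j] by (simp add: dist_norm mult.assoc)
    then have "norm (\<Sum>j. V j s - V j r) \<le> (\<Sum>j. (7 / 8) ^ j * (C * \<bar>s - r\<bar>))"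
      by (rule norm_suminf_le) (rule sums_summable[OF geo])
    then show "dist (h s) (h r) \<le> 8 * C * dist s r"
      unfolding h_def dist_norm suminf_diff[OF sV[OF s] sV[OF r]] using sums_unique[OF geo, of "C * \<bar>s - r\<bar>"] by simp
  qed (use C in simp)
  \<comment> \<open>The operator is itself an infinite series. Instead of exchanging two series,
    \<open>?L h\<close> is approximated by \<open>?L\<close> of finite partial sums, with the
    sup-norm contraction controlling the tail.\<close>
  define H where "H J s = (\<Sum>j<J. V j s)" for J s
  have Hb: "norm (h s - H J s) \<le> 8 * ((7 / 8) ^ J * C)" if "s \<in> {0..1}" for J s
  proof -
    have "h s - H J s = (\<Sum>j. V (j + J) s)"
      unfolding h_def H_def suminf_minus_initial_segment[OF sV[OF that]] by simp
    also have "norm \<dots> \<le> (\<Sum>j. (7 / 8) ^ j * ((7 / 8) ^ J * C))"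
      by (rule norm_suminf_le[OF _ sums_summable[OF geo]]) (use Vb[OF that, of "_ + J"] in \<open>simp add: power_add mult.assoc\<close>)
    also have "\<dots> = 8 * ((7 / 8) ^ J * C)" by (rule sums_unique[OF geo, symmetric])
    finally show ?thesis .
  qed
  have HB: "norm (H J s) \<le> 8 * C + 8 * ((7 / 8) ^ J * C)" if "s \<in> {0..1}" for J s
    using Hb[OF that, of J] hb[OF that] norm_triangle_ineq4[of "h s" "h s - H J s"] by simp
  have LH: "?L (H J) s = (\<Sum>j<J. V (Suc j) s)" if "s \<in> {0..1}" for J s
  proof (induction J)
    case 0
    show ?case using gk_op_one_const[OF that, of "0::'a"] by (simp add: H_def[abs_def])
  next
    case (Suc J)
    have "?L (\<lambda>r. H J r + V J r) s = ?L (H J) s + ?L (V J) s"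
      by (rule gk_op_add[OF wsummable_one that HB Vb])
    then show ?case using Suc by (simp add: H_def[abs_def] V_Suc)
  qed
  show "?L h s = h s - v s" if s: "s \<in> {0..1}" for s
  proof -
    have "norm (?L h s - ?L (H J) s) \<le> 8 * ((7 / 8) ^ J * C)" for J
    proof -
      have "?L h s = ?L (\<lambda>r. H J r + (h r - H J r)) s" by simp
      also have "\<dots> = ?L (H J) s + ?L (\<lambda>r. h r - H J r) s"
        by (rule gk_op_add[OF wsummable_one s HB Hb])
      finally have "?L h s - ?L (H J) s = ?L (\<lambda>r. h r - H J r) s" by simp
      also have "norm \<dots> \<le> 8 * ((7 / 8) ^ J * C)" by (rule gk_op_contraction_sup[OF _ s Hb]) simp_all
      finally show ?thesis .
    qed
    note A = this
    have "(\<lambda>J. 8 * ((7 / 8) ^ J * C)) \<longlonglongrightarrow> 8 * (0 * C)"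
      by (intro tendsto_intros LIMSEQ_realpow_zero) auto
    then have "(\<lambda>J. 8 * ((7 / 8) ^ J * C)) \<longlonglongrightarrow> 0" by (rule tendsto_eq_rhs) simp
    then have "(\<lambda>J. ?L h s - ?L (H J) s) \<longlonglongrightarrow> 0"
      by (rule Lim_null_comparison[OF always_eventually[OF allI[OF A]]])
    then have "(\<lambda>J. ?L (H J) s) \<longlonglongrightarrow> ?L h s"
      using tendsto_diff[OF tendsto_const[of "?L h s"]] by fastforce
    moreover have "(\<lambda>J. ?L (H J) s) \<longlonglongrightarrow> h s - V 0 s"
    proof -
      have "(\<lambda>j. V (Suc j) s) sums ((\<Sum>j. V j s) - V 0 s)"
        using summable_sums[OF sV[OF s]] by (subst sums_Suc_iff) simp
      then show ?thesis unfolding LH[OF s] h_def sums_def .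
    qed
    ultimately show ?thesis using LIMSEQ_unique by (fastforce simp: V_def)
  qed
qed

section \<open>Iterates of an operator with an approximate eigenfunction\<close>

lemma gk_op_iterate_bound:
  fixes a :: "nat \<Rightarrow> 'a::{real_normed_field,banach}"
  assumes "\<And>n. norm (a n) \<le> 1" "\<And>r. r \<in> {0..1} \<Longrightarrow> norm (g r) \<le> B" "s \<in> {0..1}"
  shows "norm ((gk_op a ^^ n) g s) \<le> B"
  using assms(3) by (induction n arbitrary: s) (auto intro!: gk_op_contraction_sup assms(1,2))

lemma gk_op_diff:
  fixes a :: "nat \<Rightarrow> 'a::{real_normed_field,banach}"
  assumes "wsummable a" "s \<in> {0..1}"
    "\<And>r. r \<in> {0..1} \<Longrightarrow> norm (g r) \<le> B" "\<And>r. r \<in> {0..1} \<Longrightarrow> norm (h r) \<le> B'"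
  shows "gk_op a (\<lambda>r. g r - h r) s = gk_op a g s - gk_op a h s"
  unfolding gk_op_def
  by (subst suminf_diff[OF gk_op_summable(2)[where g = g, OF assms(1,2,3)] gk_op_summable(2)[where g = h, OF assms(1,2,4)]])
     (simp_all add: algebra_simps)

text \<open>\<open>L^n w - l^n w\<close> telescopes into \<open>n\<close> terms, each the residual
  of the eigenvalue equation under contractions and a power of \<open>l\<close>; replacing
  \<open>w\<close> by 1 costs \<open>e\<close> on either side. Keeping the sum of
  \<open>norm l ^ k\<close> instead of bounding it by \<open>n\<close> allows estimates uniform in
  \<open>n\<close> when \<open>norm l < 1\<close>.\<close>

lemma approximate_eigenfunction:
  fixes a :: "nat \<Rightarrow> 'a::{real_normed_field,banach}"
  assumes a: "\<And>n. norm (a n) \<le> 1" and w: "\<And>r. r \<in> {0..1} \<Longrightarrow> norm (w r - 1) \<le> e"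
    and eig: "\<And>r. r \<in> {0..1} \<Longrightarrow> norm (gk_op a w r - l * w r) \<le> d"
    and l: "norm l \<le> 1" and s: "s \<in> {0..1}"
  shows "norm ((gk_op a ^^ n) (\<lambda>_. 1) s - l ^ n) \<le> 2 * e + d * (\<Sum>k<n. norm l ^ k)"
proof -
  have as: "wsummable a" using a by (rule wsummable_bounded)
  have e: "e \<ge> 0" by (rule order.trans[OF norm_ge_zero w[of 0]]) simp
  have wb: "norm (w r) \<le> 1 + e" if "r \<in> {0..1}" for r
    using w[OF that] norm_triangle_sub[of "w r" 1] by simp
  have itw: "norm ((gk_op a ^^ n) w r) \<le> 1 + e" if "r \<in> {0..1}" for r n
    by (rule gk_op_iterate_bound[OF a wb that])
  have it1: "norm ((gk_op a ^^ n) (\<lambda>_. 1) r) \<le> 1" if "r \<in> {0..1}" for r n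
    by (rule gk_op_iterate_bound[OF a _ that]) simp
  have 1: "norm ((gk_op a ^^ n) w r - l ^ n * w r) \<le> d * (\<Sum>k<n. norm l ^ k)" if "r \<in> {0..1}" for r n
    using that
  proof (induction n arbitrary: r)
    case (Suc n)
    let ?g = "\<lambda>r. (gk_op a ^^ n) w r - l ^ n * w r"
    have gb: "norm (?g r) \<le> d * (\<Sum>k<n. norm l ^ k)" if "r \<in> {0..1}" for r by (rule Suc.IH[OF that])
    have lb: "norm (l ^ n * w r) \<le> 1 * (1 + e)" if "r \<in> {0..1}" for r
      unfolding norm_mult norm_power using wb[OF that] l by (intro mult_mono power_le_one) auto
    have "gk_op a ?g r = gk_op a ((gk_op a ^^ n) w) r - l ^ n * gk_op a w r"
      using gk_op_diff[OF as Suc.prems itw lb] gk_op_cmult(1)[OF as Suc.prems wb] by simp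
    then have "(gk_op a ^^ Suc n) w r - l ^ Suc n * w r = gk_op a ?g r + l ^ n * (gk_op a w r - l * w r)"
      by (simp add: algebra_simps)
    also have "norm \<dots> \<le> d * (\<Sum>k<n. norm l ^ k) + norm l ^ n * d"
      by (rule order.trans[OF norm_triangle_ineq add_mono[OF gk_op_contraction_sup[OF a Suc.prems gb]]])
         (auto simp: norm_mult norm_power intro!: mult_left_mono eig Suc.prems)
    finally show ?case by (simp add: algebra_simps)
  qed simp
  have 2: "norm ((gk_op a ^^ n) w r - (gk_op a ^^ n) (\<lambda>_. 1) r) \<le> e" if "r \<in> {0..1}" for r n
    using that
  proof (induction n arbitrary: r)
    case 0
    then show ?case using w by simp
  next
    case (Suc n)
    have "gk_op a (\<lambda>r. (gk_op a ^^ n) w r - (gk_op a ^^ n) (\<lambda>_. 1) r) r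
      = gk_op a ((gk_op a ^^ n) w) r - gk_op a ((gk_op a ^^ n) (\<lambda>_. 1)) r"
      by (rule gk_op_diff[OF as Suc.prems itw it1])
    moreover have "norm (gk_op a (\<lambda>r. (gk_op a ^^ n) w r - (gk_op a ^^ n) (\<lambda>_. 1) r) r) \<le> e"
      by (rule gk_op_contraction_sup[OF a Suc.prems Suc.IH])
    ultimately show ?case by simp
  qed
  have 3: "norm (l ^ n * w s - l ^ n) \<le> e"
  proof -
    have "norm (l ^ n * (w s - 1)) \<le> 1 * e"
      unfolding norm_mult norm_power using w[OF s] l by (intro mult_mono power_le_one) auto
    then show ?thesis by (simp add: algebra_simps)
  qed
  have "(gk_op a ^^ n) (\<lambda>_. 1) s - l ^ n = - ((gk_op a ^^ n) w s - (gk_op a ^^ n) (\<lambda>_. 1) s)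
     + ((gk_op a ^^ n) w s - l ^ n * w s) + (l ^ n * w s - l ^ n)" by simp
  also have "norm \<dots> \<le> e + d * (\<Sum>k<n. norm l ^ k) + e"
    using 1[OF s, of n] 2[OF s, of n] 3 by (intro norm_triangle_le add_mono) (auto simp: norm_minus_commute)
  finally show ?thesis by simp
qed

section \<open>Digit functionals: integrals, weighted norm and products along an orbit\<close>

lemma gauss_integral_digit:
  fixes a :: "nat \<Rightarrow> 'a::{real_normed_field,banach,second_countable_topology}"
  assumes "wsummable a"
  shows "integrable gauss_measure (\<lambda>x. a (gk_digit x))"
    "(\<integral>x. a (gk_digit x) \<partial>gauss_measure) = (\<integral>s. gk_op a (\<lambda>_. 1) s \<partial>gauss_measure)"
  using gauss_integral_op[OF assms, of "\<lambda>_. 1" "\<lambda>_. 1" 1 1] by simp_all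

text \<open>Weights at 0 are at most twice the weights at any other state, so at every state
  \<open>wnorm a\<close> is at most twice the operator applied to the norms; averaging over the
  state gives a mean over the first digit.\<close>

lemma wnorm_le:
  fixes a :: "nat \<Rightarrow> 'a::{real_normed_field,banach,second_countable_topology}"
  assumes a: "wsummable a"
  shows "wnorm a \<le> 2 * (\<integral>x. norm (a (gk_digit x)) \<partial>gauss_measure)"
proof -
  interpret prob_space gauss_measure by (rule prob_space_gauss_measure)
  let ?b = "\<lambda>n. norm (a n)"
  have b: "wsummable ?b" using a by (simp add: wsummable_def)
  have "wnorm a / 2 = (\<integral>s. wnorm a / 2 \<partial>gauss_measure)" by (simp add: prob_space)
  also have "\<dots> \<le> (\<integral>s. gk_op ?b (\<lambda>_. 1) s \<partial>gauss_measure)"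
  proof (rule integral_mono)
    show "integrable gauss_measure (gk_op ?b (\<lambda>_. 1))"
      by (rule integrable_gauss_bounded[where B = "2 * 1 * wnorm ?b"]) (measurable, rule gk_op_bound[OF b], auto)
    fix s assume "s \<in> space gauss_measure"
    then have s: "s \<in> {0..1}" by (auto simp: space_gauss_measure)
    have "wnorm a \<le> (\<Sum>n. 2 * (gk_weight n s * ?b n))"
      unfolding wnorm_def
    proof (rule suminf_le)
      show "gk_weight n 0 * norm (a n) \<le> 2 * (gk_weight n s * ?b n)" for n
        using mult_right_mono[OF gk_weight_ge[OF s, of n], of "?b n"] by simp
      show "summable (\<lambda>n. gk_weight n 0 * norm (a n))" using a by (simp add: wsummable_def)
      show "summable (\<lambda>n. 2 * (gk_weight n s * ?b n))"
        using gk_op_summable(2)[OF b s, of "\<lambda>_. 1" 1] by (intro summable_mult) simp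
    qed
    also have "\<dots> = 2 * gk_op ?b (\<lambda>_. 1) s"
      using gk_op_summable(2)[OF b s, of "\<lambda>_. 1" 1] by (simp add: suminf_mult gk_op_def)
    finally show "wnorm a / 2 \<le> gk_op ?b (\<lambda>_. 1) s" by simp
  qed simp
  also have "\<dots> = (\<integral>x. norm (a (gk_digit x)) \<partial>gauss_measure)"
    by (rule gauss_integral_digit(2)[OF b, symmetric])
  finally show ?thesis by simp
qed

text \<open>\<open>wnorm_le\<close> presupposes summability. It is therefore applied to the
  truncations of \<open>a\<close> to finitely many digits, which bounds all partial sums by the same
  integral.\<close>

lemma wsummable_if_integrable:
  fixes a :: "nat \<Rightarrow> 'a::{real_normed_field,banach,second_countable_topology}"
  assumes i: "integrable gauss_measure (\<lambda>x. a (gk_digit x))"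
  shows "wsummable a"
  unfolding wsummable_def
proof (rule summableI_nonneg_bounded)
  fix N
  let ?b = "\<lambda>n. if n < N then a n else 0"
  have f: "finite {n. ?b n \<noteq> 0}" by (rule finite_subset[of _ "{..<N}"]) (auto split: if_splits)
  have b: "wsummable ?b" unfolding wsummable_def by (rule summable_finite[of "{..<N}"]) auto
  have "(\<Sum>n<N. gk_weight n 0 * norm (a n)) = wnorm ?b"
    unfolding wnorm_def by (subst suminf_finite[of "{..<N}"]) auto
  also have "\<dots> \<le> 2 * (\<integral>x. norm (?b (gk_digit x)) \<partial>gauss_measure)" by (rule wnorm_le[OF b])
  also have "\<dots> \<le> 2 * (\<integral>x. norm (a (gk_digit x)) \<partial>gauss_measure)"
    using i gauss_integral_digit(1)[OF b] by (intro mult_left_mono integral_mono) auto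
  finally show "(\<Sum>n<N. gk_weight n 0 * norm (a n)) \<le> 2 * (\<integral>x. norm (a (gk_digit x)) \<partial>gauss_measure)" .
qed (simp add: gk_weight_nonneg)

text \<open>The observable \<open>G\<close> at the end of the orbit drives the induction: the last
  digit factor is absorbed into it, and duality then turns it into one more application of
  \<open>gk_op\<close>.\<close>

lemma gauss_integral_prod:
  fixes u :: "nat \<Rightarrow> 'a::{real_normed_field,banach,second_countable_topology}"
  assumes u: "\<And>n. norm (u n) \<le> 1" and G: "G \<in> borel_measurable borel" "\<And>x. norm (G x) \<le> B"
  shows "(\<integral>x. (\<Prod>k<n. u (gk_digit (((\<lambda>y. frac (1 / y)) ^^ k) x))) * G (((\<lambda>y. frac (1 / y)) ^^ n) x) \<partial>gauss_measure)
    = (\<integral>s. (gk_op u ^^ n) (\<lambda>_. 1) s * G s \<partial>gauss_measure)"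
  using G
proof (induction n arbitrary: G)
  case (Suc n)
  note [measurable] = Suc.prems(1)
  let ?T = "\<lambda>y::real. frac (1 / y)"
  let ?G = "\<lambda>s. u (gk_digit s) * G (?T s)"
  have us: "wsummable u" using u by (rule wsummable_bounded)
  have Gm: "?G \<in> borel_measurable borel" unfolding frac_def by measurable
  have Gb: "norm (?G s) \<le> B" for s
    unfolding norm_mult using mult_mono[OF u[of "gk_digit s"] Suc.prems(2)[of "?T s"]] by simp
  have Lm: "(gk_op u ^^ n) (\<lambda>_. 1) \<in> borel_measurable borel" by (induction n) auto
  have "(\<integral>x. (\<Prod>k<Suc n. u (gk_digit ((?T ^^ k) x))) * G ((?T ^^ Suc n) x) \<partial>gauss_measure)
    = (\<integral>x. (\<Prod>k<n. u (gk_digit ((?T ^^ k) x))) * ?G ((?T ^^ n) x) \<partial>gauss_measure)"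
    by (simp add: mult_ac)
  also have "\<dots> = (\<integral>s. (gk_op u ^^ n) (\<lambda>_. 1) s * ?G s \<partial>gauss_measure)" by (rule Suc.IH[OF Gm Gb])
  also have "\<dots> = (\<integral>s. u (gk_digit s) * (gk_op u ^^ n) (\<lambda>_. 1) s * G (?T s) \<partial>gauss_measure)" by (simp add: mult_ac)
  also have "\<dots> = (\<integral>s. gk_op u ((gk_op u ^^ n) (\<lambda>_. 1)) s * G s \<partial>gauss_measure)"
    by (rule gauss_integral_op(2)[OF us Lm Suc.prems(1) gk_op_iterate_bound[OF u] Suc.prems(2)]) auto
  finally show ?case by simp
qed simp

section \<open>Characteristic functions of digit sums\<close>

definition gk_iexp :: "(nat \<Rightarrow> real) \<Rightarrow> real \<Rightarrow> nat \<Rightarrow> complex" where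
  "gk_iexp F t n = iexp (t * F n)"

text \<open>By \<open>integral_iexp_sum\<close> this is the characteristic function of the sum of
  \<open>F\<close> over the first \<open>n\<close> shifted digits. The operator form serves as
  definition because the estimates concern iterates.\<close>

definition cf_char :: "(nat \<Rightarrow> real) \<Rightarrow> nat \<Rightarrow> real \<Rightarrow> complex" where
  "cf_char F n t = (\<integral>s. (gk_op (gk_iexp F t) ^^ n) (\<lambda>_. 1) s \<partial>gauss_measure)"

lemma norm_gk_iexp [simp]: "norm (gk_iexp F t n) = 1"
  by (simp add: gk_iexp_def)

section \<open>Partial quotients as digits along the orbit of the Gauss map\<close>

lemma AE_gauss_measure_irrational: "AE x in gauss_measure. x \<notin> \<rat>"
proof -
  have "AE x in gauss_measure. \<forall>q\<in>\<rat>. x \<noteq> q"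
    by (subst AE_ball_countable[OF countable_rat]) (auto intro: AE_gauss_measure_neq)
  then show ?thesis by eventually_elim auto
qed

lemma cf_digit_eq_gk_digit:
  assumes "x \<in> {0<..1}" "x \<notin> \<rat>"
  shows "cf_digit (Suc k) x = Suc (gk_digit (((\<lambda>y. frac (1 / y)) ^^ k) x))"
proof -
  have "is_cf_expansion (THE a. is_cf_expansion a x) x" by (rule theI'[OF ex1_cf_expansion[OF assms]])
  \<comment> \<open>Positivity matters because \<open>gk_digit\<close> subtracts 1 in the natural
    numbers.\<close>
  then have "cf_digit (Suc k) x \<ge> 1" by (auto simp: is_cf_expansion_def cf_digit_def)
  then show ?thesis unfolding cf_digit_eq[OF assms] gk_digit_def by simp
qed

lemma AE_sum_cf_digit:
  "AE x in gauss_measure. (\<Sum>k=1..n. f (real (cf_digit k x)))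
     = (\<Sum>k<n. f (real (Suc (gk_digit (((\<lambda>y. frac (1 / y)) ^^ k) x)))))"
  using AE_gauss_measure_irrational AE_space
proof eventually_elim
  case (elim x)
  have "(\<Sum>k=1..n. f (real (cf_digit k x))) = (\<Sum>k<n. f (real (cf_digit (Suc k) x)))"
    unfolding atLeast1_atMost_eq_remove0 by (subst sum.atLeast1_atMost_eq[symmetric]) (simp add: atLeast1_atMost_eq_remove0)
  then show ?case using elim cf_digit_eq_gk_digit[of x] by (simp add: space_gauss_measure)
qed

lemma AE_cf_digit_1: "AE x in gauss_measure. cf_digit 1 x = Suc (gk_digit x)"
  using AE_gauss_measure_irrational AE_space
  by eventually_elim (use cf_digit_eq_gk_digit[of _ 0] in \<open>simp add: space_gauss_measure\<close>)

lemma measurable_f_cf_digit: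
  fixes f :: "real \<Rightarrow> real"
  assumes "k \<ge> 1" shows "(\<lambda>x. f (real (cf_digit k x))) \<in> borel_measurable gauss_measure"
  using measurable_compose[OF measurable_cf_digit[OF assms], of "\<lambda>n. f (real n)" borel] by simp

lemma measurable_sum_cf_digit:
  fixes f :: "real \<Rightarrow> real"
  shows "(\<lambda>x. \<Sum>k=1..n. f (real (cf_digit k x))) \<in> borel_measurable gauss_measure"
  by (intro borel_measurable_sum measurable_f_cf_digit) auto

lemma measurable_gauss_map_funpow [measurable]: "(\<lambda>y::real. frac (1 / y)) ^^ k \<in> borel_measurable borel"
proof (induction k)
  case (Suc k)
  note Suc [measurable]
  have "(\<lambda>x. frac (1 / ((\<lambda>y::real. frac (1 / y)) ^^ k) x)) \<in> borel_measurable borel"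
    unfolding frac_def by measurable
  then show ?case by (simp add: comp_def)
qed (simp add: id_def)

lemma integral_iexp_sum:
  "(\<integral>x. iexp (t * (\<Sum>k=1..n. f (real (cf_digit k x)))) \<partial>gauss_measure) = cf_char (\<lambda>k. f (real (Suc k))) n t"
proof -
  let ?T = "\<lambda>y::real. frac (1 / y)" and ?u = "gk_iexp (\<lambda>k. f (real (Suc k))) t"
  have [measurable]: "(\<lambda>x. \<Sum>k=1..n. f (real (cf_digit k x))) \<in> borel_measurable gauss_measure"
    by (rule measurable_sum_cf_digit)
  have "(\<integral>x. iexp (t * (\<Sum>k=1..n. f (real (cf_digit k x)))) \<partial>gauss_measure)
    = (\<integral>x. (\<Prod>k<n. ?u (gk_digit ((?T ^^ k) x))) \<partial>gauss_measure)"
  proof (rule integral_cong_AE)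
    show "AE x in gauss_measure. iexp (t * (\<Sum>k=1..n. f (real (cf_digit k x)))) = (\<Prod>k<n. ?u (gk_digit ((?T ^^ k) x)))"
      using AE_sum_cf_digit[where f = f and n = n]
      by eventually_elim (simp add: gk_iexp_def sum_distrib_left exp_sum)
    show "(\<lambda>x. \<Prod>k<n. ?u (gk_digit ((?T ^^ k) x))) \<in> borel_measurable gauss_measure"
      by (intro measurable_gauss_measure) measurable
  qed measurable
  also have "\<dots> = cf_char (\<lambda>k. f (real (Suc k))) n t"
    using gauss_integral_prod[of ?u "\<lambda>_. 1" 1 n] by (simp add: cf_char_def)
  finally show ?thesis .
qed

lemma real_distribution_normalized_law: "real_distribution (normalized_law f c d n)"
proof -
  interpret prob_space gauss_measure by (rule prob_space_gauss_measure)
  note [measurable] = measurable_sum_cf_digit[of f n]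
  show ?thesis unfolding normalized_law_def by (rule real_distribution_distr) measurable
qed

lemma char_normalized_law:
  "char (normalized_law f c d n) t = iexp (- (t / c n * d n)) * cf_char (\<lambda>k. f (real (Suc k))) n (t / c n)"
proof -
  note [measurable] = measurable_sum_cf_digit[of f n]
  have "char (normalized_law f c d n) t = (\<integral>x. iexp (- (t / c n * d n)) * iexp (t / c n * (\<Sum>k=1..n. f (real (cf_digit k x)))) \<partial>gauss_measure)"
    unfolding char_def normalized_law_def
    by (subst integral_distr) (measurable, simp add: divide_inverse algebra_simps flip: exp_add)
  also have "\<dots> = iexp (- (t / c n * d n)) * cf_char (\<lambda>k. f (real (Suc k))) n (t / c n)"
    unfolding integral_iexp_sum[symmetric] by simp
  finally show ?thesis .
qed

text \<open>The Poisson solution \<open>h\<close> for the centred first-order term makes \<open>1 + h\<close> an eigenfunction with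
  eigenvalue \<open>\<phi>\<close> up to an error quadratic in the size \<open>\<eta>\<close> of the perturbation.\<close>

lemma cf_char_approx:
  fixes F t
  defines "\<phi> \<equiv> (\<integral>x. iexp (t * F (gk_digit x)) \<partial>gauss_measure)"
    and "\<eta> \<equiv> (\<integral>x. norm (iexp (t * F (gk_digit x)) - 1) \<partial>gauss_measure)"
  shows "norm (cf_char F n t - \<phi> ^ n) \<le> 192 * \<eta> + 480 * \<eta>\<^sup>2 * (\<Sum>k<n. norm \<phi> ^ k)"
proof -
  interpret prob_space gauss_measure by (rule prob_space_gauss_measure)
  let ?u = "gk_iexp F t"
  define a where "a k = ?u k - 1" for k
  have us: "wsummable ?u" by (rule wsummable_bounded[where B = 1]) simp
  have as: "wsummable a" unfolding a_def by (rule wsummable_bounded[where B = 2]) (use norm_triangle_ineq4[of "?u _" 1] in auto)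
  have \<eta>: "\<eta> = (\<integral>x. norm (a (gk_digit x)) \<partial>gauss_measure)" by (simp add: \<eta>_def a_def gk_iexp_def)
  have \<phi>: "\<phi> = (\<integral>x. ?u (gk_digit x) \<partial>gauss_measure)" by (simp add: \<phi>_def gk_iexp_def)
  have wa: "wnorm a \<le> 2 * \<eta>" unfolding \<eta> by (rule wnorm_le[OF as])
  have \<eta>0: "\<eta> \<ge> 0" unfolding \<eta> by simp
  note iu = gauss_integral_digit(1)[OF us]
  have \<phi>1: "\<phi> - 1 = (\<integral>x. a (gk_digit x) \<partial>gauss_measure)"
    unfolding \<phi> a_def using iu by (simp add: prob_space)
  have n1: "norm (\<phi> - 1) \<le> \<eta>" unfolding \<phi>1 \<eta> by (rule integral_norm_bound)
  have n\<phi>: "norm \<phi> \<le> 1"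
    unfolding \<phi> by (rule order.trans[OF integral_norm_bound]) (simp add: prob_space)
  define v where "v s = gk_op a (\<lambda>_. 1) s - (\<phi> - 1)" for s
  have vm: "v \<in> borel_measurable borel" unfolding v_def by measurable
  have "((6 * 1 + 2 * 0) * wnorm a)-lipschitz_on {0..1} (gk_op a (\<lambda>_. 1))"
    by (rule gk_op_lipschitz[OF as]) (auto intro: lipschitz_on_constant)
  \<comment> \<open>Constants: \<open>12 = 6 * 2\<close> because
    \<open>wnorm a \<le> 2 * \<eta>\<close>, and the Poisson solution multiplies this by 8, giving
    96. The residual below is \<open>96 + 4 * 96 = 480\<close>, and replacing \<open>w\<close> by 1
    costs \<open>2 * 96 = 192\<close>.\<close>
  then have "(12 * \<eta>)-lipschitz_on {0..1} (gk_op a (\<lambda>_. 1))"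
    by (rule lipschitz_on_le) (use wa in simp)
  then have vl: "(12 * \<eta>)-lipschitz_on {0..1} v"
    unfolding lipschitz_on_def v_def by (simp add: dist_norm)
  have vz: "(\<integral>s. v s \<partial>gauss_measure) = 0"
  proof -
    have "integrable gauss_measure (gk_op a (\<lambda>_. 1))"
      by (rule integrable_gauss_bounded[where B = "2 * 1 * wnorm a"]) (measurable, rule gk_op_bound[OF as], auto)
    then show ?thesis unfolding v_def \<phi>1 gauss_integral_digit(2)[OF as] by (simp add: prob_space)
  qed
  obtain h where h': "h \<in> borel_measurable borel" "(8 * (12 * \<eta>))-lipschitz_on {0..1} h"
    "\<And>s. s \<in> {0..1} \<Longrightarrow> norm (h s) \<le> 8 * (12 * \<eta>)"
    "\<And>s. s \<in> {0..1} \<Longrightarrow> gk_op (\<lambda>_. 1) h s = h s - v s"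
    by (rule poisson_equation[OF vm vl vz]) (rule that)
  have h: "norm (h s) \<le> 96 * \<eta>" "gk_op (\<lambda>_. 1) h s = h s - v s" if "s \<in> {0..1}" for s
    using h'(3,4)[OF that] by auto
  define w where "w = (\<lambda>s. 1 + h s)"
  have wb: "norm (w s) \<le> 1 + 96 * \<eta>" if "s \<in> {0..1}" for s
    unfolding w_def using h(1)[OF that] norm_triangle_ineq[of 1 "h s"] by simp
  have one: "norm (1::complex) \<le> 1" by simp
  have eig: "norm (gk_op ?u w s - \<phi> * w s) \<le> 480 * \<eta>\<^sup>2" if s: "s \<in> {0..1}" for s
  proof -
    have "gk_op ?u w s = gk_op (\<lambda>k. 1 + a k) w s" by (simp add: a_def)
    also have "\<dots> = gk_op (\<lambda>_. 1) w s + gk_op a w s" by (rule gk_op_add_weight[OF wsummable_one as s wb])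
    also have "gk_op (\<lambda>_. 1) w s = gk_op (\<lambda>_. 1) (\<lambda>_. 1) s + gk_op (\<lambda>_. 1) h s"
      unfolding w_def by (rule gk_op_add[OF wsummable_one s one h(1)])
    also have "\<dots> = 1 + h s - v s" using h(2)[OF s] gk_op_one_const[OF s, of "1::complex"] by simp
    also have "gk_op a w s = gk_op a (\<lambda>_. 1) s + gk_op a h s"
      unfolding w_def by (rule gk_op_add[OF as s one h(1)])
    \<comment> \<open>The Poisson equation has removed everything of first order; each remaining
      term is a product of two factors of size \<eta>.\<close>
    finally have "gk_op ?u w s - \<phi> * w s = (1 - \<phi>) * h s + gk_op a h s"
      by (simp add: v_def w_def algebra_simps)
    also have "norm \<dots> \<le> \<eta> * (96 * \<eta>) + 2 * (96 * \<eta>) * (2 * \<eta>)"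
    proof (intro norm_triangle_le add_mono)
      show "norm ((1 - \<phi>) * h s) \<le> \<eta> * (96 * \<eta>)"
        unfolding norm_mult using n1 h(1)[OF s] \<eta>0 by (intro mult_mono) (auto simp: norm_minus_commute)
      show "norm (gk_op a h s) \<le> 2 * (96 * \<eta>) * (2 * \<eta>)"
        using \<eta>0 wa by (intro order.trans[OF gk_op_bound[OF as s h(1)]] mult_left_mono) auto
    qed
    finally show ?thesis by (simp add: power2_eq_square)
  qed
  have bd: "norm ((gk_op ?u ^^ n) (\<lambda>_. 1) s - \<phi> ^ n) \<le> 2 * (96 * \<eta>) + 480 * \<eta>\<^sup>2 * (\<Sum>k<n. norm \<phi> ^ k)"
    if "s \<in> {0..1}" for s
    by (rule approximate_eigenfunction[OF _ _ eig n\<phi> that]) (auto simp: w_def h(1))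
  have Lm: "(gk_op ?u ^^ n) (\<lambda>_. 1) \<in> borel_measurable borel" by (induction n) auto
  have Li: "integrable gauss_measure ((gk_op ?u ^^ n) (\<lambda>_. 1))"
    by (rule integrable_gauss_bounded[OF Lm, where B = 1]) (rule gk_op_iterate_bound, auto)
  have "cf_char F n t - \<phi> ^ n = (\<integral>s. (gk_op ?u ^^ n) (\<lambda>_. 1) s - \<phi> ^ n \<partial>gauss_measure)"
    using Li by (simp add: cf_char_def prob_space)
  also have "norm \<dots> \<le> (\<integral>s. 2 * (96 * \<eta>) + 480 * \<eta>\<^sup>2 * (\<Sum>k<n. norm \<phi> ^ k) \<partial>gauss_measure)"
    using Li by (intro order.trans[OF integral_norm_bound integral_mono] bd) (auto simp: space_gauss_measure)
  finally show ?thesis by (simp add: prob_space)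
qed

section \<open>Finite variance\<close>

lemma gk_branch_fixed_point:
  obtains s where "s \<in> {0..1}" "gk_branch n s = s"
proof
  \<comment> \<open>The fixed point is the positive root of \<open>s^2 + (n + 1) s = 1\<close>, the
    number whose partial quotients all equal \<open>n + 1\<close>.\<close>
  let ?m = "real n + 1"
  let ?r = "sqrt (?m\<^sup>2 + 4)"
  have r2: "?r * ?r = ?m\<^sup>2 + 4" by simp
  have "?m \<le> ?r" by (rule real_le_rsqrt) simp
  moreover have "?r \<le> ?m + 2" by (rule real_le_lsqrt) (auto simp: power2_sum)
  ultimately show "(?r - ?m) / 2 \<in> {0..1}" by simp
  have "?r + ?m > 0" by (intro add_nonneg_pos) auto
  then have "1 / ((?r + ?m) / 2) = (?r - ?m) / 2"
    using r2 by (simp add: divide_simps power2_eq_square algebra_simps)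
  then show "gk_branch n ((?r - ?m) / 2) = (?r - ?m) / 2"
    unfolding gk_branch_def by (simp add: field_simps)
qed

lemma AE_gauss_measure_lborel:
  assumes "AE x in gauss_measure. P x" shows "AE x in lborel. x \<in> {0<..1} \<longrightarrow> P x"
proof -
  have m: "(\<lambda>x::real. ennreal (1 / (ln 2 * (1 + x)))) \<in> borel_measurable (restrict_space lborel {0<..1})"
    by (intro measurable_restrict_space1) measurable
  have "AE x in restrict_space lborel {0<..1}. 0 < ennreal (1 / (ln 2 * (1 + x))) \<longrightarrow> P x"
    using assms unfolding gauss_measure_def AE_density[OF m] .
  then have "AE x in lborel. x \<in> {0<..1} \<longrightarrow> 0 < ennreal (1 / (ln 2 * (1 + x))) \<longrightarrow> P x"
    by (subst (asm) AE_restrict_space_iff) auto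
  then show ?thesis by eventually_elim (auto intro!: mult_pos_pos)
qed

text \<open>A nonzero value would persist on an interval of positive Lebesgue measure. This turns
  almost-sure information into a statement at the single point that a branch fixes.\<close>

lemma AE_gauss_measure_lipschitz_zero:
  fixes g :: "real \<Rightarrow> real"
  assumes "AE x in gauss_measure. g x = 0" and g: "K-lipschitz_on {0..1} g" and s: "s \<in> {0..1}"
  shows "g s = 0"
proof (rule ccontr)
  assume n: "g s \<noteq> 0"
  have K: "K \<ge> 0" using g by (rule lipschitz_on_nonneg)
  define d where "d = \<bar>g s\<bar> / (K + 1)"
  have d: "d > 0" using n K by (simp add: d_def)
  define l u where "l = max 0 (s - d)" and "u = min 1 (s + d)"
  have lu: "l < u" using s d by (auto simp: l_def u_def)
  have "g x \<noteq> 0" if x: "x \<in> {l<..<u}" for x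
  proof
    assume "g x = 0"
    then have "\<bar>g s\<bar> \<le> K * \<bar>s - x\<bar>"
      using lipschitz_onD[OF g s, of x] x by (simp add: dist_real_def l_def u_def)
    also have "\<dots> \<le> K * d" using x K by (intro mult_left_mono) (auto simp: l_def u_def)
    also have "\<dots> < (K + 1) * d" using d by simp
    also have "\<dots> = \<bar>g s\<bar>" using K by (simp add: d_def)
    finally show False by simp
  qed
  moreover have "AE x in lborel. x \<in> {0<..1} \<longrightarrow> g x = 0" using assms(1) by (rule AE_gauss_measure_lborel)
  ultimately have "AE x in lborel. x \<notin> {l<..<u}"
    by (elim eventually_mono) (auto simp: l_def u_def)
  then have "emeasure lborel {l<..<u} = 0"
    by (subst (asm) AE_iff_measurable[of "{l<..<u}"]) auto
  then show False using lu by simp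
qed

text \<open>Poisson solutions and the variance are constructed over the reals, whereas the perturbed
  operator acts on complex functions.\<close>

lemma gk_op_of_real:
  fixes a :: "nat \<Rightarrow> real"
  assumes "wsummable a" "s \<in> {0..1}" "\<And>r. r \<in> {0..1} \<Longrightarrow> norm (g r) \<le> B"
  shows "gk_op (\<lambda>n. of_real (a n)) (\<lambda>r. of_real (g r)) s = (of_real (gk_op a g s) :: 'a::{real_normed_field,banach})"
proof -
  have "of_real (gk_weight n s) * (of_real (a n) * of_real (g (gk_branch n s)))
      = (of_real (of_real (gk_weight n s) * (a n * g (gk_branch n s))) :: 'a)" for n
    by simp
  then show ?thesis
    unfolding gk_op_def by (simp only: suminf_of_real[OF gk_op_summable(2)[where g = g, OF assms]])
qed

lemma gk_op_expand:
  fixes a :: "nat \<Rightarrow> 'a::{real_normed_field,banach}"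
  assumes a: "wsummable a" and s: "s \<in> {0..1}"
    and g: "\<And>r. r \<in> {0..1} \<Longrightarrow> norm (g r) \<le> B" and h: "\<And>r. r \<in> {0..1} \<Longrightarrow> norm (h r) \<le> B'"
  shows "gk_op a (\<lambda>r. 1 + p * g r + q * h r) s = gk_op a (\<lambda>_. 1) s + p * gk_op a g s + q * gk_op a h s"
proof -
  have 1: "norm (p * g r) \<le> norm p * B" if "r \<in> {0..1}" for r
    unfolding norm_mult using g[OF that] by (intro mult_left_mono) auto
  have 2: "norm (q * h r) \<le> norm q * B'" if "r \<in> {0..1}" for r
    unfolding norm_mult using h[OF that] by (intro mult_left_mono) auto
  have 3: "norm (1 + p * g r) \<le> 1 + norm p * B" if "r \<in> {0..1}" for r
    using 1[OF that] by (intro norm_triangle_le) auto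
  show ?thesis
    using gk_op_add[where g = "\<lambda>r. 1 + p * g r" and h = "\<lambda>r. q * h r", OF a s 3 2]
      gk_op_add[where g = "\<lambda>_. 1" and h = "\<lambda>r. p * g r" and B = 1, OF a s _ 1]
      gk_op_cmult(1)[where g = g, OF a s g] gk_op_cmult(1)[where g = h, OF a s h] by simp
qed

text \<open>The asymptotic variance is the mean of the conditional variances of the martingale
  differences \<open>F (digit) + h (new state) - h (old state)\<close>; evaluating at the fixed point of a branch
  shows that it only vanishes when \<open>F\<close> does.\<close>

lemma asymptotic_variance_pos:
  fixes F :: "nat \<Rightarrow> real"
  assumes F: "wsummable F" and F2: "wsummable (\<lambda>n. (F n)\<^sup>2)"
    and hm: "h \<in> borel_measurable borel" and hl: "C-lipschitz_on {0..1} h"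
    and hb: "\<And>s. s \<in> {0..1} \<Longrightarrow> norm (h s) \<le> B"
    and h: "\<And>s. s \<in> {0..1} \<Longrightarrow> gk_op (\<lambda>_. 1) h s = h s - gk_op F (\<lambda>_. 1) s"
    and F0: "F m \<noteq> 0"
  shows "(\<integral>s. gk_op (\<lambda>n. (F n)\<^sup>2 / 2) (\<lambda>_. 1) s + gk_op F h s \<partial>gauss_measure) > 0"
proof -
  interpret prob_space gauss_measure by (rule prob_space_gauss_measure)
  note [measurable] = hm
  have one: "norm (1::real) \<le> 1" by simp
  have h2b: "norm ((h s)\<^sup>2) \<le> B\<^sup>2" if "s \<in> {0..1}" for s
    using power_mono[OF hb[OF that], of 2] by simp
  define D where "D n s = F n + h (gk_branch n s) - h s" for n s
  \<comment> \<open>Conditional second moment of \<open>D\<close> given the state, written out. The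
    Poisson equation makes the conditional mean of \<open>D\<close> vanish, so this is a conditional
    variance.\<close>
  define V where "V s = gk_op (\<lambda>n. (F n)\<^sup>2) (\<lambda>_. 1) s + 2 * gk_op F h s + gk_op (\<lambda>_. 1) (\<lambda>r. (h r)\<^sup>2) s - (h s)\<^sup>2" for s
  have Vsums: "(\<lambda>n. gk_weight n s * (D n s)\<^sup>2) sums V s" if s: "s \<in> {0..1}" for s
  proof -
    have s1: "(\<lambda>n. gk_weight n s * (F n)\<^sup>2) sums gk_op (\<lambda>n. (F n)\<^sup>2) (\<lambda>_. 1) s"
      using gk_op_summable(2)[OF F2 s, of "\<lambda>_. 1" 1] by (simp add: gk_op_def summable_sums)
    have s2: "(\<lambda>n. gk_weight n s * (F n * h (gk_branch n s))) sums gk_op F h s"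
      using gk_op_summable(2)[where g = h, OF F s hb] by (simp add: gk_op_def summable_sums)
    have s3: "(\<lambda>n. gk_weight n s * (h (gk_branch n s))\<^sup>2) sums gk_op (\<lambda>_. 1) (\<lambda>r. (h r)\<^sup>2) s"
      using gk_op_summable(2)[where g = "\<lambda>r. (h r)\<^sup>2", OF wsummable_one s h2b] by (simp add: gk_op_def summable_sums)
    have s4: "(\<lambda>n. gk_weight n s * F n) sums gk_op F (\<lambda>_. 1) s"
      using gk_op_summable(2)[OF F s, of "\<lambda>_. 1" 1] by (simp add: gk_op_def summable_sums)
    have s5: "(\<lambda>n. gk_weight n s * h (gk_branch n s)) sums gk_op (\<lambda>_. 1) h s"
      using gk_op_summable(2)[where g = h, OF wsummable_one s hb] by (simp add: gk_op_def summable_sums)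
    have s6: "(\<lambda>n. gk_weight n s) sums 1" using gk_weight_sums[of s] s by simp
    have "(\<lambda>n. gk_weight n s * (F n)\<^sup>2 + 2 * (gk_weight n s * (F n * h (gk_branch n s))) + gk_weight n s * (h (gk_branch n s))\<^sup>2
       - 2 * h s * (gk_weight n s * F n + gk_weight n s * h (gk_branch n s)) + (h s)\<^sup>2 * gk_weight n s) sums
      (gk_op (\<lambda>n. (F n)\<^sup>2) (\<lambda>_. 1) s + 2 * gk_op F h s + gk_op (\<lambda>_. 1) (\<lambda>r. (h r)\<^sup>2) s
       - 2 * h s * (gk_op F (\<lambda>_. 1) s + gk_op (\<lambda>_. 1) h s) + (h s)\<^sup>2 * 1)"
      by (intro sums_add sums_diff sums_mult s1 s2 s3 s4 s5 s6)
    moreover have "gk_op F (\<lambda>_. 1) s + gk_op (\<lambda>_. 1) h s = h s" using h[OF s] by simp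
    ultimately show ?thesis unfolding V_def D_def by (simp add: power2_eq_square algebra_simps)
  qed
  have Vge: "gk_weight m s * (D m s)\<^sup>2 \<le> V s" if s: "s \<in> {0..1}" for s
    using sum_le_suminf[OF sums_summable[OF Vsums[OF s]], of "{m}"] sums_unique[OF Vsums[OF s]] gk_weight_nonneg[of s] s by simp
  have i1: "integrable gauss_measure (gk_op (\<lambda>n. (F n)\<^sup>2) (\<lambda>_. 1))"
    by (rule integrable_gauss_bounded[where B = "2 * 1 * wnorm (\<lambda>n. (F n)\<^sup>2)"]) (measurable, rule gk_op_bound[OF F2], auto)
  have i2: "integrable gauss_measure (gk_op F h)"
    by (rule integrable_gauss_bounded[OF _ gk_op_bound[OF F _ hb]]) measurable
  have i3: "integrable gauss_measure (gk_op (\<lambda>_. 1) (\<lambda>r. (h r)\<^sup>2))"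
    by (rule integrable_gauss_bounded[OF _ gk_op_bound[OF wsummable_one _ h2b]]) measurable
  have i4: "integrable gauss_measure (\<lambda>s. (h s)\<^sup>2)"
    by (rule integrable_gauss_bounded[OF _ h2b]) measurable
  have half: "gk_op (\<lambda>n. (F n)\<^sup>2 / 2) (\<lambda>_. 1) s = gk_op (\<lambda>n. (F n)\<^sup>2) (\<lambda>_. 1) s / 2" if s: "s \<in> {0..1}" for s
    using gk_op_cmult(2)[where g = "\<lambda>_. 1" and c = "1 / 2", OF F2 s one] by simp
  \<comment> \<open>Invariance of the Gauss measure cancels the two \<open>h^2\<close> terms and
    leaves twice the integral of the conclusion.\<close>
  have "(\<integral>s. V s \<partial>gauss_measure) = 2 * (\<integral>s. gk_op (\<lambda>n. (F n)\<^sup>2) (\<lambda>_. 1) s / 2 + gk_op F h s \<partial>gauss_measure)"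
    unfolding V_def using i1 i2 i3 i4 gauss_integral_op_one[OF _ h2b] by simp
  also have "(\<integral>s. gk_op (\<lambda>n. (F n)\<^sup>2) (\<lambda>_. 1) s / 2 + gk_op F h s \<partial>gauss_measure)
    = (\<integral>s. gk_op (\<lambda>n. (F n)\<^sup>2 / 2) (\<lambda>_. 1) s + gk_op F h s \<partial>gauss_measure)"
    by (intro Bochner_Integration.integral_cong refl) (auto simp: half space_gauss_measure)
  finally have eq: "(\<integral>s. V s \<partial>gauss_measure) = 2 * (\<integral>s. gk_op (\<lambda>n. (F n)\<^sup>2 / 2) (\<lambda>_. 1) s + gk_op F h s \<partial>gauss_measure)" .
  have iV: "integrable gauss_measure V" unfolding V_def[abs_def] using i1 i2 i3 i4 by simp
  have V0: "AE s in gauss_measure. 0 \<le> V s"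
  proof (intro AE_I2)
    fix s assume "s \<in> space gauss_measure"
    then have s: "s \<in> {0..1}" by (auto simp: space_gauss_measure)
    show "0 \<le> V s" using s gk_weight_nonneg[of s m] by (intro order.trans[OF _ Vge[OF s]]) auto
  qed
  have "(\<integral>s. V s \<partial>gauss_measure) \<noteq> 0"
  proof
    assume "(\<integral>s. V s \<partial>gauss_measure) = 0"
    then have "AE s in gauss_measure. V s = 0" using integral_nonneg_eq_0_iff_AE[OF iV V0] by simp
    then have "AE s in gauss_measure. D m s = 0"
      using AE_space
    proof eventually_elim
      case (elim s)
      then have s: "s \<in> {0..1}" by (auto simp: space_gauss_measure)
      have "gk_weight m s * (D m s)\<^sup>2 \<le> 0" using Vge[OF s] elim by simp
      moreover have "gk_weight m s > 0" using gk_weight_pos[of s m] s by simp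
      ultimately show ?case by (simp add: mult_le_0_iff)
    qed
    moreover have "(C + C)-lipschitz_on {0..1} (D m)"
    proof (rule lipschitz_onI)
      have C: "C \<ge> 0" using hl by (rule lipschitz_on_nonneg)
      then show "0 \<le> C + C" by simp
      fix s r :: real assume s: "s \<in> {0..1}" and r: "r \<in> {0..1}"
      have "\<bar>h (gk_branch m s) - h (gk_branch m r)\<bar> \<le> C * \<bar>gk_branch m s - gk_branch m r\<bar>"
        using lipschitz_onD[OF hl gk_branch_in[OF s] gk_branch_in[OF r]] by (simp add: dist_real_def)
      also have "\<dots> \<le> C * \<bar>s - r\<bar>" using gk_branch_lipschitz[OF s r] C by (intro mult_left_mono)
      finally have "\<bar>h (gk_branch m s) - h (gk_branch m r)\<bar> \<le> C * \<bar>s - r\<bar>" .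
      moreover have "\<bar>h s - h r\<bar> \<le> C * \<bar>s - r\<bar>" using lipschitz_onD[OF hl s r] by (simp add: dist_real_def)
      ultimately show "dist (D m s) (D m r) \<le> (C + C) * dist s r"
        unfolding D_def dist_real_def by (simp add: distrib_right abs_le_iff)
    qed
    \<comment> \<open>At a fixed point old and new state coincide, the two values of
      \<open>h\<close> cancel, and \<open>D m s\<close> is \<open>F m\<close> itself.\<close>
    moreover obtain s where s: "s \<in> {0..1}" "gk_branch m s = s" by (rule gk_branch_fixed_point)
    ultimately have "D m s = 0" by (intro AE_gauss_measure_lipschitz_zero)
    then show False using s F0 by (simp add: D_def)
  qed
  moreover have "(\<integral>s. V s \<partial>gauss_measure) \<ge> 0" by (rule integral_nonneg_AE[OF V0])
  ultimately show ?thesis using eq by simp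
qed

text \<open>Residual of the eigenvalue equation for \<open>1 + i t h - t^2 h2\<close> with
  eigenvalue \<open>1 - t^2 b\<close>. The letters \<open>x\<close>, \<open>y\<close> stand for
  \<open>gk_op F\<close> applied to \<open>h\<close>, \<open>h2\<close>, and \<open>x'\<close>,
  \<open>y'\<close> for the operator with coefficient \<open>F^2 / 2\<close> applied to them. All
  terms up to order 2 cancel, so only orders 3 and 4 and the Taylor remainder \<open>r\<close>
  survive.\<close>

lemma quadratic_expansion:
  fixes t h v h2 k b x y x' y' r :: complex
  shows "(1 + (\<i> * t) * (h - v) + (- t\<^sup>2) * (h2 - (k - b))) + ((\<i> * t) * (v + (\<i> * t) * x + (- t\<^sup>2) * y)
    + ((- t\<^sup>2) * ((k - x) + (\<i> * t) * x' + (- t\<^sup>2) * y') + r)) - (1 - t\<^sup>2 * b) * (1 + (\<i> * t) * h + (- t\<^sup>2) * h2)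
    = ((\<i> * t) * (- t\<^sup>2)) * y + ((\<i> * t) * (- t\<^sup>2)) * x' + ((- t\<^sup>2) * (- t\<^sup>2)) * y'
      - ((\<i> * t) * (- t\<^sup>2)) * (b * h) - ((- t\<^sup>2) * (- t\<^sup>2)) * (b * h2) + r"
proof -
  have "\<i> * \<i> = (-1::complex)" by simp
  then show ?thesis by algebra
qed
text \<open>Second-order perturbation theory: \<open>h\<close> corrects the first-order term and
  \<open>h2\<close> the centred second-order term, so the eigenvalue is \<open>1 - t^2 kb\<close>
  with \<open>kb\<close> the mean of the second-order coefficient. Over \<open>n\<close> steps at
  \<open>t\<close> of order \<open>1 / sqrt n\<close> a residual \<open>o(t^2)\<close> suffices,
  which asks only for second moments of \<open>F\<close>.\<close>

lemma cf_char_finite_variance: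
  fixes F :: "nat \<Rightarrow> real"
  assumes F2': "integrable gauss_measure (\<lambda>x. (F (gk_digit x))\<^sup>2)"
    and F1': "integrable gauss_measure (\<lambda>x. F (gk_digit x))"
    and mean: "(\<integral>x. F (gk_digit x) \<partial>gauss_measure) = 0" and F0: "F m \<noteq> 0"
  obtains \<sigma> where "\<sigma> > 0" "\<And>t. (\<lambda>n. cf_char F n (t / (\<sigma> * sqrt n))) \<longlonglongrightarrow> exp (- (t\<^sup>2 / 2))"
proof -
  interpret prob_space gauss_measure by (rule prob_space_gauss_measure)
  have F: "wsummable F" using F1' by (rule wsummable_if_integrable)
  have F2: "wsummable (\<lambda>n. (F n)\<^sup>2)" using F2' by (rule wsummable_if_integrable)
  have Fh: "wsummable (\<lambda>n. (F n)\<^sup>2 / 2)" using wsummable_mult[OF F2, of "1 / 2"] by simp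
  have one: "norm (1::real) \<le> 1" by simp
  define v where "v = gk_op F (\<lambda>_. 1)"
  have vm: "v \<in> borel_measurable borel" unfolding v_def by measurable
  have vl: "(6 * wnorm F)-lipschitz_on {0..1} v"
    unfolding v_def using gk_op_lipschitz[OF F, of "\<lambda>_. 1" 1 0] by (auto intro: lipschitz_on_constant)
  have vz: "(\<integral>s. v s \<partial>gauss_measure) = 0"
    unfolding v_def using gauss_integral_digit(2)[OF F] mean by simp
  obtain h where hm[measurable]: "h \<in> borel_measurable borel" and hl: "(8 * (6 * wnorm F))-lipschitz_on {0..1} h"
    and hb: "\<And>s. s \<in> {0..1} \<Longrightarrow> norm (h s) \<le> 8 * (6 * wnorm F)"
    and h: "\<And>s. s \<in> {0..1} \<Longrightarrow> gk_op (\<lambda>_. 1) h s = h s - v s"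
    by (rule poisson_equation[OF vm vl vz]) (rule that)
  define B where "B = 8 * (6 * wnorm F)"
  note hl = hl[folded B_def] and hb = hb[folded B_def]
  \<comment> \<open>Coefficient of \<open>(it)^2\<close> after the first correction: half the
    conditional second moment plus the correlation of the digit function with the corrector
    \<open>h\<close>.\<close>
  define k where "k s = gk_op (\<lambda>n. (F n)\<^sup>2 / 2) (\<lambda>_. 1) s + gk_op F h s" for s
  define kb where "kb = (\<integral>s. k s \<partial>gauss_measure)"
  have kb: "kb > 0"
    unfolding kb_def k_def by (rule asymptotic_variance_pos[OF F F2 hm hl hb _ F0]) (use h in \<open>auto simp: v_def\<close>)
  have [measurable]: "k \<in> borel_measurable borel" unfolding k_def[abs_def] by measurable
  define C where "C = 6 * wnorm (\<lambda>n. (F n)\<^sup>2 / 2) + (6 * B + 2 * B) * wnorm F"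
  have kl: "C-lipschitz_on {0..1} k"
    unfolding k_def[abs_def] C_def
  proof (rule lipschitz_on_add)
    show "(6 * wnorm (\<lambda>n. (F n)\<^sup>2 / 2))-lipschitz_on {0..1} (gk_op (\<lambda>n. (F n)\<^sup>2 / 2) (\<lambda>_. 1))"
      using gk_op_lipschitz[OF Fh, of "\<lambda>_. 1" 1 0] by (auto intro: lipschitz_on_constant)
    show "((6 * B + 2 * B) * wnorm F)-lipschitz_on {0..1} (gk_op F h)"
      by (rule gk_op_lipschitz[OF F hb hl])
  qed
  have ki: "integrable gauss_measure k" by (rule integrable_gauss_bounded[OF _ lipschitz_on_bounded[OF kl]]) measurable
  have k2m: "(\<lambda>s. k s - kb) \<in> borel_measurable borel" by measurable
  have k2l: "C-lipschitz_on {0..1} (\<lambda>s. k s - kb)" using kl unfolding lipschitz_on_def by (simp add: dist_norm)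
  have k2z: "(\<integral>s. k s - kb \<partial>gauss_measure) = 0" using ki by (simp add: kb_def prob_space)
  obtain h2 where h2m[measurable]: "h2 \<in> borel_measurable borel" and h2l: "(8 * C)-lipschitz_on {0..1} h2"
    and h2b: "\<And>s. s \<in> {0..1} \<Longrightarrow> norm (h2 s) \<le> 8 * C"
    and h2: "\<And>s. s \<in> {0..1} \<Longrightarrow> gk_op (\<lambda>_. 1) h2 s = h2 s - (k s - kb)"
    by (rule poisson_equation[OF k2m k2l k2z]) (rule that)
  define c :: "real \<Rightarrow> complex" where "c = of_real"
  define w where "w \<tau> = (\<lambda>s. 1 + (\<i> * c \<tau>) * c (h s) + (- (c \<tau>)\<^sup>2) * c (h2 s))" for \<tau>
  define R where "R \<tau> n = iexp (\<tau> * F n) - 1 - (\<i> * c \<tau>) * c (F n) + (c \<tau>)\<^sup>2 * c ((F n)\<^sup>2 / 2)" for \<tau> n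
  \<comment> \<open>Two bounds for the Taylor remainder: the quadratic one is an integrable
    majorant, the cubic one gives pointwise smallness without a third moment.\<close>
  have R1: "norm (R \<tau> n) \<le> \<tau>\<^sup>2 * (F n)\<^sup>2" and R2: "norm (R \<tau> n) \<le> \<bar>\<tau>\<bar> ^ 3 * \<bar>F n\<bar> ^ 3 / 6" for \<tau> n
  proof -
    have "R \<tau> n = iexp (\<tau> * F n) - (\<Sum>k\<le>2. (\<i> * (\<tau> * F n)) ^ k / fact k)"
      by (simp add: R_def c_def numeral_2_eq_2 power2_eq_square algebra_simps)
    then show "norm (R \<tau> n) \<le> \<tau>\<^sup>2 * (F n)\<^sup>2" "norm (R \<tau> n) \<le> \<bar>\<tau>\<bar> ^ 3 * \<bar>F n\<bar> ^ 3 / 6"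
      using iexp_approx2[of "\<tau> * F n" 2] iexp_approx1[of "\<tau> * F n" 2]
      by (simp_all add: abs_mult power_mult_distrib fact_numeral)
  qed
  have Rs: "wsummable (R \<tau>)" for \<tau>
    by (rule wsummable_comparison[OF wsummable_mult[OF F2, of "\<tau>\<^sup>2"]]) (use R1 in simp)
  have cs: "wsummable (\<lambda>n. c (a n))" if "wsummable a" for a :: "nat \<Rightarrow> real"
    using that by (simp add: wsummable_def c_def)
  have chb: "norm (c (h s)) \<le> B" if "s \<in> {0..1}" for s using hb[OF that] by (simp add: c_def)
  have ch2b: "norm (c (h2 s)) \<le> 8 * C" if "s \<in> {0..1}" for s using h2b[OF that] by (simp add: c_def)
  have B0: "B \<ge> 0" by (rule order.trans[OF norm_ge_zero hb[of 0]]) simp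
  have C0: "C \<ge> 0" using kl by (rule lipschitz_on_nonneg)
  have w1: "norm (w \<tau> s - 1) \<le> \<bar>\<tau>\<bar> * B + \<tau>\<^sup>2 * (8 * C)" if "s \<in> {0..1}" for \<tau> s
  proof -
    have "w \<tau> s - 1 = (\<i> * c \<tau>) * c (h s) + (- (c \<tau>)\<^sup>2) * c (h2 s)" by (simp add: w_def)
    also have "norm \<dots> \<le> \<bar>\<tau>\<bar> * B + \<tau>\<^sup>2 * (8 * C)"
      using hb[OF that] h2b[OF that]
      by (intro norm_triangle_le add_mono) (auto simp: norm_mult norm_power c_def intro!: mult_left_mono)
    finally show ?thesis .
  qed
  define M where "M = 2 * (8 * C) * wnorm F + 2 * B * wnorm (\<lambda>n. (F n)\<^sup>2 / 2) + 2 * (8 * C) * wnorm (\<lambda>n. (F n)\<^sup>2 / 2) + kb * B + kb * (8 * C)"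
  have eig: "norm (gk_op (gk_iexp F \<tau>) (w \<tau>) s - of_real (1 - \<tau>\<^sup>2 * kb) * w \<tau> s)
     \<le> M * \<bar>\<tau>\<bar> ^ 3 + 2 * (1 + B + 8 * C) * wnorm (R \<tau>)" if \<tau>: "\<bar>\<tau>\<bar> \<le> 1" and s: "s \<in> {0..1}" for \<tau> s
  proof -
    let ?p = "\<i> * c \<tau>" and ?q = "- (c \<tau>)\<^sup>2"
    have \<tau>2: "\<tau>\<^sup>2 \<le> 1" using \<tau> by (simp add: abs_square_le_1)
    have wb: "norm (w \<tau> r) \<le> 1 + B + 8 * C" if "r \<in> {0..1}" for r
    proof -
      have "norm (w \<tau> r) \<le> 1 + norm (w \<tau> r - 1)" using norm_triangle_sub[of "w \<tau> r" 1] by simp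
      also have "\<dots> \<le> 1 + (1 * B + 1 * (8 * C))"
        using B0 C0 \<tau> \<tau>2 by (intro add_left_mono order.trans[OF w1[OF that]] add_mono mult_right_mono) auto
      finally show ?thesis by simp
    qed
    have u: "gk_iexp F \<tau> = (\<lambda>n. 1 + (?p * c (F n) + (?q * c ((F n)\<^sup>2 / 2) + R \<tau> n)))"
      by (auto simp: gk_iexp_def R_def)
    have expand1: "gk_op (\<lambda>_. 1) (w \<tau>) s = gk_op (\<lambda>_. 1) (\<lambda>_. 1) s
        + ?p * gk_op (\<lambda>_. 1) (\<lambda>r. c (h r)) s + ?q * gk_op (\<lambda>_. 1) (\<lambda>r. c (h2 r)) s"
      unfolding w_def by (rule gk_op_expand[OF wsummable_one s chb ch2b])
    have expand2: "gk_op (\<lambda>n. c (F n)) (w \<tau>) s = gk_op (\<lambda>n. c (F n)) (\<lambda>_. 1) s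
        + ?p * gk_op (\<lambda>n. c (F n)) (\<lambda>r. c (h r)) s + ?q * gk_op (\<lambda>n. c (F n)) (\<lambda>r. c (h2 r)) s"
      unfolding w_def by (rule gk_op_expand[OF cs[OF F] s chb ch2b])
    have expand3: "gk_op (\<lambda>n. c ((F n)\<^sup>2 / 2)) (w \<tau>) s = gk_op (\<lambda>n. c ((F n)\<^sup>2 / 2)) (\<lambda>_. 1) s
        + ?p * gk_op (\<lambda>n. c ((F n)\<^sup>2 / 2)) (\<lambda>r. c (h r)) s + ?q * gk_op (\<lambda>n. c ((F n)\<^sup>2 / 2)) (\<lambda>r. c (h2 r)) s"
      unfolding w_def by (rule gk_op_expand[OF cs[OF Fh] s chb ch2b])
    have s1: "wsummable (\<lambda>n. ?p * c (F n))" by (intro wsummable_mult cs F)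
    have s2: "wsummable (\<lambda>n. ?q * c ((F n)\<^sup>2 / 2))" by (intro wsummable_mult cs Fh)
    have "gk_op (gk_iexp F \<tau>) (w \<tau>) s = gk_op (\<lambda>_. 1) (w \<tau>) s + (gk_op (\<lambda>n. ?p * c (F n)) (w \<tau>) s
       + (gk_op (\<lambda>n. ?q * c ((F n)\<^sup>2 / 2)) (w \<tau>) s + gk_op (R \<tau>) (w \<tau>) s))"
      unfolding u
      by (simp only: gk_op_add_weight[OF wsummable_one wsummable_add[OF s1 wsummable_add[OF s2 Rs]] s wb]
           gk_op_add_weight[OF s1 wsummable_add[OF s2 Rs] s wb] gk_op_add_weight[OF s2 Rs s wb])
    also have "gk_op (\<lambda>n. ?p * c (F n)) (w \<tau>) s = ?p * gk_op (\<lambda>n. c (F n)) (w \<tau>) s"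
      by (rule gk_op_cmult(2)[OF cs[OF F] s wb])
    also have "gk_op (\<lambda>n. ?q * c ((F n)\<^sup>2 / 2)) (w \<tau>) s = ?q * gk_op (\<lambda>n. c ((F n)\<^sup>2 / 2)) (w \<tau>) s"
      by (rule gk_op_cmult(2)[OF cs[OF Fh] s wb])
    also have "gk_op (\<lambda>_. 1) (w \<tau>) s = 1 + ?p * c (h s - v s) + ?q * c (h2 s - (k s - kb))"
      unfolding expand1
      using gk_op_of_real[where g = h and 'a = complex, OF wsummable_one s hb]
        gk_op_of_real[where g = h2 and 'a = complex, OF wsummable_one s h2b]
      by (simp add: c_def h[OF s] h2[OF s] gk_op_one_const[OF s])
    also have "gk_op (\<lambda>n. c (F n)) (w \<tau>) s = c (v s) + ?p * c (gk_op F h s) + ?q * c (gk_op F h2 s)"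
      unfolding expand2
      using gk_op_of_real[where g = h and 'a = complex, OF F s hb]
        gk_op_of_real[where g = h2 and 'a = complex, OF F s h2b]
        gk_op_of_real[where g = "\<lambda>_. 1" and 'a = complex, OF F s one]
      by (simp add: c_def v_def)
    also have "gk_op (\<lambda>n. c ((F n)\<^sup>2 / 2)) (w \<tau>) s = c (k s - gk_op F h s)
        + ?p * c (gk_op (\<lambda>n. (F n)\<^sup>2 / 2) h s) + ?q * c (gk_op (\<lambda>n. (F n)\<^sup>2 / 2) h2 s)"
      unfolding expand3
      using gk_op_of_real[where g = h and 'a = complex, OF Fh s hb]
        gk_op_of_real[where g = h2 and 'a = complex, OF Fh s h2b]
        gk_op_of_real[where g = "\<lambda>_. 1" and 'a = complex, OF Fh s one]
      by (simp add: c_def k_def)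
    finally have E: "gk_op (gk_iexp F \<tau>) (w \<tau>) s - of_real (1 - \<tau>\<^sup>2 * kb) * w \<tau> s
      = (?p * ?q) * c (gk_op F h2 s) + (?p * ?q) * c (gk_op (\<lambda>n. (F n)\<^sup>2 / 2) h s)
       + (?q * ?q) * c (gk_op (\<lambda>n. (F n)\<^sup>2 / 2) h2 s) - (?p * ?q) * c (kb * h s) - (?q * ?q) * c (kb * h2 s)
       + gk_op (R \<tau>) (w \<tau>) s"
      unfolding w_def
      using quadratic_expansion[of "c \<tau>" "c (h s)" "c (v s)" "c (h2 s)" "c (k s)" "c kb" "c (gk_op F h s)" "c (gk_op F h2 s)"
        "c (gk_op (\<lambda>n. (F n)\<^sup>2 / 2) h s)" "c (gk_op (\<lambda>n. (F n)\<^sup>2 / 2) h2 s)" "gk_op (R \<tau>) (w \<tau>) s"]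
      by (simp only: c_def w_def of_real_diff of_real_mult of_real_power of_real_1)
    have "norm (gk_op (gk_iexp F \<tau>) (w \<tau>) s - of_real (1 - \<tau>\<^sup>2 * kb) * w \<tau> s) \<le> (\<bar>\<tau>\<bar> ^ 3 * (2 * (8 * C) * wnorm F) + \<bar>\<tau>\<bar> ^ 3 * (2 * B * wnorm (\<lambda>n. (F n)\<^sup>2 / 2))
       + \<bar>\<tau>\<bar> ^ 3 * (2 * (8 * C) * wnorm (\<lambda>n. (F n)\<^sup>2 / 2)) + \<bar>\<tau>\<bar> ^ 3 * (kb * B) + \<bar>\<tau>\<bar> ^ 3 * (kb * (8 * C)))
       + 2 * (1 + B + 8 * C) * wnorm (R \<tau>)"
    proof -
      have p3: "norm (?p * ?q) = \<bar>\<tau>\<bar> ^ 3"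
        unfolding norm_mult norm_minus_cancel norm_power c_def norm_of_real norm_ii
        by (simp only: power3_eq_cube power2_eq_square mult_1 mult.assoc)
      have "norm (?q * ?q) = \<bar>\<tau>\<bar> ^ 3 * \<bar>\<tau>\<bar>"
        unfolding norm_mult norm_minus_cancel norm_power c_def norm_of_real
        by (simp only: power3_eq_cube power2_eq_square mult.assoc)
      also have "\<dots> \<le> \<bar>\<tau>\<bar> ^ 3 * 1" using \<tau> by (intro mult_left_mono) auto
      finally have q4: "norm (?q * ?q) \<le> \<bar>\<tau>\<bar> ^ 3" by simp
      have t3: "norm ((?p * ?q) * z) \<le> \<bar>\<tau>\<bar> ^ 3 * b" "norm ((?q * ?q) * z) \<le> \<bar>\<tau>\<bar> ^ 3 * b"
        if "norm z \<le> b" for z b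
        unfolding norm_mult[of _ z] using p3 q4 that by (auto intro!: mult_mono)
      have gF: "norm (c (gk_op F h2 s)) \<le> 2 * (8 * C) * wnorm F"
        using gk_op_bound[OF F s h2b] by (simp add: c_def)
      have gH: "norm (c (gk_op (\<lambda>n. (F n)\<^sup>2 / 2) h s)) \<le> 2 * B * wnorm (\<lambda>n. (F n)\<^sup>2 / 2)"
        using gk_op_bound[OF Fh s hb] by (simp add: c_def)
      have gH2: "norm (c (gk_op (\<lambda>n. (F n)\<^sup>2 / 2) h2 s)) \<le> 2 * (8 * C) * wnorm (\<lambda>n. (F n)\<^sup>2 / 2)"
        using gk_op_bound[OF Fh s h2b] by (simp add: c_def)
      have gk1: "norm (c (kb * h s)) \<le> kb * B" using hb[OF s] kb by (simp add: c_def norm_mult)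
      have gk2: "norm (c (kb * h2 s)) \<le> kb * (8 * C)" using h2b[OF s] kb by (simp add: c_def norm_mult)
      show ?thesis unfolding E
        by (rule order.trans[OF norm_triangle_ineq add_mono[OF
              order.trans[OF norm_triangle_ineq4 add_mono[OF
              order.trans[OF norm_triangle_ineq4 add_mono[OF
              order.trans[OF norm_triangle_ineq add_mono[OF
              order.trans[OF norm_triangle_ineq add_mono[OF t3(1)[OF gF] t3(1)[OF gH]]]
              t3(2)[OF gH2]]] t3(1)[OF gk1]]] t3(2)[OF gk2]]] gk_op_bound[OF Rs s wb]]])
    qed
    also have "\<dots> = M * \<bar>\<tau>\<bar> ^ 3 + 2 * (1 + B + 8 * C) * wnorm (R \<tau>)"
      by (simp only: M_def distrib_right mult.commute[of "\<bar>\<tau>\<bar> ^ 3"])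
    finally show ?thesis .
  qed
  \<comment> \<open>\<open>1 - \<tau>^2 kb\<close> has to match \<open>1 - t^2 / (2 n)\<close> at
    \<open>\<tau> = t / (\<sigma> sqrt n)\<close>, hence \<open>\<sigma>^2 = 2 kb\<close>.\<close>
  define \<sigma> where "\<sigma> = sqrt (2 * kb)"
  have \<sigma>: "\<sigma> > 0" "\<sigma>\<^sup>2 = 2 * kb" using kb by (simp_all add: \<sigma>_def)
  show ?thesis
  proof (rule that[OF \<sigma>(1)])
    fix t :: real
    define T where "T n = t / (\<sigma> * sqrt (real n))" for n
    have "(\<lambda>n. t / \<sigma> * (1 / sqrt (real n))) \<longlonglongrightarrow> t / \<sigma> * 0"
      by (intro tendsto_mult tendsto_const) real_asymp
    then have T0: "T \<longlonglongrightarrow> 0" by (simp add: T_def[abs_def])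
    have nT2: "real n * (T n)\<^sup>2 = t\<^sup>2 / \<sigma>\<^sup>2" if "n > 0" for n
      using that \<sigma>(1) by (simp add: T_def power_divide power_mult_distrib)
    have nT3: "(\<lambda>n. real n * \<bar>T n\<bar> ^ 3) \<longlonglongrightarrow> 0"
    proof (rule Lim_transform_eventually)
      show "(\<lambda>n. t\<^sup>2 / \<sigma>\<^sup>2 * \<bar>T n\<bar>) \<longlonglongrightarrow> 0" by (intro tendsto_mult_right_zero tendsto_rabs_zero T0)
      show "\<forall>\<^sub>F n in sequentially. t\<^sup>2 / \<sigma>\<^sup>2 * \<bar>T n\<bar> = real n * \<bar>T n\<bar> ^ 3"
        using eventually_gt_at_top[of 0]
      proof eventually_elim
        case (elim n)
        have "\<bar>T n\<bar> ^ 3 = \<bar>T n\<bar>\<^sup>2 * \<bar>T n\<bar>" by (rule power_Suc2[of _ 2, simplified])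
        then have "real n * \<bar>T n\<bar> ^ 3 = real n * (T n)\<^sup>2 * \<bar>T n\<bar>" by (simp only: power2_abs mult.assoc)
        then show ?case using nT2[OF elim] by simp
      qed
    qed
    have nR: "(\<lambda>n. real n * wnorm (R (T n))) \<longlonglongrightarrow> 0"
    proof (rule tendsto_sandwich[OF _ _ tendsto_const])
      show "\<forall>\<^sub>F n in sequentially. 0 \<le> real n * wnorm (R (T n))"
        by (intro always_eventually allI mult_nonneg_nonneg wnorm_nonneg Rs) simp
      show "\<forall>\<^sub>F n in sequentially. real n * wnorm (R (T n)) \<le> 2 * (\<integral>x. real n * norm (R (T n) (gk_digit x)) \<partial>gauss_measure)"
      proof (intro always_eventually allI)
        fix n
        have "real n * wnorm (R (T n)) \<le> real n * (2 * (\<integral>x. norm (R (T n) (gk_digit x)) \<partial>gauss_measure))"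
          by (intro mult_left_mono wnorm_le Rs) simp
        also have "\<dots> = 2 * (\<integral>x. real n * norm (R (T n) (gk_digit x)) \<partial>gauss_measure)"
          unfolding integral_mult_right_zero by (rule mult.left_commute)
        finally show "real n * wnorm (R (T n)) \<le> 2 * (\<integral>x. real n * norm (R (T n) (gk_digit x)) \<partial>gauss_measure)" .
      qed
      have "(\<lambda>n. \<integral>x. real n * norm (R (T n) (gk_digit x)) \<partial>gauss_measure) \<longlonglongrightarrow> (\<integral>x. 0 \<partial>gauss_measure)"
      proof (rule integral_dominated_convergence[where w = "\<lambda>x. t\<^sup>2 / \<sigma>\<^sup>2 * (F (gk_digit x))\<^sup>2"])
        show "integrable gauss_measure (\<lambda>x. t\<^sup>2 / \<sigma>\<^sup>2 * (F (gk_digit x))\<^sup>2)" using F2' by simp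
        show "(\<lambda>x. real n * norm (R (T n) (gk_digit x))) \<in> borel_measurable gauss_measure" for n
          by (rule measurable_gauss_measure) measurable
        show "AE x in gauss_measure. norm (real n * norm (R (T n) (gk_digit x))) \<le> t\<^sup>2 / \<sigma>\<^sup>2 * (F (gk_digit x))\<^sup>2" for n
        proof (intro AE_I2)
          fix x
          show "norm (real n * norm (R (T n) (gk_digit x))) \<le> t\<^sup>2 / \<sigma>\<^sup>2 * (F (gk_digit x))\<^sup>2"
          proof (cases "n = 0")
            case False
            have "real n * norm (R (T n) (gk_digit x)) \<le> real n * ((T n)\<^sup>2 * (F (gk_digit x))\<^sup>2)"
              by (intro mult_left_mono R1) simp
            also have "\<dots> = t\<^sup>2 / \<sigma>\<^sup>2 * (F (gk_digit x))\<^sup>2" using nT2[of n] False by (simp flip: mult.assoc)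
            finally show ?thesis by simp
          qed simp
        qed
        show "AE x in gauss_measure. (\<lambda>n. real n * norm (R (T n) (gk_digit x))) \<longlonglongrightarrow> 0"
        proof (rule AE_I2, rule tendsto_sandwich[OF _ _ tendsto_const])
          fix x
          have "(\<lambda>n. (\<bar>F (gk_digit x)\<bar> ^ 3 / 6) * (real n * \<bar>T n\<bar> ^ 3)) \<longlonglongrightarrow> 0"
            by (intro tendsto_mult_right_zero nT3)
          then show "(\<lambda>n. real n * (\<bar>T n\<bar> ^ 3 * \<bar>F (gk_digit x)\<bar> ^ 3 / 6)) \<longlonglongrightarrow> 0" by (simp add: mult_ac)
          show "\<forall>\<^sub>F n in sequentially. real n * norm (R (T n) (gk_digit x)) \<le> real n * (\<bar>T n\<bar> ^ 3 * \<bar>F (gk_digit x)\<bar> ^ 3 / 6)"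
            by (intro always_eventually allI mult_left_mono R2) simp
        qed auto
      qed simp
      then show "(\<lambda>n. 2 * (\<integral>x. real n * norm (R (T n) (gk_digit x)) \<partial>gauss_measure)) \<longlonglongrightarrow> 0"
        by (intro tendsto_mult_right_zero) simp
    qed
    define l where "l n = 1 - (T n)\<^sup>2 * kb" for n
    define e where "e n = \<bar>T n\<bar> * B + (T n)\<^sup>2 * (8 * C)" for n
    define d where "d n = M * \<bar>T n\<bar> ^ 3 + 2 * (1 + B + 8 * C) * wnorm (R (T n))" for n
    have ev: "\<forall>\<^sub>F n in sequentially. norm (cf_char F n (T n) - of_real (l n ^ n)) \<le> 2 * e n + real n * d n"
    proof -
      have "\<forall>\<^sub>F n in sequentially. \<bar>T n\<bar> < 1" using order_tendstoD(2)[OF tendsto_rabs_zero[OF T0], of 1] by simp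
      moreover have "(\<lambda>n. (T n)\<^sup>2 * kb) \<longlonglongrightarrow> 0"
        using T0 by (intro tendsto_mult_left_zero tendsto_null_power) auto
      then have "\<forall>\<^sub>F n in sequentially. (T n)\<^sup>2 * kb < 1" using order_tendstoD(2)[of _ 0] by fastforce
      ultimately show ?thesis
      proof eventually_elim
        case (elim n)
        have ln: "norm (complex_of_real (l n)) \<le> 1" using elim(2) kb unfolding norm_of_real by (simp add: l_def)
        have d0: "d n \<ge> 0"
          using eig[of "T n" 0] elim(1) unfolding d_def by (intro order.trans[OF norm_ge_zero eig[of "T n" 0]]) auto
        let ?L = "(gk_op (gk_iexp F (T n)) ^^ n) (\<lambda>_. 1)"
        have Lm: "(gk_op (gk_iexp F (T n)) ^^ j) (\<lambda>_. 1) \<in> borel_measurable borel" for j by (induction j) auto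
        have Li: "integrable gauss_measure ?L"
          by (rule integrable_gauss_bounded[OF Lm, where B = 1]) (rule gk_op_iterate_bound, auto)
        have bd: "norm (?L s - of_real (l n) ^ n) \<le> 2 * e n + real n * d n" if s: "s \<in> {0..1}" for s
        proof -
          have "norm (?L s - of_real (l n) ^ n) \<le> 2 * e n + d n * (\<Sum>j<n. norm (complex_of_real (l n)) ^ j)"
            unfolding e_def d_def l_def using elim(1)
            by (intro approximate_eigenfunction[where w = "w (T n)", OF _ w1 eig ln[unfolded l_def] s]) auto
          \<comment> \<open>Here bounding the geometric sum by \<open>n\<close> is enough, because
            \<open>n * d n\<close> tends to 0.\<close>
          also have "d n * (\<Sum>j<n. norm (complex_of_real (l n)) ^ j) \<le> d n * (\<Sum>j<n. 1)"
            using ln d0 by (intro mult_left_mono sum_mono power_le_one) auto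
          finally show ?thesis by (simp add: mult.commute)
        qed
        have "cf_char F n (T n) - of_real (l n ^ n) = (\<integral>s. ?L s - of_real (l n) ^ n \<partial>gauss_measure)"
          using Li by (simp add: cf_char_def prob_space)
        also have "norm \<dots> \<le> (\<integral>s. 2 * e n + real n * d n \<partial>gauss_measure)"
          using Li by (intro order.trans[OF integral_norm_bound integral_mono] bd) (auto simp: space_gauss_measure)
        finally show ?case by (simp add: prob_space)
      qed
    qed
    have e0: "(\<lambda>n. 2 * e n + real n * d n) \<longlonglongrightarrow> 0"
    proof -
      have "(\<lambda>n. 2 * (\<bar>T n\<bar> * B + (T n)\<^sup>2 * (8 * C)) + (M * (real n * \<bar>T n\<bar> ^ 3) + 2 * (1 + B + 8 * C) * (real n * wnorm (R (T n)))))
        \<longlonglongrightarrow> 2 * (\<bar>0\<bar> * B + 0\<^sup>2 * (8 * C)) + (M * 0 + 2 * (1 + B + 8 * C) * 0)"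
        by (intro tendsto_intros T0 nT3 nR)
      then show ?thesis by (simp add: e_def d_def algebra_simps)
    qed
    have "(\<lambda>n. (1 + (- (t\<^sup>2 / 2)) / real n) ^ n) \<longlonglongrightarrow> exp (- (t\<^sup>2 / 2))"
      by (rule tendsto_exp_limit_sequentially)
    then have "(\<lambda>n. l n ^ n) \<longlonglongrightarrow> exp (- (t\<^sup>2 / 2))"
    proof (rule Lim_transform_eventually)
      show "\<forall>\<^sub>F n in sequentially. (1 + (- (t\<^sup>2 / 2)) / real n) ^ n = l n ^ n"
        using eventually_gt_at_top[of 0]
      proof eventually_elim
        case (elim n)
        have "(T n)\<^sup>2 = t\<^sup>2 / \<sigma>\<^sup>2 / real n" unfolding nT2[OF elim, symmetric] using elim by simp
        then show ?case using \<sigma> kb by (simp add: l_def)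
      qed
    qed
    then have lim: "(\<lambda>n. complex_of_real (l n ^ n)) \<longlonglongrightarrow> of_real (exp (- (t\<^sup>2 / 2)))" by (rule tendsto_of_real)
    have "(\<lambda>n. cf_char F n (T n) - of_real (l n ^ n)) \<longlonglongrightarrow> 0" by (rule Lim_null_comparison[OF ev e0])
    from tendsto_add[OF this lim] show "(\<lambda>n. cf_char F n (t / (\<sigma> * sqrt n))) \<longlonglongrightarrow> exp (- (t\<^sup>2 / 2))"
      by (simp add: T_def)
  qed
qed

section \<open>Truncated moments and symmetrisation\<close>

text \<open>Stated for an arbitrary measure because it is used both for the digit variable and for
  its symmetrisation on the product space.\<close>

definition trunc_second_moment :: "'a measure \<Rightarrow> ('a \<Rightarrow> real) \<Rightarrow> real \<Rightarrow> real" where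
  "trunc_second_moment M X t = (\<integral>\<omega>. (X \<omega>)\<^sup>2 * indicat_real {\<omega>. \<bar>X \<omega>\<bar> \<le> t} \<omega> \<partial>M)"

lemma integrable_monotone_limit:
  fixes f :: "nat \<Rightarrow> 'a \<Rightarrow> real"
  assumes f: "\<And>i. integrable M (f i)" and mono: "\<And>x. mono (\<lambda>i. f i x)"
    and lim: "\<And>x. (\<lambda>i. f i x) \<longlonglongrightarrow> u x" and bound: "\<And>i. (\<integral>x. f i x \<partial>M) \<le> L"
  shows "integrable M u" "(\<lambda>i. \<integral>x. f i x \<partial>M) \<longlonglongrightarrow> (\<integral>x. u x \<partial>M)" "(\<integral>x. u x \<partial>M) \<le> L"
proof -
  have um: "u \<in> borel_measurable M"
    by (rule borel_measurable_LIMSEQ_real[where u = f]) (use lim f in auto)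
  have inc: "incseq (\<lambda>i. \<integral>x. f i x \<partial>M)"
    by (rule incseq_SucI) (intro integral_mono f monoD[OF mono], simp)
  obtain l where l: "(\<lambda>i. \<integral>x. f i x \<partial>M) \<longlonglongrightarrow> l"
    using incseq_convergent[OF inc, of L] bound by blast
  have "integrable M u" "integral\<^sup>L M u = l"
    using integrable_monotone_convergence[of M f u l] integral_monotone_convergence[of M f u l] f mono lim l um by auto
  then show "integrable M u" "(\<lambda>i. \<integral>x. f i x \<partial>M) \<longlonglongrightarrow> (\<integral>x. u x \<partial>M)" using l by auto
  then show "(\<integral>x. u x \<partial>M) \<le> L" using bound by (intro LIMSEQ_le_const2) auto
qed

section \<open>Truncated second moments and criteria for slow variation\<close>

context prob_space
begin

lemma integrable_trunc_power:
  assumes [measurable]: "X \<in> borel_measurable M"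
  shows "integrable M (\<lambda>\<omega>. \<bar>X \<omega>\<bar> ^ k * indicat_real {\<omega>. \<bar>X \<omega>\<bar> \<le> t} \<omega>)"
proof (rule integrable_const_bound[where B = "\<bar>t\<bar> ^ k"])
  show "AE \<omega> in M. norm (\<bar>X \<omega>\<bar> ^ k * indicat_real {\<omega>. \<bar>X \<omega>\<bar> \<le> t} \<omega>) \<le> \<bar>t\<bar> ^ k"
    by (intro AE_I2) (auto simp: indicator_def abs_mult intro!: power_mono)
qed measurable

lemma integrable_trunc_second_moment:
  assumes "X \<in> borel_measurable M"
  shows "integrable M (\<lambda>\<omega>. (X \<omega>)\<^sup>2 * indicat_real {\<omega>. \<bar>X \<omega>\<bar> \<le> t} \<omega>)"
  using integrable_trunc_power[OF assms, of 2] by simp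

lemma trunc_second_moment_mono:
  assumes "X \<in> borel_measurable M" "s \<le> t"
  shows "trunc_second_moment M X s \<le> trunc_second_moment M X t"
  unfolding trunc_second_moment_def using assms(2)
  by (intro integral_mono integrable_trunc_second_moment assms(1)) (auto simp: indicator_def)

lemma trunc_second_moment_nonneg: "trunc_second_moment M X t \<ge> 0"
  unfolding trunc_second_moment_def by (intro integral_nonneg_AE AE_I2) auto

lemma trunc_indicator_lim: "(\<lambda>n. g * indicat_real {\<omega>. \<bar>X \<omega>\<bar> \<le> real n} \<omega>) \<longlonglongrightarrow> g"
proof (rule tendsto_eventually)
  obtain N where N: "\<bar>X \<omega>\<bar> \<le> real N" using real_arch_simple by blast
  show "\<forall>\<^sub>F n in sequentially. g * indicat_real {\<omega>. \<bar>X \<omega>\<bar> \<le> real n} \<omega> = g"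
    using eventually_ge_at_top[of N] by eventually_elim (use N in \<open>auto simp: indicator_def\<close>)
qed

lemma second_moment_if_trunc_bounded:
  assumes X: "X \<in> borel_measurable M" and L: "\<And>n::nat. trunc_second_moment M X n \<le> L"
  shows "integrable M (\<lambda>\<omega>. (X \<omega>)\<^sup>2)"
    "(\<lambda>n. trunc_second_moment M X (real n)) \<longlonglongrightarrow> expectation (\<lambda>\<omega>. (X \<omega>)\<^sup>2)"
proof -
  let ?f = "\<lambda>n \<omega>. (X \<omega>)\<^sup>2 * indicat_real {\<omega>. \<bar>X \<omega>\<bar> \<le> real n} \<omega>"
  have "mono (\<lambda>n. ?f n \<omega>)" for \<omega> by (intro monoI) (auto simp: indicator_def)
  note * = integrable_monotone_limit[where f = ?f and u = "\<lambda>\<omega>. (X \<omega>)\<^sup>2" and L = L, OF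
      integrable_trunc_second_moment[OF X] this trunc_indicator_lim L[unfolded trunc_second_moment_def]]
  show "integrable M (\<lambda>\<omega>. (X \<omega>)\<^sup>2)" by (rule *(1))
  show "(\<lambda>n. trunc_second_moment M X (real n)) \<longlonglongrightarrow> expectation (\<lambda>\<omega>. (X \<omega>)\<^sup>2)"
    unfolding trunc_second_moment_def by (rule *(2))
qed

lemma trunc_second_moment_at_top:
  assumes X: "X \<in> borel_measurable M" and inf: "\<not> integrable M (\<lambda>\<omega>. (X \<omega>)\<^sup>2)"
  shows "filterlim (trunc_second_moment M X) at_top at_top"
  unfolding filterlim_at_top
proof
  fix L
  obtain n :: nat where n: "trunc_second_moment M X n > L"
    using second_moment_if_trunc_bounded(1)[OF X, of L] inf by (meson not_le)
  show "\<forall>\<^sub>F x in at_top. L \<le> trunc_second_moment M X x"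
    using eventually_ge_at_top[of "real n"]
    by eventually_elim (use n trunc_second_moment_mono[OF X] in \<open>fastforce intro: order.trans less_imp_le\<close>)
qed

lemma trunc_second_moment_finite:
  assumes X: "X \<in> borel_measurable M" and fin: "integrable M (\<lambda>\<omega>. (X \<omega>)\<^sup>2)"
  shows "(trunc_second_moment M X \<longlongrightarrow> expectation (\<lambda>\<omega>. (X \<omega>)\<^sup>2)) at_top"
proof -
  have le: "trunc_second_moment M X t \<le> expectation (\<lambda>\<omega>. (X \<omega>)\<^sup>2)" for t
    unfolding trunc_second_moment_def
    by (intro integral_mono integrable_trunc_second_moment X fin) (auto simp: indicator_def)
  have lim: "(\<lambda>n. trunc_second_moment M X (real n)) \<longlonglongrightarrow> expectation (\<lambda>\<omega>. (X \<omega>)\<^sup>2)"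
    by (rule second_moment_if_trunc_bounded(2)[OF X le])
  show ?thesis
  proof (rule tendstoI)
    fix e :: real assume e: "e > 0"
    obtain N where N: "\<And>n. n \<ge> N \<Longrightarrow> dist (trunc_second_moment M X (real n)) (expectation (\<lambda>\<omega>. (X \<omega>)\<^sup>2)) < e"
      using tendstoD[OF lim e] by (auto simp: eventually_sequentially)
    show "\<forall>\<^sub>F x in at_top. dist (trunc_second_moment M X x) (expectation (\<lambda>\<omega>. (X \<omega>)\<^sup>2)) < e"
      using eventually_ge_at_top[of "real N"]
    proof eventually_elim
      case (elim x)
      show ?case using N[of N] le[of x] le[of N] trunc_second_moment_mono[OF X elim] by (simp add: dist_real_def)
    qed
  qed
qed

lemma borel_measurable_trunc_second_moment:
  assumes "X \<in> borel_measurable M"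
  shows "trunc_second_moment M X \<in> borel_measurable borel"
  by (rule borel_measurable_mono) (auto intro!: monoI trunc_second_moment_mono assms)

lemma slowly_varying_if_finite:
  assumes X: "X \<in> borel_measurable M" and fin: "integrable M (\<lambda>\<omega>. (X \<omega>)\<^sup>2)"
    and pos: "expectation (\<lambda>\<omega>. (X \<omega>)\<^sup>2) > 0"
  shows "slowly_varying (trunc_second_moment M X)"
  unfolding slowly_varying_def
proof (intro conjI allI impI)
  note lim = trunc_second_moment_finite[OF X fin]
  show "trunc_second_moment M X \<in> borel_measurable borel" by (rule borel_measurable_trunc_second_moment[OF X])
  show "\<forall>\<^sub>F x in at_top. 0 < trunc_second_moment M X x" by (rule order_tendstoD(1)[OF lim pos])
  fix c :: real assume c: "c > 0"
  have "((\<lambda>x. trunc_second_moment M X (c * x)) \<longlongrightarrow> expectation (\<lambda>\<omega>. (X \<omega>)\<^sup>2)) at_top"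
    by (rule filterlim_compose[OF lim]) (use c in real_asymp)
  from tendsto_divide[OF this lim] show "((\<lambda>x. trunc_second_moment M X (c * x) / trunc_second_moment M X x) \<longlongrightarrow> 1) at_top"
    using pos by simp
qed

text \<open>For \<open>c \<ge> 1\<close> the increment of the truncated moment from \<open>x\<close>
  to \<open>c * x\<close> lives on \<open>|X| > x\<close> and is at most
  \<open>c^2 x^2 P(|X| > x)\<close>. For \<open>c < 1\<close> the ratio is the reciprocal of one
  already treated.\<close>

lemma slowly_varying_if_tail:
  assumes X[measurable]: "X \<in> borel_measurable M"
    and pos: "\<forall>\<^sub>F x in at_top. trunc_second_moment M X x > 0"
    and tail: "((\<lambda>x. x\<^sup>2 * prob {\<omega>\<in>space M. \<bar>X \<omega>\<bar> > x} / trunc_second_moment M X x) \<longlongrightarrow> 0) at_top"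
  shows "slowly_varying (trunc_second_moment M X)"
proof -
  let ?l = "trunc_second_moment M X" and ?P = "\<lambda>x. prob {\<omega>\<in>space M. \<bar>X \<omega>\<bar> > x}"
  have diff: "?l (c * x) - ?l x \<le> c\<^sup>2 * (x\<^sup>2 * ?P x)" if "x > 0" "c \<ge> 1" for x c
  proof -
    have "?l (c * x) - ?l x = expectation (\<lambda>\<omega>. (X \<omega>)\<^sup>2 * indicat_real {\<omega>. \<bar>X \<omega>\<bar> \<le> c * x} \<omega> - (X \<omega>)\<^sup>2 * indicat_real {\<omega>. \<bar>X \<omega>\<bar> \<le> x} \<omega>)"
      unfolding trunc_second_moment_def by (intro Bochner_Integration.integral_diff[symmetric] integrable_trunc_second_moment X)
    also have "\<dots> \<le> expectation (\<lambda>\<omega>. (c * x)\<^sup>2 * indicat_real {\<omega>\<in>space M. \<bar>X \<omega>\<bar> > x} \<omega>)"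
    proof (rule integral_mono)
      show "integrable M (\<lambda>\<omega>. (X \<omega>)\<^sup>2 * indicat_real {\<omega>. \<bar>X \<omega>\<bar> \<le> c * x} \<omega> - (X \<omega>)\<^sup>2 * indicat_real {\<omega>. \<bar>X \<omega>\<bar> \<le> x} \<omega>)"
        by (intro Bochner_Integration.integrable_diff integrable_trunc_second_moment X)
    next
      fix \<omega> assume "\<omega> \<in> space M"
      moreover have "(X \<omega>)\<^sup>2 \<le> (c * x)\<^sup>2" if "\<bar>X \<omega>\<bar> \<le> c * x" using power_mono[OF that, of 2] by simp
      ultimately show "(X \<omega>)\<^sup>2 * indicat_real {\<omega>. \<bar>X \<omega>\<bar> \<le> c * x} \<omega> - (X \<omega>)\<^sup>2 * indicat_real {\<omega>. \<bar>X \<omega>\<bar> \<le> x} \<omega>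
        \<le> (c * x)\<^sup>2 * indicat_real {\<omega>\<in>space M. \<bar>X \<omega>\<bar> > x} \<omega>"
        by (auto simp: indicator_def)
    next
      have "{\<omega>\<in>space M. \<bar>X \<omega>\<bar> > x} \<in> events" by measurable
      then show "integrable M (\<lambda>\<omega>. (c * x)\<^sup>2 * indicat_real {\<omega>\<in>space M. \<bar>X \<omega>\<bar> > x} \<omega>)"
        by (intro integrable_mult_right integrable_real_indicator) (auto simp: less_top[symmetric])
    qed
    also have "\<dots> = c\<^sup>2 * (x\<^sup>2 * ?P x)" by (simp add: power_mult_distrib)
    finally show ?thesis .
  qed
  have ge1: "((\<lambda>x. ?l (c * x) / ?l x) \<longlongrightarrow> 1) at_top" if c: "c \<ge> 1" for c
  proof (rule tendsto_sandwich[of "\<lambda>_. 1"])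
    show "((\<lambda>x. 1 + c\<^sup>2 * (x\<^sup>2 * ?P x / ?l x)) \<longlongrightarrow> 1) at_top"
      using tendsto_add[OF tendsto_const tendsto_mult[OF tendsto_const tail], of 1 "c\<^sup>2"] by simp
    show "\<forall>\<^sub>F x in at_top. 1 \<le> ?l (c * x) / ?l x"
      using pos eventually_gt_at_top[of 0]
    proof eventually_elim
      case (elim x)
      have "x \<le> c * x" using elim c by simp
      then show ?case using trunc_second_moment_mono[OF X, of x "c * x"] elim by simp
    qed
    show "\<forall>\<^sub>F x in at_top. ?l (c * x) / ?l x \<le> 1 + c\<^sup>2 * (x\<^sup>2 * ?P x / ?l x)"
      using pos eventually_gt_at_top[of 0]
    proof eventually_elim
      case (elim x)
      have "?l (c * x) / ?l x \<le> (?l x + c\<^sup>2 * (x\<^sup>2 * ?P x)) / ?l x"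
        using diff[OF elim(2) c] elim by (intro divide_right_mono) auto
      also have "\<dots> = 1 + c\<^sup>2 * (x\<^sup>2 * ?P x / ?l x)" using elim by (simp add: add_divide_distrib)
      finally show ?case .
    qed
  qed simp
  show ?thesis unfolding slowly_varying_def
  proof (intro conjI allI impI)
    show "?l \<in> borel_measurable borel" by (rule borel_measurable_trunc_second_moment[OF X])
    show "\<forall>\<^sub>F x in at_top. 0 < ?l x" by (rule pos)
    fix c :: real assume c: "c > 0"
    show "((\<lambda>x. ?l (c * x) / ?l x) \<longlongrightarrow> 1) at_top"
    proof (cases "c \<ge> 1")
      case False
      have "((\<lambda>x. ?l (1 / c * (c * x)) / ?l (c * x)) \<longlongrightarrow> 1) at_top"
        by (rule filterlim_compose[OF ge1]) (use c False in \<open>simp, real_asymp\<close>)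
      from tendsto_inverse[OF this] show ?thesis using c by simp
    qed (rule ge1)
  qed
qed

lemma cauchy_schwarz_event:
  assumes g: "integrable M g" "integrable M (\<lambda>\<omega>. (g \<omega>)\<^sup>2)" and A: "A \<in> events"
  shows "(expectation (\<lambda>\<omega>. g \<omega> * indicat_real A \<omega>))\<^sup>2 \<le> prob A * expectation (\<lambda>\<omega>. (g \<omega>)\<^sup>2)"
proof -
  let ?m = "expectation (\<lambda>\<omega>. g \<omega> * indicat_real A \<omega>)"
  have i: "integrable M (\<lambda>\<omega>. g \<omega> * indicat_real A \<omega>)" by (rule integrable_real_mult_indicator[OF A g(1)])
  have iA: "integrable M (indicat_real A)" using A by (simp add: less_top[symmetric])
  show ?thesis
  proof (cases "prob A = 0")
    case True
    then have "AE \<omega> in M. \<omega> \<notin> A" using prob_eq_0[OF A] by simp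
    then have "?m = expectation (\<lambda>\<omega>. 0)" using i by (intro integral_cong_AE) (auto simp: indicator_def)
    then show ?thesis using True by simp
  next
    case False
    then have p: "prob A > 0" by (simp add: measure_nonneg less_le)
    \<comment> \<open>Coefficient of the orthogonal projection of \<open>g\<close> onto the
      indicator of \<open>A\<close>; nonnegativity of the squared residual is the
      inequality.\<close>
    let ?k = "?m / prob A"
    have "0 \<le> expectation (\<lambda>\<omega>. (g \<omega> - ?k * indicat_real A \<omega>)\<^sup>2)" by (intro integral_nonneg_AE AE_I2) simp
    also have "\<dots> = expectation (\<lambda>\<omega>. (g \<omega>)\<^sup>2 - 2 * ?k * (g \<omega> * indicat_real A \<omega>) + ?k\<^sup>2 * indicat_real A \<omega>)"
      by (intro Bochner_Integration.integral_cong refl) (auto simp: indicator_def power2_eq_square algebra_simps)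
    also have "\<dots> = expectation (\<lambda>\<omega>. (g \<omega>)\<^sup>2) - 2 * ?k * ?m + ?k\<^sup>2 * prob A"
      using g(2) i iA A by simp
    also have "\<dots> = expectation (\<lambda>\<omega>. (g \<omega>)\<^sup>2) - ?m\<^sup>2 / prob A"
      using p by (simp add: power2_eq_square field_simps)
    finally show ?thesis using p by (simp add: field_simps)
  qed
qed

end

lemma one_minus_cos_ge:
  fixes y :: real assumes "\<bar>y\<bar> \<le> 1" shows "y\<^sup>2 / 4 \<le> 1 - cos y"
proof -
  have "\<bar>Re (iexp y - (\<Sum>k\<le>3. (\<i> * y) ^ k / fact k))\<bar> \<le> \<bar>y\<bar> ^ 4 / fact 4"
    using order.trans[OF abs_Re_le_cmod iexp_approx1[of y 3]] by simp
  moreover have "Re (iexp y - (\<Sum>k\<le>3. (\<i> * y) ^ k / fact k)) = cos y - (1 - y\<^sup>2 / 2)"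
    by (simp add: numeral_3_eq_3 power2_eq_square Re_exp fact_numeral)
  \<comment> \<open>The cosine series to order 3 leaves an error
    \<open>y^4 / 24 \<le> y^2 / 24\<close>, and \<open>1 / 2 - 1 / 24\<close> exceeds
    \<open>1 / 4\<close>.\<close>
  moreover have "\<bar>y\<bar> ^ 4 \<le> \<bar>y\<bar> ^ 2" using assms by (intro power_decreasing) auto
  ultimately have "\<bar>cos y - (1 - y\<^sup>2 / 2)\<bar> \<le> y\<^sup>2 / 24" by (simp add: fact_numeral)
  then have "cos y - (1 - y\<^sup>2 / 2) \<le> y\<^sup>2 / 24" by (rule abs_le_D1)
  moreover have "0 \<le> y\<^sup>2" by simp
  ultimately show ?thesis by linarith
qed

lemma one_minus_cos_le: "1 - cos (y::real) \<le> y\<^sup>2 / 2"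
proof -
  have "1 - cos y = 2 * (sin (y / 2))\<^sup>2" using cos_double_sin[of "y / 2"] by simp
  also have "(sin (y / 2))\<^sup>2 \<le> (y / 2)\<^sup>2" by (rule iffD1[OF abs_le_square_iff abs_sin_x_le_abs_x])
  finally show ?thesis by (simp add: power2_eq_square)
qed

lemma one_minus_cos_squared: "(1 - cos (y::real))\<^sup>2 = (4 * (1 - cos y) - (1 - cos (2 * y))) / 2"
  using cos_double_cos[of y] by (simp add: power2_eq_square algebra_simps)

section \<open>Characteristic functions and symmetrised variables\<close>

context prob_space
begin

definition chf :: "('a \<Rightarrow> real) \<Rightarrow> real \<Rightarrow> complex" where
  "chf X t = expectation (\<lambda>\<omega>. iexp (t * X \<omega>))"

lemma integrable_iexp_real:
  assumes [measurable]: "X \<in> borel_measurable M"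
  shows "integrable M (\<lambda>\<omega>. iexp (t * X \<omega>))"
  by (rule integrable_const_bound[where B = 1]) auto

lemma norm_chf_le: "norm (chf X t) \<le> 1"
  unfolding chf_def by (rule order.trans[OF integral_norm_bound]) (simp add: prob_space)

lemma chf_zero: "chf X 0 = 1"
  by (simp add: chf_def prob_space)

lemma chf_minus:
  assumes X: "X \<in> borel_measurable M" shows "chf X (- t) = cnj (chf X t)"
proof -
  have "cnj (iexp (t * X \<omega>)) = iexp (- t * X \<omega>)" for \<omega> by (simp add: exp_cnj)
  then show ?thesis
    unfolding chf_def using Bochner_Integration.integral_cnj[of M "\<lambda>\<omega>. iexp (t * X \<omega>)"] by (simp only:)
qed

lemma expectation_norm_iexp_diff:
  assumes X: "X \<in> borel_measurable M"
  shows "expectation (\<lambda>\<omega>. (norm (iexp (t * X \<omega>) - 1))\<^sup>2) = 2 * (1 - Re (chf X t))"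
proof -
  have "(norm (iexp y - 1))\<^sup>2 = 2 - 2 * Re (iexp y)" for y :: real
    unfolding cmod_power2 using sin_cos_squared_add[of y] by (simp add: Re_exp Im_exp power2_diff)
  then have "expectation (\<lambda>\<omega>. (norm (iexp (t * X \<omega>) - 1))\<^sup>2) = expectation (\<lambda>\<omega>. 2 - 2 * Re (iexp (t * X \<omega>)))"
    by (simp only:)
  also have "\<dots> = 2 - 2 * Re (chf X t)"
    unfolding chf_def using integrable_iexp_real[OF X, of t] by (simp add: prob_space del: Re_exp)
  finally show ?thesis by simp
qed

text \<open>Symmetrisation: \<open>1 - \<bar>\<phi>\<bar>\<^sup>2\<close> belongs to the difference of two independent copies of \<open>X\<close>.\<close>

definition symmetrized :: "('a \<Rightarrow> real) \<Rightarrow> 'a \<times> 'a \<Rightarrow> real" where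
  "symmetrized X z = X (fst z) - X (snd z)"

lemma measurable_symmetrized:
  assumes [measurable]: "X \<in> borel_measurable M"
  shows "symmetrized X \<in> borel_measurable (M \<Otimes>\<^sub>M M)"
  unfolding symmetrized_def by measurable

lemma prob_space_pair: "prob_space (M \<Otimes>\<^sub>M M)"
proof -
  interpret pair_prob_space M M ..
  show ?thesis by unfold_locales
qed

lemma integral_pair_fst:
  fixes f :: "'a \<Rightarrow> 'b::{banach,second_countable_topology}"
  assumes f: "integrable M f"
  shows "integrable (M \<Otimes>\<^sub>M M) (\<lambda>z. f (fst z))" "(\<integral>z. f (fst z) \<partial>(M \<Otimes>\<^sub>M M)) = (\<integral>x. f x \<partial>M)"
proof -
  have d: "distr (M \<Otimes>\<^sub>M M) M fst = M" by (rule distr_pair_fst)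
  show "integrable (M \<Otimes>\<^sub>M M) (\<lambda>z. f (fst z))"
    using integrable_distr[of fst "M \<Otimes>\<^sub>M M" M f] f d by simp
  show "(\<integral>z. f (fst z) \<partial>(M \<Otimes>\<^sub>M M)) = (\<integral>x. f x \<partial>M)"
    using integral_distr[of fst "M \<Otimes>\<^sub>M M" M f] f d by simp
qed

lemma integral_pair_snd:
  fixes f :: "'a \<Rightarrow> 'b::{banach,second_countable_topology}"
  assumes f: "integrable M f"
  shows "integrable (M \<Otimes>\<^sub>M M) (\<lambda>z. f (snd z))" "(\<integral>z. f (snd z) \<partial>(M \<Otimes>\<^sub>M M)) = (\<integral>x. f x \<partial>M)"
proof -
  have fst: "distr (M \<Otimes>\<^sub>M M) M fst = M" by (rule distr_pair_fst)
  interpret pair_prob_space M M ..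
  have swap: "distr (M \<Otimes>\<^sub>M M) (M \<Otimes>\<^sub>M M) (\<lambda>(x, y). (y, x)) = M \<Otimes>\<^sub>M M" using distr_pair_swap by simp
  have d: "distr (M \<Otimes>\<^sub>M M) M snd = M"
  proof -
    have "distr (M \<Otimes>\<^sub>M M) M snd = distr (distr (M \<Otimes>\<^sub>M M) (M \<Otimes>\<^sub>M M) (\<lambda>(x, y). (y, x))) M fst"
      by (subst distr_distr) (auto simp: comp_def case_prod_beta)
    then show ?thesis unfolding swap fst .
  qed
  show "integrable (M \<Otimes>\<^sub>M M) (\<lambda>z. f (snd z))"
    using integrable_distr[of snd "M \<Otimes>\<^sub>M M" M f] f d by simp
  show "(\<integral>z. f (snd z) \<partial>(M \<Otimes>\<^sub>M M)) = (\<integral>x. f x \<partial>M)"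
    using integral_distr[of snd "M \<Otimes>\<^sub>M M" M f] f d by simp
qed

lemma one_minus_chf_squared:
  assumes X[measurable]: "X \<in> borel_measurable M"
  shows "(\<integral>z. 1 - cos (t * symmetrized X z) \<partial>(M \<Otimes>\<^sub>M M)) = 1 - (norm (chf X t))\<^sup>2"
proof -
  interpret P: prob_space "M \<Otimes>\<^sub>M M" by (rule prob_space_pair)
  interpret pair_sigma_finite M M ..
  have i: "integrable (M \<Otimes>\<^sub>M M) (\<lambda>z. iexp (t * X (fst z)) * iexp (- t * X (snd z)))"
    by (rule P.integrable_const_bound[where B = 1]) (auto simp: norm_mult)
  have "(\<integral>z. iexp (t * X (fst z)) * iexp (- t * X (snd z)) \<partial>(M \<Otimes>\<^sub>M M))
    = (\<integral>x. \<integral>y. iexp (t * X x) * iexp (- t * X y) \<partial>M \<partial>M)"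
    using integral_fst'[OF i] by simp
  also have "\<dots> = chf X t * chf X (- t)"
    unfolding chf_def by simp
  also have "\<dots> = of_real ((norm (chf X t))\<^sup>2)"
    unfolding chf_minus[OF X] complex_norm_square by simp
  finally have *: "(\<integral>z. iexp (t * X (fst z)) * iexp (- t * X (snd z)) \<partial>(M \<Otimes>\<^sub>M M)) = of_real ((norm (chf X t))\<^sup>2)" .
  have re: "cos (t * symmetrized X z) = Re (iexp (t * X (fst z)) * iexp (- t * X (snd z)))" for z
    by (simp add: symmetrized_def Re_exp Im_exp right_diff_distrib cos_diff)
  have "(\<integral>z. cos (t * symmetrized X z) \<partial>(M \<Otimes>\<^sub>M M)) = (norm (chf X t))\<^sup>2"
    unfolding re using * integral_Re[OF i] by simp
  moreover have "integrable (M \<Otimes>\<^sub>M M) (\<lambda>z. cos (t * symmetrized X z))"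
    by (rule P.integrable_const_bound[where B = 1]) (auto intro: measurable_symmetrized[OF X, THEN measurable_compose])
  ultimately show ?thesis by (simp add: P.prob_space)
qed

text \<open>By Fubini some section \<open>y \<mapsto> X x - X y\<close> would be square integrable,
  and it differs from \<open>X\<close> only by sign and an additive constant.\<close>

lemma not_integrable_symmetrized:
  assumes X[measurable]: "X \<in> borel_measurable M" and inf: "\<not> integrable M (\<lambda>\<omega>. (X \<omega>)\<^sup>2)"
  shows "\<not> integrable (M \<Otimes>\<^sub>M M) (\<lambda>z. (symmetrized X z)\<^sup>2)"
proof
  interpret pair_sigma_finite M M ..
  assume "integrable (M \<Otimes>\<^sub>M M) (\<lambda>z. (symmetrized X z)\<^sup>2)"
  then have "AE x in M. integrable M (\<lambda>y. (symmetrized X (x, y))\<^sup>2)" by (rule AE_integrable_fst')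
  then obtain x where x: "integrable M (\<lambda>y. (X x - X y)\<^sup>2)"
    using AE_prob_1 ae_filter_bot eventually_happens'[of "ae_filter M"] by (fastforce simp: symmetrized_def trivial_limit_def)
  have "integrable M (\<lambda>y. (X y)\<^sup>2)"
  proof (rule Bochner_Integration.integrable_bound)
    show "integrable M (\<lambda>y. 2 * (X x - X y)\<^sup>2 + 2 * (X x)\<^sup>2)" using x by simp
    have "b\<^sup>2 \<le> 2 * (a - b)\<^sup>2 + 2 * a\<^sup>2" for a b :: real
      using zero_le_power2[of "2 * a - b"] by (simp add: power2_eq_square algebra_simps)
    then show "AE y in M. norm ((X y)\<^sup>2) \<le> norm (2 * (X x - X y)\<^sup>2 + 2 * (X x)\<^sup>2)"
      by (intro AE_I2) simp
  qed measurable
  then show False using inf by simp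
qed

text \<open>Cutting the integral of \<open>1 - cos\<close> at level \<open>1 / |t|\<close> bounds it
  below by \<open>t^2 / 4\<close> times the truncated moment of the symmetrised variable, and that
  moment tends to infinity.\<close>

lemma one_minus_chf_squared_ge:
  assumes X: "X \<in> borel_measurable M" and inf: "\<not> integrable M (\<lambda>\<omega>. (X \<omega>)\<^sup>2)"
  shows "\<exists>d>0. \<forall>t. 0 < \<bar>t\<bar> \<and> \<bar>t\<bar> < d \<longrightarrow> K * t\<^sup>2 \<le> 1 - (norm (chf X t))\<^sup>2"
proof -
  interpret P: prob_space "M \<Otimes>\<^sub>M M" by (rule prob_space_pair)
  note Z = measurable_symmetrized[OF X]
  let ?l = "trunc_second_moment (M \<Otimes>\<^sub>M M) (symmetrized X)"
  have lower: "t\<^sup>2 / 4 * ?l (1 / \<bar>t\<bar>) \<le> 1 - (norm (chf X t))\<^sup>2" if t: "t \<noteq> 0" for t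
  proof -
    have "t\<^sup>2 / 4 * ?l (1 / \<bar>t\<bar>) = (\<integral>z. t\<^sup>2 / 4 * ((symmetrized X z)\<^sup>2 * indicat_real {z. \<bar>symmetrized X z\<bar> \<le> 1 / \<bar>t\<bar>} z) \<partial>(M \<Otimes>\<^sub>M M))"
      unfolding trunc_second_moment_def by simp
    also have "\<dots> \<le> (\<integral>z. 1 - cos (t * symmetrized X z) \<partial>(M \<Otimes>\<^sub>M M))"
    proof (rule integral_mono)
      show "integrable (M \<Otimes>\<^sub>M M) (\<lambda>z. t\<^sup>2 / 4 * ((symmetrized X z)\<^sup>2 * indicat_real {z. \<bar>symmetrized X z\<bar> \<le> 1 / \<bar>t\<bar>} z))"
        by (intro integrable_mult_right P.integrable_trunc_second_moment Z)
      show "integrable (M \<Otimes>\<^sub>M M) (\<lambda>z. 1 - cos (t * symmetrized X z))"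
        using Z by (intro P.integrable_const_bound[where B = 2] AE_I2) (auto simp: abs_le_iff intro: order.trans[OF _ cos_ge_minus_one])
      show "t\<^sup>2 / 4 * ((symmetrized X z)\<^sup>2 * indicat_real {z. \<bar>symmetrized X z\<bar> \<le> 1 / \<bar>t\<bar>} z) \<le> 1 - cos (t * symmetrized X z)" for z
      proof (cases "\<bar>symmetrized X z\<bar> \<le> 1 / \<bar>t\<bar>")
        case True
        then have "\<bar>t * symmetrized X z\<bar> \<le> 1" using t by (simp add: abs_mult field_simps)
        from one_minus_cos_ge[OF this] show ?thesis using True by (simp add: power_mult_distrib)
      qed simp
    qed
    also have "\<dots> = 1 - (norm (chf X t))\<^sup>2" by (rule one_minus_chf_squared[OF X])
    finally show ?thesis .
  qed
  have "\<forall>\<^sub>F x in at_top. 4 * \<bar>K\<bar> \<le> ?l x"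
    using P.trunc_second_moment_at_top[OF Z not_integrable_symmetrized[OF X inf]] by (simp add: filterlim_at_top)
  then obtain x0 where x0: "\<And>x. x \<ge> x0 \<Longrightarrow> 4 * \<bar>K\<bar> \<le> ?l x" by (auto simp: eventually_at_top_linorder)
  show ?thesis
  proof (intro exI[of _ "1 / (\<bar>x0\<bar> + 1)"] conjI allI impI)
    fix t assume t: "0 < \<bar>t\<bar> \<and> \<bar>t\<bar> < 1 / (\<bar>x0\<bar> + 1)"
    then have "\<bar>x0\<bar> + 1 < 1 / \<bar>t\<bar>" by (simp add: field_simps)
    then have "4 * \<bar>K\<bar> \<le> ?l (1 / \<bar>t\<bar>)" by (intro x0) auto
    then have "t\<^sup>2 / 4 * (4 * \<bar>K\<bar>) \<le> t\<^sup>2 / 4 * ?l (1 / \<bar>t\<bar>)" by (intro mult_left_mono) auto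
    also have "\<dots> \<le> 1 - (norm (chf X t))\<^sup>2" using t by (intro lower) auto
    finally have "t\<^sup>2 * \<bar>K\<bar> \<le> 1 - (norm (chf X t))\<^sup>2" by simp
    moreover have "K * t\<^sup>2 \<le> t\<^sup>2 * \<bar>K\<bar>" using mult_right_mono[of K "\<bar>K\<bar>" "t\<^sup>2"] by (simp add: mult.commute)
    ultimately show "K * t\<^sup>2 \<le> 1 - (norm (chf X t))\<^sup>2" by simp
  qed simp
qed

lemma prob_tail_small:
  fixes X :: "'a \<Rightarrow> real"
  assumes X[measurable]: "X \<in> borel_measurable M" and e: "e > 0"
  obtains K where "K > 0" "\<And>x. x \<ge> K \<Longrightarrow> prob {\<omega>\<in>space M. \<bar>X \<omega>\<bar> > x} < e"
proof -
  have "(\<lambda>n. prob {\<omega>\<in>space M. \<bar>X \<omega>\<bar> > real n}) \<longlonglongrightarrow> prob (\<Inter>n. {\<omega>\<in>space M. \<bar>X \<omega>\<bar> > real n})"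
    by (rule finite_Lim_measure_decseq) (auto simp: decseq_def)
  moreover have "(\<Inter>n. {\<omega>\<in>space M. \<bar>X \<omega>\<bar> > real n}) = {}"
  proof -
    have "\<exists>n. \<not> real n < \<bar>X \<omega>\<bar>" for \<omega> using reals_Archimedean2[of "\<bar>X \<omega>\<bar>"] less_asym by blast
    then show ?thesis by auto
  qed
  ultimately have "(\<lambda>n. prob {\<omega>\<in>space M. \<bar>X \<omega>\<bar> > real n}) \<longlonglongrightarrow> 0" by simp
  then obtain n where n: "prob {\<omega>\<in>space M. \<bar>X \<omega>\<bar> > real n} < e"
    using order_tendstoD(2)[of _ 0] e by (fastforce simp: eventually_sequentially)
  show ?thesis
  proof (rule that[of "real n + 1"])
    fix x assume "x \<ge> real n + 1"
    then have "prob {\<omega>\<in>space M. \<bar>X \<omega>\<bar> > x} \<le> prob {\<omega>\<in>space M. \<bar>X \<omega>\<bar> > real n}"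
      by (intro finite_measure_mono) auto
    then show "prob {\<omega>\<in>space M. \<bar>X \<omega>\<bar> > x} < e" using n by simp
  qed simp
qed

text \<open>With an infinite second moment the linear size of \<open>e\<^bsup>itX\<^esup> - 1\<close> is negligible against the
  square root of its quadratic size, so the dependence between digits has no effect.\<close>

lemma expectation_norm_iexp_small:
  assumes X[measurable]: "X \<in> borel_measurable M" and inf: "\<not> integrable M (\<lambda>\<omega>. (X \<omega>)\<^sup>2)" and e: "e > 0"
  shows "\<exists>d>0. \<forall>t. 0 < \<bar>t\<bar> \<and> \<bar>t\<bar> < d \<longrightarrow> 0 < 1 - (norm (chf X t))\<^sup>2 \<and>
     (expectation (\<lambda>\<omega>. norm (iexp (t * X \<omega>) - 1)))\<^sup>2 \<le> e * (1 - (norm (chf X t))\<^sup>2)"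
proof -
  \<comment> \<open>The tail probability is taken below \<open>1 / 4\<close> so that the term in
    \<open>\<eta>^2\<close> can be absorbed, and below \<open>e / 8\<close> for the term in
    \<open>U\<close>.\<close>
  obtain K where K: "K > 0" "prob {\<omega>\<in>space M. \<bar>X \<omega>\<bar> > K} < min (1 / 4) (e / 8)"
    using prob_tail_small[OF X, of "min (1 / 4) (e / 8)"] e by auto
  let ?A = "{\<omega>\<in>space M. \<bar>X \<omega>\<bar> > K}"
  obtain d where d: "d > 0" "\<And>t. 0 < \<bar>t\<bar> \<Longrightarrow> \<bar>t\<bar> < d \<Longrightarrow> (8 * K\<^sup>2 / e) * t\<^sup>2 \<le> 1 - (norm (chf X t))\<^sup>2"
    using one_minus_chf_squared_ge[OF X inf, of "8 * K\<^sup>2 / e"] by blast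
  show ?thesis
  proof (intro exI[of _ d] conjI allI impI)
    fix t assume t: "0 < \<bar>t\<bar> \<and> \<bar>t\<bar> < d"
    define U where "U = 1 - (norm (chf X t))\<^sup>2"
    have U: "(8 * K\<^sup>2 / e) * t\<^sup>2 \<le> U" using d(2) t by (simp add: U_def)
    have "0 < (8 * K\<^sup>2 / e) * t\<^sup>2" using K e t by simp
    then have U0: "U > 0" using U by simp
    then show "0 < 1 - (norm (chf X t))\<^sup>2" by (simp add: U_def)
    define g where "g \<omega> = norm (iexp (t * X \<omega>) - 1)" for \<omega>
    have [measurable]: "g \<in> borel_measurable M" unfolding g_def by measurable
    have g2: "g \<omega> \<le> 2" "0 \<le> g \<omega>" for \<omega>
      using norm_triangle_ineq4[of "iexp (t * X \<omega>)" 1] by (simp_all add: g_def)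
    have ig: "integrable M g" by (rule integrable_const_bound[where B = 2]) (use g2 in auto)
    have ig2: "integrable M (\<lambda>\<omega>. (g \<omega>)\<^sup>2)"
    proof (rule integrable_const_bound[where B = "2\<^sup>2"])
      show "AE \<omega> in M. norm ((g \<omega>)\<^sup>2) \<le> 2\<^sup>2" using power_mono[OF g2(1) g2(2), of _ 2] by (intro AE_I2) simp
    qed measurable
    define \<eta> where "\<eta> = expectation g"
    have \<eta>0: "\<eta> \<ge> 0" unfolding \<eta>_def using g2 by (intro integral_nonneg_AE) simp
    have A: "?A \<in> events" by measurable
    \<comment> \<open>\<open>E g^2 = 2 (1 - Re \<phi>)\<close> splits as
      \<open>(1 - |\<phi>|^2) + |\<phi> - 1|^2\<close>, and the second summand is at most
      \<open>\<eta>^2\<close>.\<close>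
    have Eg2: "expectation (\<lambda>\<omega>. (g \<omega>)\<^sup>2) \<le> U + \<eta>\<^sup>2"
    proof -
      have "expectation (\<lambda>\<omega>. (g \<omega>)\<^sup>2) = 2 * (1 - Re (chf X t))"
        unfolding g_def by (rule expectation_norm_iexp_diff[OF X])
      also have "\<dots> = U + (norm (chf X t - 1))\<^sup>2"
        unfolding U_def cmod_power2 by (simp add: power2_eq_square algebra_simps)
      also have "norm (chf X t - 1) \<le> \<eta>"
      proof -
        have "chf X t - 1 = expectation (\<lambda>\<omega>. iexp (t * X \<omega>) - 1)"
          unfolding chf_def using integrable_iexp_real[OF X, of t] by (simp add: prob_space)
        then show ?thesis unfolding \<eta>_def g_def by (simp only: integral_norm_bound)
      qed
      then have "U + (norm (chf X t - 1))\<^sup>2 \<le> U + \<eta>\<^sup>2" by (intro add_left_mono power_mono) auto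
      finally show ?thesis .
    qed
    have iA: "integrable M (\<lambda>\<omega>. g \<omega> * indicat_real ?A \<omega>)" by (rule integrable_real_mult_indicator[OF A ig])
    let ?m = "expectation (\<lambda>\<omega>. g \<omega> * indicat_real ?A \<omega>)"
    have m0: "?m \<ge> 0" using g2 by (intro integral_nonneg_AE AE_I2) simp
    \<comment> \<open>Where \<open>|X| \<le> K\<close> the integrand is at most
      \<open>|t| K\<close>, a small multiple of \<open>sqrt U\<close> by the choice of
      \<open>d\<close>; where \<open>|X| > K\<close> Cauchy-Schwarz gains the small probability of
      the event.\<close>
    have "\<eta> \<le> expectation (\<lambda>\<omega>. \<bar>t\<bar> * K + g \<omega> * indicat_real ?A \<omega>)"
      unfolding \<eta>_def
    proof (rule integral_mono)
      fix \<omega> assume w: "\<omega> \<in> space M"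
      show "g \<omega> \<le> \<bar>t\<bar> * K + g \<omega> * indicat_real ?A \<omega>"
      proof (cases "\<omega> \<in> ?A")
        case False
        have "g \<omega> \<le> \<bar>t * X \<omega>\<bar>" using iexp_approx1[of "t * X \<omega>" 0] by (simp add: g_def)
        also have "\<dots> \<le> \<bar>t\<bar> * K" unfolding abs_mult using False w by (intro mult_left_mono) auto
        finally show ?thesis using False by simp
      qed (use K in simp)
    qed (use ig iA in auto)
    also have "\<dots> = \<bar>t\<bar> * K + ?m" using iA by (simp add: prob_space)
    finally have "\<eta>\<^sup>2 \<le> (\<bar>t\<bar> * K + ?m)\<^sup>2" using \<eta>0 by (intro power_mono) auto
    also have "\<dots> \<le> 2 * (\<bar>t\<bar> * K)\<^sup>2 + 2 * ?m\<^sup>2"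
      using zero_le_power2[of "\<bar>t\<bar> * K - ?m"] by (simp add: power2_sum power2_diff)
    also have "?m\<^sup>2 \<le> prob ?A * (U + \<eta>\<^sup>2)"
      using cauchy_schwarz_event[OF ig ig2 A] mult_left_mono[OF Eg2, of "prob ?A"] by simp
    then have "2 * (\<bar>t\<bar> * K)\<^sup>2 + 2 * ?m\<^sup>2 \<le> 2 * (\<bar>t\<bar> * K)\<^sup>2 + 2 * (prob ?A * (U + \<eta>\<^sup>2))" by simp
    also have "\<dots> = 2 * (K\<^sup>2 * t\<^sup>2) + 2 * prob ?A * U + 2 * prob ?A * \<eta>\<^sup>2"
      by (simp add: power_mult_distrib algebra_simps)
    also have "\<dots> \<le> 2 * (e / 8 * U) + 2 * (e / 8) * U + 2 * (1 / 4) * \<eta>\<^sup>2"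
    proof -
      have "K\<^sup>2 * t\<^sup>2 \<le> e / 8 * U" using U e by (simp add: field_simps)
      moreover have "2 * prob ?A * U \<le> 2 * (e / 8) * U" using K U0 by (intro mult_right_mono) auto
      moreover have "2 * prob ?A * \<eta>\<^sup>2 \<le> 2 * (1 / 4) * \<eta>\<^sup>2" using K by (intro mult_right_mono) auto
      ultimately show ?thesis by linarith
    qed
    \<comment> \<open>The bound is \<open>e * U / 2 + \<eta>^2 / 2\<close>; half of
      \<open>\<eta>^2\<close> moves to the left.\<close>
    finally have "\<eta>\<^sup>2 \<le> e * U" by linarith
    then show "(expectation (\<lambda>\<omega>. norm (iexp (t * X \<omega>) - 1)))\<^sup>2 \<le> e * (1 - (norm (chf X t))\<^sup>2)"
      by (simp add: \<eta>_def U_def g_def[abs_def])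
  qed (rule d(1))
qed

end

section \<open>Slow variation implies convergence of powers\<close>

lemma iexp_taylor2: "(\<Sum>k\<le>2. (\<i> * complex_of_real y) ^ k / fact k) = 1 + \<i> * of_real y - of_real (y\<^sup>2 / 2)"
  by (simp add: numeral_2_eq_2 power2_eq_square algebra_simps)

section \<open>Tail moments, third moments and normalising constants under slow variation\<close>

context prob_space
begin

lemma shell_bound:
  assumes X[measurable]: "X \<in> borel_measurable M" and y: "0 < y" "y \<le> z"
  shows "integrable M (\<lambda>\<omega>. \<bar>X \<omega>\<bar> * indicat_real {\<omega>. y < \<bar>X \<omega>\<bar> \<and> \<bar>X \<omega>\<bar> \<le> z} \<omega>)"
    "expectation (\<lambda>\<omega>. \<bar>X \<omega>\<bar> * indicat_real {\<omega>. y < \<bar>X \<omega>\<bar> \<and> \<bar>X \<omega>\<bar> \<le> z} \<omega>)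
      \<le> (trunc_second_moment M X z - trunc_second_moment M X y) / y"
proof -
  let ?f = "\<lambda>\<omega>. \<bar>X \<omega>\<bar> * indicat_real {\<omega>. y < \<bar>X \<omega>\<bar> \<and> \<bar>X \<omega>\<bar> \<le> z} \<omega>"
  show i: "integrable M ?f"
    by (rule integrable_const_bound[where B = z]) (use y in \<open>auto simp: indicator_def\<close>)
  have d: "integrable M (\<lambda>\<omega>. ((X \<omega>)\<^sup>2 * indicat_real {\<omega>. \<bar>X \<omega>\<bar> \<le> z} \<omega> - (X \<omega>)\<^sup>2 * indicat_real {\<omega>. \<bar>X \<omega>\<bar> \<le> y} \<omega>) / y)"
    by (intro integrable_divide Bochner_Integration.integrable_diff integrable_trunc_second_moment X)
  have "expectation ?f \<le> expectation (\<lambda>\<omega>. ((X \<omega>)\<^sup>2 * indicat_real {\<omega>. \<bar>X \<omega>\<bar> \<le> z} \<omega> - (X \<omega>)\<^sup>2 * indicat_real {\<omega>. \<bar>X \<omega>\<bar> \<le> y} \<omega>) / y)"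
  proof (rule integral_mono[OF i d])
    fix \<omega>
    have "\<bar>X \<omega>\<bar> \<le> (X \<omega>)\<^sup>2 / y" if "y < \<bar>X \<omega>\<bar>"
    proof -
      have "\<bar>X \<omega>\<bar> * y \<le> \<bar>X \<omega>\<bar> * \<bar>X \<omega>\<bar>" using that y by (intro mult_left_mono) auto
      then show ?thesis using y by (simp add: field_simps power2_eq_square)
    qed
    then show "?f \<omega> \<le> ((X \<omega>)\<^sup>2 * indicat_real {\<omega>. \<bar>X \<omega>\<bar> \<le> z} \<omega> - (X \<omega>)\<^sup>2 * indicat_real {\<omega>. \<bar>X \<omega>\<bar> \<le> y} \<omega>) / y"
      using y by (auto simp: indicator_def)
  qed
  also have "\<dots> = (trunc_second_moment M X z - trunc_second_moment M X y) / y"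
    unfolding trunc_second_moment_def using integrable_trunc_second_moment[OF X] by simp
  finally show "expectation ?f \<le> (trunc_second_moment M X z - trunc_second_moment M X y) / y" .
qed

text \<open>Dyadic shells: the truncated moment \<open>l\<close> grows by at most a factor
  \<open>1 + e\<close> per doubling, so the shell at \<open>2^j x\<close> contributes at most
  \<open>e ((1 + e) / 2)^j\<close> times \<open>l x / x\<close>. With \<open>e \<le> 1 / 2\<close>
  the ratio is at most \<open>3 / 4\<close>, whose geometric series is 4. Integrability comes out as
  well, by monotone convergence, and is the source of the finite mean.\<close>

lemma slowly_varying_tail_moment:
  assumes X[measurable]: "X \<in> borel_measurable M" and sv: "slowly_varying (trunc_second_moment M X)"
    and e: "0 < e" "e \<le> 1 / 2"
  shows "\<forall>\<^sub>F x in at_top. integrable M (\<lambda>\<omega>. \<bar>X \<omega>\<bar> * indicat_real {\<omega>. x < \<bar>X \<omega>\<bar>} \<omega>) \<and>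
    x * expectation (\<lambda>\<omega>. \<bar>X \<omega>\<bar> * indicat_real {\<omega>. x < \<bar>X \<omega>\<bar>} \<omega>) \<le> 4 * e * trunc_second_moment M X x"
proof -
  let ?l = "trunc_second_moment M X"
  have pos: "\<forall>\<^sub>F x in at_top. ?l x > 0" and "((\<lambda>x. ?l (2 * x) / ?l x) \<longlongrightarrow> 1) at_top"
    using sv by (auto simp: slowly_varying_def)
  then have "\<forall>\<^sub>F x in at_top. ?l (2 * x) / ?l x < 1 + e"
    using e by (intro order_tendstoD(2)[where y = 1]) auto
  with pos have "\<forall>\<^sub>F x in at_top. ?l (2 * x) \<le> (1 + e) * ?l x"
    by eventually_elim (simp add: field_simps)
  then obtain x0 where x0: "\<And>x. x \<ge> x0 \<Longrightarrow> ?l (2 * x) \<le> (1 + e) * ?l x"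
    by (auto simp: eventually_at_top_linorder)
  show ?thesis using eventually_ge_at_top[of "max 1 x0"]
  proof eventually_elim
    case (elim x)
    then have x: "x \<ge> 1" "x \<ge> x0" by auto
    have l0: "?l y \<ge> 0" for y by (rule trunc_second_moment_nonneg)
    have pw: "x * 2 ^ j \<ge> x" for j :: nat using x by (simp add: mult_le_cancel_left1)
    have grow: "?l (x * 2 ^ j) \<le> (1 + e) ^ j * ?l x" for j
    proof (induction j)
      case (Suc j)
      have "?l (2 * (x * 2 ^ j)) \<le> (1 + e) * ?l (x * 2 ^ j)" using pw[of j] x by (intro x0) linarith
      also have "\<dots> \<le> (1 + e) * ((1 + e) ^ j * ?l x)" using Suc e by (intro mult_left_mono) auto
      finally show ?case by (simp add: mult_ac)
    qed simp
    let ?f = "\<lambda>J \<omega>. \<bar>X \<omega>\<bar> * indicat_real {\<omega>. x < \<bar>X \<omega>\<bar> \<and> \<bar>X \<omega>\<bar> \<le> x * 2 ^ J} \<omega>"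
    have fi: "integrable M (?f J)" for J using shell_bound(1)[OF X, of x "x * 2 ^ J"] x pw[of J] by auto
    have fb: "expectation (?f J) \<le> (\<Sum>j<J. (3 / 4) ^ j) * (e * ?l x / x)" for J
    proof (induction J)
      case 0
      have "?f 0 = (\<lambda>\<omega>. 0)" by (auto simp: indicator_def)
      then show ?case by simp
    next
      case (Suc J)
      let ?y = "x * 2 ^ J" and ?g = "\<lambda>\<omega>. \<bar>X \<omega>\<bar> * indicat_real {\<omega>. x * 2 ^ J < \<bar>X \<omega>\<bar> \<and> \<bar>X \<omega>\<bar> \<le> x * 2 ^ Suc J} \<omega>"
      have y: "0 < ?y" "?y \<le> x * 2 ^ Suc J" using x by auto
      have "?f (Suc J) = (\<lambda>\<omega>. ?f J \<omega> + ?g \<omega>)"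
      proof
        fix \<omega> show "?f (Suc J) \<omega> = ?f J \<omega> + ?g \<omega>"
          using pw[of J] y(2) by (auto simp: indicator_def)
      qed
      then have "expectation (?f (Suc J)) = expectation (?f J) + expectation ?g"
        using fi[of J] shell_bound(1)[OF X y] by simp
      also have "expectation ?g \<le> (?l (x * 2 ^ Suc J) - ?l ?y) / ?y" by (rule shell_bound(2)[OF X y])
      also have "\<dots> \<le> (e * ((1 + e) ^ J * ?l x)) / ?y"
      proof (intro divide_right_mono)
        have "?l (2 * ?y) \<le> (1 + e) * ?l ?y" using pw[of J] x by (intro x0) linarith
        then have "?l (2 * ?y) - ?l ?y \<le> e * ?l ?y" by (simp add: algebra_simps)
        also have "\<dots> \<le> e * ((1 + e) ^ J * ?l x)" using grow[of J] e by (intro mult_left_mono) auto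
        finally show "?l (x * 2 ^ Suc J) - ?l ?y \<le> e * ((1 + e) ^ J * ?l x)" by (simp add: mult_ac)
      qed (use y in simp)
      also have "\<dots> = ((1 + e) / 2) ^ J * (e * ?l x / x)"
        using x by (simp add: power_divide field_simps)
      also have "\<dots> \<le> (3 / 4) ^ J * (e * ?l x / x)"
        using e l0[of x] x by (intro mult_right_mono power_mono) auto
      finally show ?case using Suc unfolding sum.lessThan_Suc distrib_right by linarith
    qed
    have geo: "(\<Sum>j<J. (3 / 4 :: real) ^ j) \<le> 4" for J
      using sum_le_suminf[OF summable_geometric[of "3 / 4 :: real"], of "{..<J}"] by (simp add: suminf_geometric)
    have fb': "expectation (?f J) \<le> 4 * (e * ?l x / x)" for J
      by (rule order.trans[OF fb mult_right_mono[OF geo]]) (use e l0[of x] x in simp)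
    have lim: "(\<lambda>J. ?f J \<omega>) \<longlonglongrightarrow> \<bar>X \<omega>\<bar> * indicat_real {\<omega>. x < \<bar>X \<omega>\<bar>} \<omega>" for \<omega>
    proof (rule tendsto_eventually)
      obtain N where N: "\<bar>X \<omega>\<bar> < 2 ^ N" using real_arch_pow[of 2 "\<bar>X \<omega>\<bar>"] by auto
      show "\<forall>\<^sub>F J in sequentially. ?f J \<omega> = \<bar>X \<omega>\<bar> * indicat_real {\<omega>. x < \<bar>X \<omega>\<bar>} \<omega>"
        using eventually_ge_at_top[of N]
      proof eventually_elim
        case (elim J)
        have "(2::real) ^ N \<le> 2 ^ J" using elim by (intro power_increasing) auto
        also have "\<dots> \<le> x * 2 ^ J" using x by (simp add: mult_le_cancel_right1)
        finally have "\<bar>X \<omega>\<bar> \<le> x * 2 ^ J" using N by simp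
        then show ?case by (auto simp: indicator_def)
      qed
    qed
    have mono: "mono (\<lambda>J. ?f J \<omega>)" for \<omega>
    proof (rule monoI)
      fix i j :: nat assume "i \<le> j"
      then have "x * 2 ^ i \<le> x * 2 ^ j" using x by (intro mult_left_mono power_increasing) auto
      then show "?f i \<omega> \<le> ?f j \<omega>" by (auto simp: indicator_def)
    qed
    note * = integrable_monotone_limit[where f = ?f and L = "4 * (e * ?l x / x)", OF fi mono lim fb']
    show ?case using *(1) *(3) x by (simp add: field_simps)
  qed
qed

lemma slowly_varying_integrable:
  assumes X[measurable]: "X \<in> borel_measurable M" and sv: "slowly_varying (trunc_second_moment M X)"
  shows "integrable M X"
proof -
  obtain x where i: "integrable M (\<lambda>\<omega>. \<bar>X \<omega>\<bar> * indicat_real {\<omega>. x < \<bar>X \<omega>\<bar>} \<omega>)"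
    using eventually_happens[OF slowly_varying_tail_moment[OF X sv, of "1 / 2"]] by auto
  have "integrable M (\<lambda>\<omega>. \<bar>x\<bar> + \<bar>X \<omega>\<bar> * indicat_real {\<omega>. x < \<bar>X \<omega>\<bar>} \<omega>)" using i by simp
  then show ?thesis
    by (rule Bochner_Integration.integrable_bound) (auto simp: indicator_def)
qed

lemma tail_moment_ratio:
  assumes X[measurable]: "X \<in> borel_measurable M" and sv: "slowly_varying (trunc_second_moment M X)"
  shows "((\<lambda>x. x * expectation (\<lambda>\<omega>. \<bar>X \<omega>\<bar> * indicat_real {\<omega>. x < \<bar>X \<omega>\<bar>} \<omega>) / trunc_second_moment M X x) \<longlongrightarrow> 0) at_top"
proof (rule tendstoI)
  fix d :: real assume d: "d > 0"
  let ?e = "min (1 / 2) (d / 8)"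
  have e: "0 < ?e" "?e \<le> 1 / 2" using d by auto
  have pos: "\<forall>\<^sub>F x in at_top. trunc_second_moment M X x > 0" using sv by (simp add: slowly_varying_def)
  show "\<forall>\<^sub>F x in at_top. dist (x * expectation (\<lambda>\<omega>. \<bar>X \<omega>\<bar> * indicat_real {\<omega>. x < \<bar>X \<omega>\<bar>} \<omega>) / trunc_second_moment M X x) 0 < d"
    using slowly_varying_tail_moment[OF X sv e] pos eventually_gt_at_top[of 0]
  proof eventually_elim
    case (elim x)
    let ?E = "expectation (\<lambda>\<omega>. \<bar>X \<omega>\<bar> * indicat_real {\<omega>. x < \<bar>X \<omega>\<bar>} \<omega>)"
    have "?E \<ge> 0" by (intro integral_nonneg_AE AE_I2) simp
    moreover have "x * ?E / trunc_second_moment M X x \<le> 4 * ?e" using elim by (simp add: divide_le_eq)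
    moreover have "4 * ?e < d" using d by (simp add: min_def)
    ultimately show ?case using elim by (simp add: dist_real_def abs_of_nonneg)
  qed
qed

text \<open>Split at \<open>d * x\<close>: below, \<open>|X|^3 \<le> d x X^2\<close>; between
  \<open>d * x\<close> and \<open>x\<close>, \<open>|X|^3 \<le> x X^2\<close>, and slow variation
  makes the increment of the truncated moment relatively small.\<close>

lemma third_moment_ratio:
  assumes X[measurable]: "X \<in> borel_measurable M" and sv: "slowly_varying (trunc_second_moment M X)"
  shows "((\<lambda>x. expectation (\<lambda>\<omega>. \<bar>X \<omega>\<bar> ^ 3 * indicat_real {\<omega>. \<bar>X \<omega>\<bar> \<le> x} \<omega>) / (x * trunc_second_moment M X x)) \<longlongrightarrow> 0) at_top"
proof (rule tendstoI)
  let ?l = "trunc_second_moment M X" and ?E = "\<lambda>x. expectation (\<lambda>\<omega>. \<bar>X \<omega>\<bar> ^ 3 * indicat_real {\<omega>. \<bar>X \<omega>\<bar> \<le> x} \<omega>)"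
  have bound: "?E x \<le> d * x * ?l (d * x) + x * (?l x - ?l (d * x))" if "x > 0" "0 < d" "d < 1" for x d
  proof -
    let ?q = "\<lambda>t \<omega>. (X \<omega>)\<^sup>2 * indicat_real {\<omega>. \<bar>X \<omega>\<bar> \<le> t} \<omega>"
    have dx: "d * x \<le> x" using that by simp
    have "?E x \<le> expectation (\<lambda>\<omega>. d * x * ?q (d * x) \<omega> + x * (?q x \<omega> - ?q (d * x) \<omega>))"
    proof (rule integral_mono)
      show "integrable M (\<lambda>\<omega>. d * x * ?q (d * x) \<omega> + x * (?q x \<omega> - ?q (d * x) \<omega>))"
        by (intro Bochner_Integration.integrable_add Bochner_Integration.integrable_diff integrable_mult_right integrable_trunc_second_moment X)
      fix \<omega>
      have *: "\<bar>X \<omega>\<bar> ^ 3 \<le> c * (X \<omega>)\<^sup>2" if "\<bar>X \<omega>\<bar> \<le> c" for c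
      proof -
        have "\<bar>X \<omega>\<bar> ^ 3 = \<bar>X \<omega>\<bar> * (X \<omega>)\<^sup>2" by (simp add: power3_eq_cube power2_eq_square)
        then show ?thesis using that by (simp add: mult_right_mono)
      qed
      show "\<bar>X \<omega>\<bar> ^ 3 * indicat_real {\<omega>. \<bar>X \<omega>\<bar> \<le> x} \<omega> \<le> d * x * ?q (d * x) \<omega> + x * (?q x \<omega> - ?q (d * x) \<omega>)"
        using *[of x] *[of "d * x"] dx by (auto simp: indicator_def)
    qed (rule integrable_trunc_power[OF X])
    also have "\<dots> = d * x * ?l (d * x) + x * (?l x - ?l (d * x))"
      unfolding trunc_second_moment_def using integrable_trunc_second_moment[OF X] by simp
    finally show ?thesis .
  qed
  fix e :: real assume e: "e > 0"
  define d where "d = min (1 / 2) (e / 2)"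
  have d: "0 < d" "d < 1" "d \<le> e / 2" using e by (auto simp: d_def)
  have pos: "\<forall>\<^sub>F x in at_top. ?l x > 0" and lim: "((\<lambda>x. ?l (d * x) / ?l x) \<longlongrightarrow> 1) at_top"
    using sv d by (auto simp: slowly_varying_def)
  have "\<forall>\<^sub>F x in at_top. ?l (d * x) / ?l x > 1 - e / 2" using e by (intro order_tendstoD(1)[OF lim]) auto
  then show "\<forall>\<^sub>F x in at_top. dist (?E x / (x * ?l x)) 0 < e"
    using pos eventually_gt_at_top[of 0]
  proof eventually_elim
    case (elim x)
    let ?r = "?l (d * x) / ?l x"
    have r1: "?r \<le> 1" using trunc_second_moment_mono[OF X, of "d * x" x] elim d by simp
    have "?E x / (x * ?l x) \<le> (d * x * ?l (d * x) + x * (?l x - ?l (d * x))) / (x * ?l x)"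
      using bound[of x d] elim d by (intro divide_right_mono) auto
    also have "\<dots> = d * ?r + (1 - ?r)" using elim by (simp add: field_simps)
    also have "\<dots> \<le> d * 1 + (1 - ?r)" using r1 d by (intro add_right_mono mult_left_mono) auto
    also have "\<dots> < e" using elim(1) d by simp
    finally have "?E x / (x * ?l x) < e" .
    moreover have "?E x \<ge> 0" by (intro integral_nonneg_AE AE_I2) simp
    ultimately show ?case using elim by (simp add: dist_real_def)
  qed
qed

text \<open>Second-order Taylor expansion where \<open>|X| \<le> x\<close>, first-order beyond; the
  cubic and the linear remainder are negligible by the third and tail moment ratios. With
  \<open>t = 1 / x\<close> the truncation level matches the frequency.\<close>

lemma chf_expansion:
  assumes X[measurable]: "X \<in> borel_measurable M" and sv: "slowly_varying (trunc_second_moment M X)"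
  defines "\<mu> \<equiv> expectation X"
  shows "((\<lambda>x. (chf X (1 / x) - 1 - \<i> * of_real (\<mu> / x)) * of_real (x\<^sup>2 / trunc_second_moment M X x)) \<longlongrightarrow> - (1 / 2)) at_top"
proof -
  let ?l = "trunc_second_moment M X" and ?E3 = "\<lambda>x. expectation (\<lambda>\<omega>. \<bar>X \<omega>\<bar> ^ 3 * indicat_real {\<omega>. \<bar>X \<omega>\<bar> \<le> x} \<omega>)"
    and ?E1 = "\<lambda>x. expectation (\<lambda>\<omega>. \<bar>X \<omega>\<bar> * indicat_real {\<omega>. x < \<bar>X \<omega>\<bar>} \<omega>)"
  have iX: "integrable M X" by (rule slowly_varying_integrable[OF X sv])
  have pos: "\<forall>\<^sub>F x in at_top. ?l x > 0" using sv by (simp add: slowly_varying_def)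
  have key: "norm (chf X (1 / x) - 1 - \<i> * of_real (\<mu> / x) + of_real (?l x / (2 * x\<^sup>2)))
      \<le> ?E3 x / (6 * x ^ 3) + 3 / x * ?E1 x" if x: "x > 0" for x
  proof -
    let ?q = "\<lambda>\<omega>. (X \<omega>)\<^sup>2 * indicat_real {\<omega>. \<bar>X \<omega>\<bar> \<le> x} \<omega>"
    let ?g = "\<lambda>\<omega>. iexp (1 / x * X \<omega>) - 1 - \<i> * of_real (X \<omega> / x) + of_real (?q \<omega> / (2 * x\<^sup>2))"
    note iq = integrable_trunc_second_moment[OF X, of x] and i3 = integrable_trunc_power[OF X, of 3 x]
    have i1: "integrable M (\<lambda>\<omega>. \<bar>X \<omega>\<bar> * indicat_real {\<omega>. x < \<bar>X \<omega>\<bar>} \<omega>)"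
      using iX by (rule Bochner_Integration.integrable_bound) (auto simp: indicator_def)
    note ie = integrable_iexp_real[OF X, of "1 / x"]
    have ig: "integrable M ?g"
      by (intro Bochner_Integration.integrable_add Bochner_Integration.integrable_diff ie integrable_const
          integrable_mult_right integrable_of_real integrable_divide iX iq)
    have eq: "chf X (1 / x) - 1 - \<i> * of_real (\<mu> / x) + of_real (?l x / (2 * x\<^sup>2)) = expectation ?g"
    proof -
      have a: "integrable M (\<lambda>\<omega>. \<i> * complex_of_real (X \<omega> / x))"
        by (intro integrable_mult_right integrable_of_real integrable_divide iX)
      have b: "integrable M (\<lambda>\<omega>. complex_of_real (?q \<omega> / (2 * x\<^sup>2)))"
        by (intro integrable_of_real integrable_divide iq)
      have "expectation ?g = expectation (\<lambda>\<omega>. iexp (1 / x * X \<omega>)) - expectation (\<lambda>\<omega>. 1) - expectation (\<lambda>\<omega>. \<i> * complex_of_real (X \<omega> / x))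
         + expectation (\<lambda>\<omega>. complex_of_real (?q \<omega> / (2 * x\<^sup>2)))"
        using ie a b
        by (subst Bochner_Integration.integral_add, simp, simp, subst Bochner_Integration.integral_diff, simp, simp,
            subst Bochner_Integration.integral_diff, simp_all)
      also have "expectation (\<lambda>\<omega>. \<i> * complex_of_real (X \<omega> / x)) = \<i> * of_real (\<mu> / x)"
        unfolding \<mu>_def by (simp only: integral_mult_right_zero integral_complex_of_real integral_divide_zero)
      also have "expectation (\<lambda>\<omega>. complex_of_real (?q \<omega> / (2 * x\<^sup>2))) = of_real (?l x / (2 * x\<^sup>2))"
        unfolding trunc_second_moment_def by (simp only: integral_complex_of_real integral_divide_zero)
      finally show ?thesis by (simp add: chf_def prob_space)
    qed
    have "norm (expectation ?g) \<le> expectation (\<lambda>\<omega>. \<bar>X \<omega>\<bar> ^ 3 * indicat_real {\<omega>. \<bar>X \<omega>\<bar> \<le> x} \<omega> / (6 * x ^ 3)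
        + 3 / x * (\<bar>X \<omega>\<bar> * indicat_real {\<omega>. x < \<bar>X \<omega>\<bar>} \<omega>))"
    proof (rule order.trans[OF integral_norm_bound integral_mono])
      show "integrable M (\<lambda>\<omega>. \<bar>X \<omega>\<bar> ^ 3 * indicat_real {\<omega>. \<bar>X \<omega>\<bar> \<le> x} \<omega> / (6 * x ^ 3) + 3 / x * (\<bar>X \<omega>\<bar> * indicat_real {\<omega>. x < \<bar>X \<omega>\<bar>} \<omega>))"
        by (intro Bochner_Integration.integrable_add integrable_divide integrable_mult_right i3 i1)
      show "norm (?g \<omega>) \<le> \<bar>X \<omega>\<bar> ^ 3 * indicat_real {\<omega>. \<bar>X \<omega>\<bar> \<le> x} \<omega> / (6 * x ^ 3) + 3 / x * (\<bar>X \<omega>\<bar> * indicat_real {\<omega>. x < \<bar>X \<omega>\<bar>} \<omega>)" for \<omega>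
      proof (cases "\<bar>X \<omega>\<bar> \<le> x")
        case True
        let ?A = "iexp (1 / x * X \<omega>) - (\<Sum>k\<le>2. (\<i> * complex_of_real (1 / x * X \<omega>)) ^ k / fact k)"
        have E: "?g \<omega> = ?A" unfolding iexp_taylor2 using True by (simp add: power_divide)
        have "norm ?A \<le> \<bar>1 / x * X \<omega>\<bar> ^ Suc 2 / fact (Suc 2)" by (rule iexp_approx1)
        moreover have "\<bar>1 / x * X \<omega>\<bar> ^ Suc 2 / fact (Suc 2) = \<bar>X \<omega>\<bar> ^ 3 / (6 * x ^ 3)"
          using x by (simp add: abs_mult power_divide fact_numeral eval_nat_numeral)
        moreover have "\<bar>X \<omega>\<bar> ^ 3 / (6 * x ^ 3) = \<bar>X \<omega>\<bar> ^ 3 * indicat_real {\<omega>. \<bar>X \<omega>\<bar> \<le> x} \<omega> / (6 * x ^ 3) + 3 / x * (\<bar>X \<omega>\<bar> * indicat_real {\<omega>. x < \<bar>X \<omega>\<bar>} \<omega>)"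
          using True by simp
        ultimately show ?thesis unfolding E by linarith
      next
        case False
        let ?A = "iexp (1 / x * X \<omega>) - (\<Sum>k\<le>1. (\<i> * complex_of_real (1 / x * X \<omega>)) ^ k / fact k)"
        have E: "?g \<omega> = ?A" using False by simp
        have "norm ?A \<le> 2 * \<bar>1 / x * X \<omega>\<bar> ^ 1 / fact 1" by (rule iexp_approx2)
        moreover have "2 * \<bar>1 / x * X \<omega>\<bar> ^ 1 / fact 1 \<le> 3 / x * \<bar>X \<omega>\<bar>"
          using x by (simp add: abs_mult divide_right_mono)
        moreover have "3 / x * \<bar>X \<omega>\<bar> = \<bar>X \<omega>\<bar> ^ 3 * indicat_real {\<omega>. \<bar>X \<omega>\<bar> \<le> x} \<omega> / (6 * x ^ 3) + 3 / x * (\<bar>X \<omega>\<bar> * indicat_real {\<omega>. x < \<bar>X \<omega>\<bar>} \<omega>)"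
          using False by simp
        ultimately show ?thesis unfolding E by linarith
      qed
    qed (use ig in simp)
    also have "\<dots> = ?E3 x / (6 * x ^ 3) + 3 / x * ?E1 x"
      using i3 i1 by simp
    finally show ?thesis unfolding eq .
  qed
  let ?D = "\<lambda>x. (chf X (1 / x) - 1 - \<i> * of_real (\<mu> / x) + of_real (?l x / (2 * x\<^sup>2))) * of_real (x\<^sup>2 / ?l x)"
  have "(?D \<longlongrightarrow> 0) at_top"
  proof (rule Lim_null_comparison)
    show "((\<lambda>x. 1 / 6 * (?E3 x / (x * ?l x)) + 3 * (x * ?E1 x / ?l x)) \<longlongrightarrow> 0) at_top"
      using tendsto_add[OF tendsto_mult[OF tendsto_const third_moment_ratio[OF X sv]] tendsto_mult[OF tendsto_const tail_moment_ratio[OF X sv]], of "1 / 6" 3]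
      by simp
    show "\<forall>\<^sub>F x in at_top. norm (?D x) \<le> 1 / 6 * (?E3 x / (x * ?l x)) + 3 * (x * ?E1 x / ?l x)"
      using pos eventually_gt_at_top[of 0]
    proof eventually_elim
      case (elim x)
      have "norm (?D x) \<le> (?E3 x / (6 * x ^ 3) + 3 / x * ?E1 x) * (x\<^sup>2 / ?l x)"
        unfolding norm_mult norm_of_real using key[OF elim(2)] elim by (intro mult_mono) auto
      also have "\<dots> = 1 / 6 * (?E3 x / (x * ?l x)) + 3 * (x * ?E1 x / ?l x)"
        using elim by (simp add: field_simps power2_eq_square power3_eq_cube)
      finally show ?case .
    qed
  qed
  from tendsto_diff[OF this tendsto_const[of "1 / 2"]]
  have "((\<lambda>x. ?D x - 1 / 2) \<longlongrightarrow> - (1 / 2)) at_top" by simp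
  then show ?thesis
  proof (rule Lim_transform_eventually)
    show "\<forall>\<^sub>F x in at_top. ?D x - 1 / 2 = (chf X (1 / x) - 1 - \<i> * of_real (\<mu> / x)) * of_real (x\<^sup>2 / ?l x)"
      using pos eventually_gt_at_top[of 0]
    proof eventually_elim
      case (elim x)
      have "complex_of_real (?l x / (2 * x\<^sup>2)) * of_real (x\<^sup>2 / ?l x) = of_real (?l x / (2 * x\<^sup>2) * (x\<^sup>2 / ?l x))"
        by (rule of_real_mult[symmetric])
      also have "?l x / (2 * x\<^sup>2) * (x\<^sup>2 / ?l x) = 1 / 2" using elim by simp
      finally have "complex_of_real (?l x / (2 * x\<^sup>2)) * of_real (x\<^sup>2 / ?l x) = 1 / 2" by simp
      then show ?case by (simp only: distrib_right) simp
    qed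
  qed
qed

text \<open>\<open>E (min 1 (X\<^sup>2 / x\<^sup>2))\<close> is a continuous substitute for the truncated second moment divided
  by \<open>x\<^sup>2\<close>, so that the
  normalising constants can be obtained from the intermediate value theorem.\<close>

lemma normalizing_sequence:
  assumes X[measurable]: "X \<in> borel_measurable M" and sv: "slowly_varying (trunc_second_moment M X)"
  obtains b where "\<And>n. b n > 0" "filterlim b at_top sequentially"
    "(\<lambda>n. real n * trunc_second_moment M X (b n) / (b n)\<^sup>2) \<longlonglongrightarrow> 1"
proof -
  let ?l = "trunc_second_moment M X" and ?P = "\<lambda>x. prob {\<omega>\<in>space M. \<bar>X \<omega>\<bar> > x}"
    and ?E1 = "\<lambda>x. expectation (\<lambda>\<omega>. \<bar>X \<omega>\<bar> * indicat_real {\<omega>. x < \<bar>X \<omega>\<bar>} \<omega>)"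
  have iX: "integrable M X" by (rule slowly_varying_integrable[OF X sv])
  have pos: "\<forall>\<^sub>F x in at_top. ?l x > 0" using sv by (simp add: slowly_varying_def)
  define q where "q x = expectation (\<lambda>\<omega>. min 1 ((X \<omega>)\<^sup>2 / x\<^sup>2))" for x
  have min1: "norm (min 1 ((X \<omega>)\<^sup>2 / x\<^sup>2)) \<le> 1" for \<omega> x
  proof -
    have "0 \<le> (X \<omega>)\<^sup>2 / x\<^sup>2" by simp
    then show ?thesis unfolding real_norm_def by linarith
  qed
  have iq: "integrable M (\<lambda>\<omega>. min 1 ((X \<omega>)\<^sup>2 / x\<^sup>2))" for x
    by (rule integrable_const_bound[where B = 1, OF AE_I2[OF min1]]) measurable
  have q_eq: "q x = ?l x / x\<^sup>2 + ?P x" if "x > 0" for x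
  proof -
    have A: "{\<omega>\<in>space M. \<bar>X \<omega>\<bar> > x} \<in> events" by measurable
    have "q x = expectation (\<lambda>\<omega>. (X \<omega>)\<^sup>2 * indicat_real {\<omega>. \<bar>X \<omega>\<bar> \<le> x} \<omega> / x\<^sup>2 + indicat_real {\<omega>\<in>space M. \<bar>X \<omega>\<bar> > x} \<omega>)"
      unfolding q_def
    proof (intro Bochner_Integration.integral_cong refl)
      fix \<omega> assume w: "\<omega> \<in> space M"
      have "(X \<omega>)\<^sup>2 / x\<^sup>2 \<le> 1 \<longleftrightarrow> \<bar>X \<omega>\<bar> \<le> x" using that abs_le_square_iff[of "X \<omega>" x] by (simp add: divide_le_eq)
      then show "min 1 ((X \<omega>)\<^sup>2 / x\<^sup>2) = (X \<omega>)\<^sup>2 * indicat_real {\<omega>. \<bar>X \<omega>\<bar> \<le> x} \<omega> / x\<^sup>2 + indicat_real {\<omega>\<in>space M. \<bar>X \<omega>\<bar> > x} \<omega>"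
        using w by (auto simp: indicator_def min_def)
    qed
    also have "\<dots> = ?l x / x\<^sup>2 + ?P x"
    proof (subst Bochner_Integration.integral_add)
      show "integrable M (\<lambda>\<omega>. (X \<omega>)\<^sup>2 * indicat_real {\<omega>. \<bar>X \<omega>\<bar> \<le> x} \<omega> / x\<^sup>2)"
        by (intro integrable_divide integrable_trunc_second_moment X)
      show "integrable M (indicat_real {\<omega>\<in>space M. \<bar>X \<omega>\<bar> > x})" using A by (simp add: less_top[symmetric])
    qed (use A in \<open>simp add: trunc_second_moment_def\<close>)
    finally show ?thesis .
  qed
  have anti: "q y \<le> q x" if "0 < x" "x \<le> y" for x y
    unfolding q_def using that by (intro integral_mono iq min.mono order_refl divide_left_mono power_mono) auto
  have q_pos: "q x > 0" if x: "x > 0" for x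
  proof -
    obtain y where y: "y \<ge> x" "?l y > 0"
      using eventually_happens[OF eventually_conj[OF pos eventually_ge_at_top[of x]]] by auto
    have "0 < ?l y / y\<^sup>2" using y x by simp
    also have "\<dots> \<le> q y" using q_eq[of y] y x by simp
    also have "\<dots> \<le> q x" by (rule anti[OF x y(1)])
    finally show ?thesis .
  qed
  have cont: "continuous_on {1..} q"
    unfolding continuous_on_sequentially
  proof (intro allI ballI impI)
    fix u :: "nat \<Rightarrow> real" and a assume a: "a \<in> {1..}" and u: "(\<forall>n. u n \<in> {1..}) \<and> u \<longlonglongrightarrow> a"
    show "(q \<circ> u) \<longlonglongrightarrow> q a"
      unfolding q_def comp_def
    proof (rule integral_dominated_convergence[where w = "\<lambda>_. 1"])
      show "AE \<omega> in M. (\<lambda>n. min 1 ((X \<omega>)\<^sup>2 / (u n)\<^sup>2)) \<longlonglongrightarrow> min 1 ((X \<omega>)\<^sup>2 / a\<^sup>2)"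
        using a u by (intro AE_I2 tendsto_intros) auto
      show "AE \<omega> in M. norm (min 1 ((X \<omega>)\<^sup>2 / (u n)\<^sup>2)) \<le> 1" for n by (rule AE_I2[OF min1])
      show "integrable M (\<lambda>_. 1 :: real)" by simp
    qed measurable
  qed
  have q0: "(q \<longlongrightarrow> 0) at_top"
  proof (rule Lim_null_comparison)
    have "((\<lambda>x. 1 / x) \<longlongrightarrow> 0) (at_top :: real filter)" by real_asymp
    from tendsto_mult[OF this tendsto_const[of "expectation (\<lambda>\<omega>. \<bar>X \<omega>\<bar>)"]]
    show "((\<lambda>x. 1 / x * expectation (\<lambda>\<omega>. \<bar>X \<omega>\<bar>)) \<longlongrightarrow> 0) at_top" by simp
    show "\<forall>\<^sub>F x in at_top. norm (q x) \<le> 1 / x * expectation (\<lambda>\<omega>. \<bar>X \<omega>\<bar>)"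
      using eventually_gt_at_top[of 0]
    proof eventually_elim
      case (elim x)
      have "q x \<le> expectation (\<lambda>\<omega>. 1 / x * \<bar>X \<omega>\<bar>)"
        unfolding q_def
      proof (intro integral_mono iq integrable_mult_right integrable_abs iX)
        fix \<omega>
        have "min 1 (y\<^sup>2) \<le> \<bar>y\<bar>" for y :: real
        proof (cases "\<bar>y\<bar> \<le> 1")
          case True
          then have "\<bar>y\<bar> * \<bar>y\<bar> \<le> 1 * \<bar>y\<bar>" by (intro mult_right_mono) auto
          then show ?thesis by (simp add: power2_eq_square min_le_iff_disj)
        qed (simp add: min_le_iff_disj)
        from this[of "X \<omega> / x"] show "min 1 ((X \<omega>)\<^sup>2 / x\<^sup>2) \<le> 1 / x * \<bar>X \<omega>\<bar>"
          using elim by (simp add: power_divide)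
      qed
      then show ?case using q_pos[OF elim] by simp
    qed
  qed
  \<comment> \<open>The intermediate value theorem is applied on \<open>{1..}\<close>, away from the
    singularity at 0, so \<open>q x = 1 / n\<close> is solved only for \<open>n \<ge> n0\<close>;
    below that, \<open>b n\<close> takes the placeholder 1.\<close>
  obtain n0 :: nat where n0: "n0 > 0" "1 / real n0 < q 1"
  proof -
    obtain n where "inverse (real (Suc n)) < q 1" using reals_Archimedean[OF q_pos[of 1]] by auto
    then show ?thesis by (intro that[of "Suc n"]) (auto simp: inverse_eq_divide)
  qed
  have ex: "\<exists>x\<ge>1. q x = 1 / real n" if n: "n \<ge> n0" for n
  proof -
    have "1 / real n \<le> 1 / real n0" using n n0 by (intro divide_left_mono) auto
    then have le: "1 / real n \<le> q 1" using n0 by simp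
    have "1 / real n > 0" using n n0 by simp
    then have "\<forall>\<^sub>F y in at_top. q y < 1 / real n" by (rule order_tendstoD(2)[OF q0])
    from eventually_happens[OF eventually_conj[OF this eventually_ge_at_top[of 1]]]
    obtain y where y: "y \<ge> 1" "q y < 1 / real n" by auto
    have "continuous_on {1..y} q" by (rule continuous_on_subset[OF cont]) auto
    from IVT2'[OF less_imp_le[OF y(2)] le y(1) this] show ?thesis by blast
  qed
  define b where "b n = (if n \<ge> n0 then (SOME x. x \<ge> 1 \<and> q x = 1 / real n) else 1)" for n
  have b: "b n \<ge> 1 \<and> q (b n) = 1 / real n" if "n \<ge> n0" for n
    using someI_ex[OF ex[OF that]] that by (auto simp: b_def)
  have b1: "b n \<ge> 1" for n using b[of n] by (cases "n \<ge> n0") (auto simp: b_def)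
  have b_top: "filterlim b at_top sequentially"
    unfolding filterlim_at_top
  proof
    fix K :: real
    let ?K = "max 1 K"
    have "(\<lambda>n. 1 / real n) \<longlonglongrightarrow> 0" by real_asymp
    then have "\<forall>\<^sub>F n in sequentially. 1 / real n < q ?K" using q_pos[of ?K] by (intro order_tendstoD(2)) auto
    then show "\<forall>\<^sub>F n in sequentially. K \<le> b n"
      using eventually_ge_at_top[of n0]
    proof eventually_elim
      case (elim n)
      show ?case
      proof (rule ccontr)
        assume "\<not> K \<le> b n"
        then have "q ?K \<le> q (b n)" using b1[of n] by (intro anti) auto
        then show False using b[OF elim(2)] elim(1) by simp
      qed
    qed
  qed
  \<comment> \<open>Since \<open>q\<close> is \<open>?l x / x^2\<close> plus the tail probability,
    \<open>q (b n) = 1 / n\<close> yields the claim once the tail term is negligible; a Markov bound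
    by the tail moment shows this.\<close>
  have "((\<lambda>x. x\<^sup>2 * ?P x / ?l x) \<longlongrightarrow> 0) at_top"
  proof (rule Lim_null_comparison[OF _ tail_moment_ratio[OF X sv]])
    show "\<forall>\<^sub>F x in at_top. norm (x\<^sup>2 * ?P x / ?l x) \<le> x * ?E1 x / ?l x"
      using pos eventually_gt_at_top[of 0]
    proof eventually_elim
      case (elim x)
      have A: "{\<omega>\<in>space M. \<bar>X \<omega>\<bar> > x} \<in> events" by measurable
      have i1: "integrable M (\<lambda>\<omega>. \<bar>X \<omega>\<bar> * indicat_real {\<omega>. x < \<bar>X \<omega>\<bar>} \<omega>)"
        using iX by (rule Bochner_Integration.integrable_bound) (auto simp: indicator_def)
      have "x * ?P x = expectation (\<lambda>\<omega>. x * indicat_real {\<omega>\<in>space M. \<bar>X \<omega>\<bar> > x} \<omega>)" using A by simp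
      also have "\<dots> \<le> ?E1 x"
      proof (intro integral_mono i1)
        show "integrable M (\<lambda>\<omega>. x * indicat_real {\<omega>\<in>space M. \<bar>X \<omega>\<bar> > x} \<omega>)"
          using A by (intro integrable_mult_right) (simp add: less_top[symmetric])
      qed (auto simp: indicator_def)
      finally have "x * (x * ?P x) \<le> x * ?E1 x" using elim by (intro mult_left_mono) auto
      then have "x * (x * ?P x) / ?l x \<le> x * ?E1 x / ?l x" using elim by (intro divide_right_mono) auto
      then show ?case using elim by (simp add: power2_eq_square mult.assoc)
    qed
  qed
  from filterlim_compose[OF this b_top] have t0: "(\<lambda>n. (b n)\<^sup>2 * ?P (b n) / ?l (b n)) \<longlonglongrightarrow> 0" .
  from tendsto_inverse[OF tendsto_add[OF tendsto_const[of 1] this]]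
  have "(\<lambda>n. inverse (1 + (b n)\<^sup>2 * ?P (b n) / ?l (b n))) \<longlonglongrightarrow> 1" by simp
  then have "(\<lambda>n. real n * ?l (b n) / (b n)\<^sup>2) \<longlonglongrightarrow> 1"
  proof (rule Lim_transform_eventually)
    show "\<forall>\<^sub>F n in sequentially. inverse (1 + (b n)\<^sup>2 * ?P (b n) / ?l (b n)) = real n * ?l (b n) / (b n)\<^sup>2"
      using eventually_compose_filterlim[OF pos b_top] eventually_ge_at_top[of "n0"]
    proof eventually_elim
      case (elim n)
      have n: "real n > 0" using elim n0 by simp
      have bp: "(b n)\<^sup>2 > 0" using b1[of n] by simp
      have "?l (b n) / (b n)\<^sup>2 + ?P (b n) = 1 / real n" using q_eq[of "b n"] b[OF elim(2)] b1[of n] by simp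
      note q = this
      have "?l (b n) + (b n)\<^sup>2 * ?P (b n) = (?l (b n) / (b n)\<^sup>2 + ?P (b n)) * (b n)\<^sup>2"
        unfolding distrib_right using bp by (simp add: mult.commute)
      then have eq: "real n * (?l (b n) + (b n)\<^sup>2 * ?P (b n)) = (b n)\<^sup>2" unfolding q using n by simp
      have "inverse (1 + (b n)\<^sup>2 * ?P (b n) / ?l (b n)) = inverse ((?l (b n) + (b n)\<^sup>2 * ?P (b n)) / ?l (b n))"
        using elim(1) by (simp add: add_divide_distrib)
      also have "\<dots> = real n * ?l (b n) / (real n * (?l (b n) + (b n)\<^sup>2 * ?P (b n)))" using n by simp
      finally show ?case unfolding eq .
    qed
  qed
  then show ?thesis using b1 b_top by (intro that[of b]) (auto intro: less_le_trans[OF zero_less_one])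
qed

text \<open>For the centred characteristic function \<psi>, \<open>n (\<psi> - 1)\<close> tends to
  \<open>- t^2 / 2\<close>, and \<open>|a^n - b^n| \<le> n |a - b|\<close> on the unit disc compares
  the power with \<open>(1 - t^2 / (2 n))^n\<close>. Positive \<open>t\<close> makes
  \<open>b n / t\<close> a truncation level tending to infinity.\<close>

lemma clt_chf_power_pos:
  assumes X[measurable]: "X \<in> borel_measurable M" and sv: "slowly_varying (trunc_second_moment M X)"
    and inf: "\<not> integrable M (\<lambda>\<omega>. (X \<omega>)\<^sup>2)"
    and b: "\<And>n. b n > 0" "filterlim b at_top sequentially"
      "(\<lambda>n. real n * trunc_second_moment M X (b n) / (b n)\<^sup>2) \<longlonglongrightarrow> 1"
    and t: "t > 0"
  shows "(\<lambda>n. (iexp (- (t / b n * expectation X)) * chf X (t / b n)) ^ n) \<longlonglongrightarrow> exp (- (t\<^sup>2 / 2))"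
proof -
  let ?l = "trunc_second_moment M X"
  define \<mu> where "\<mu> = expectation X"
  define x where "x n = b n / t" for n
  have x_top: "filterlim x at_top sequentially"
    unfolding x_def using b(2) t by (intro filterlim_at_top_mult_tendsto_pos[where f = "\<lambda>_. 1 / t" and c = "1 / t", simplified] tendsto_const) auto
  have pos: "\<forall>\<^sub>F x in at_top. ?l x > 0" using sv by (simp add: slowly_varying_def)
  have l_top: "filterlim ?l at_top at_top" by (rule trunc_second_moment_at_top[OF X inf])
  have r1: "(\<lambda>n. ?l (x n) / ?l (b n)) \<longlonglongrightarrow> 1"
  proof -
    have "\<forall>c>0. ((\<lambda>y. ?l (c * y) / ?l y) \<longlongrightarrow> 1) at_top" using sv by (simp add: slowly_varying_def)
    then have "((\<lambda>y. ?l (1 / t * y) / ?l y) \<longlongrightarrow> 1) at_top" using t by (elim allE[of _ "1 / t"] mp) simp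
    from filterlim_compose[OF this b(2)] show ?thesis by (simp add: x_def)
  qed
  have posb: "\<forall>\<^sub>F n in sequentially. ?l (b n) > 0" by (rule eventually_compose_filterlim[OF pos b(2)])
  have posx: "\<forall>\<^sub>F n in sequentially. ?l (x n) > 0" by (rule eventually_compose_filterlim[OF pos x_top])
  have nl: "(\<lambda>n. real n * ?l (x n) / (x n)\<^sup>2) \<longlonglongrightarrow> t\<^sup>2"
  proof (rule Lim_transform_eventually)
    show "(\<lambda>n. t\<^sup>2 * (real n * ?l (b n) / (b n)\<^sup>2) * (?l (x n) / ?l (b n))) \<longlonglongrightarrow> t\<^sup>2"
      using tendsto_mult[OF tendsto_mult[OF tendsto_const b(3)] r1, of "t\<^sup>2"] by simp
    show "\<forall>\<^sub>F n in sequentially. t\<^sup>2 * (real n * ?l (b n) / (b n)\<^sup>2) * (?l (x n) / ?l (b n)) = real n * ?l (x n) / (x n)\<^sup>2"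
      using posb
    proof eventually_elim
      case (elim n)
      then show ?case using b(1)[of n] t by (simp add: x_def power_divide field_simps)
    qed
  qed
  \<comment> \<open>Infinite variance enters here: \<open>n ?l(x n) / (x n)^2\<close> converges
    while \<open>?l (x n)\<close> diverges, so the quadratic term that the centring produces
    vanishes.\<close>
  have nx: "(\<lambda>n. real n / (x n)\<^sup>2) \<longlonglongrightarrow> 0"
  proof (rule Lim_transform_eventually)
    have "((\<lambda>n. inverse (?l (x n))) \<longlonglongrightarrow> 0)"
      by (rule filterlim_compose[OF tendsto_inverse_0_at_top filterlim_compose[OF l_top x_top]]) (rule filterlim_ident)
    from tendsto_mult[OF nl this] show "(\<lambda>n. real n * ?l (x n) / (x n)\<^sup>2 * inverse (?l (x n))) \<longlonglongrightarrow> 0" by simp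
    show "\<forall>\<^sub>F n in sequentially. real n * ?l (x n) / (x n)\<^sup>2 * inverse (?l (x n)) = real n / (x n)\<^sup>2"
      using posx by eventually_elim simp
  qed
  define th where "th n = chf X (1 / x n) - 1 - \<i> * of_real (\<mu> / x n)" for n
  have nth: "(\<lambda>n. of_nat n * th n) \<longlonglongrightarrow> - of_real (t\<^sup>2 / 2)"
  proof (rule Lim_transform_eventually)
    have "(\<lambda>n. th n * of_real ((x n)\<^sup>2 / ?l (x n))) \<longlonglongrightarrow> - (1 / 2)"
      unfolding th_def \<mu>_def using filterlim_compose[OF chf_expansion[OF X sv] x_top] by simp
    from tendsto_mult[OF this tendsto_of_real[OF nl]]
    show "(\<lambda>n. th n * of_real ((x n)\<^sup>2 / ?l (x n)) * of_real (real n * ?l (x n) / (x n)\<^sup>2)) \<longlonglongrightarrow> - of_real (t\<^sup>2 / 2)"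
      by simp
    show "\<forall>\<^sub>F n in sequentially. th n * of_real ((x n)\<^sup>2 / ?l (x n)) * of_real (real n * ?l (x n) / (x n)\<^sup>2) = of_nat n * th n"
      using posx
    proof eventually_elim
      case (elim n)
      have "x n \<noteq> 0" using b(1)[of n] t by (simp add: x_def)
      then have "(x n)\<^sup>2 / ?l (x n) * (real n * ?l (x n) / (x n)\<^sup>2) = real n" using elim by simp
      then have "complex_of_real ((x n)\<^sup>2 / ?l (x n)) * of_real (real n * ?l (x n) / (x n)\<^sup>2) = of_nat n"
        by (metis of_real_mult of_real_of_nat_eq)
      then show ?case by (simp only: mult.assoc) (simp add: mult.commute)
    qed
  qed
  define rr where "rr n = iexp (\<mu> / x n) - 1 - \<i> * of_real (\<mu> / x n)" for n
  have nrr: "(\<lambda>n. of_nat n * rr n) \<longlonglongrightarrow> 0"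
  proof (rule Lim_null_comparison)
    show "(\<lambda>n. \<mu>\<^sup>2 / 2 * (real n / (x n)\<^sup>2)) \<longlonglongrightarrow> 0" using tendsto_mult[OF tendsto_const[of "\<mu>\<^sup>2 / 2"] nx] by (simp only: mult_zero_right)
    show "\<forall>\<^sub>F n in sequentially. norm (of_nat n * rr n) \<le> \<mu>\<^sup>2 / 2 * (real n / (x n)\<^sup>2)"
    proof (intro always_eventually allI)
      fix n
      have sq: "\<bar>y\<bar> ^ Suc 1 / fact (Suc 1) = y\<^sup>2 / 2" for y :: real by (simp add: power2_eq_square)
      have "(\<Sum>k\<le>1. (\<i> * complex_of_real y) ^ k / fact k) = 1 + \<i> * of_real y" for y by simp
      then have "norm (rr n) \<le> (\<mu> / x n)\<^sup>2 / 2"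
        using iexp_approx1[of "\<mu> / x n" 1] unfolding sq rr_def diff_diff_eq by (simp only:)
      then have "real n * norm (rr n) \<le> real n * ((\<mu> / x n)\<^sup>2 / 2)" by (intro mult_left_mono) auto
      then show "norm (of_nat n * rr n) \<le> \<mu>\<^sup>2 / 2 * (real n / (x n)\<^sup>2)"
        by (simp add: norm_mult power_divide mult.commute)
    qed
  qed
  have ie: "(\<lambda>n. iexp (- (\<mu> / x n))) \<longlonglongrightarrow> 1"
  proof -
    have "(\<lambda>n. - (\<mu> / x n)) \<longlonglongrightarrow> 0"
      using tendsto_minus[OF tendsto_divide_0[OF tendsto_const filterlim_at_top_imp_at_infinity[OF x_top]]] by simp
    from isCont_tendsto_compose[OF isCont_iexp this] show ?thesis by simp
  qed
  define ps where "ps n = iexp (- (\<mu> / x n)) * chf X (1 / x n)" for n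
  have psn: "of_nat n * (ps n - 1) = iexp (- (\<mu> / x n)) * (of_nat n * th n - of_nat n * rr n)" for n
  proof -
    have "iexp (- (\<mu> / x n)) * iexp (\<mu> / x n) = 1" by (simp flip: exp_add)
    then have "ps n - 1 = iexp (- (\<mu> / x n)) * (th n - rr n)"
      by (simp add: ps_def th_def rr_def algebra_simps)
    then show ?thesis unfolding right_diff_distrib[symmetric] by (simp only: mult.left_commute)
  qed
  have nps: "(\<lambda>n. of_nat n * (ps n - 1)) \<longlonglongrightarrow> - of_real (t\<^sup>2 / 2)"
    unfolding psn using tendsto_mult[OF ie tendsto_diff[OF nth nrr]] by simp
  define w where "w n = 1 + (- (t\<^sup>2 / 2)) / real n" for n
  have "(\<lambda>n. ps n ^ n - of_real (w n ^ n)) \<longlonglongrightarrow> 0"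
  proof (rule Lim_null_comparison)
    have "(\<lambda>n. norm (of_nat n * (ps n - 1) + of_real (t\<^sup>2 / 2))) \<longlonglongrightarrow> norm (- complex_of_real (t\<^sup>2 / 2) + of_real (t\<^sup>2 / 2))"
      by (intro tendsto_intros nps)
    then show "(\<lambda>n. norm (of_nat n * (ps n - 1) + of_real (t\<^sup>2 / 2))) \<longlonglongrightarrow> 0" by simp
    have "(\<lambda>n. t\<^sup>2 / 2 / real n) \<longlonglongrightarrow> 0" by real_asymp
    then have "\<forall>\<^sub>F n in sequentially. t\<^sup>2 / 2 / real n < 1" by (rule order_tendstoD(2)) simp
    then show "\<forall>\<^sub>F n in sequentially. norm (ps n ^ n - of_real (w n ^ n)) \<le> norm (of_nat n * (ps n - 1) + of_real (t\<^sup>2 / 2))"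
      using eventually_gt_at_top[of 0]
    proof eventually_elim
      case (elim n)
      have n1: "norm (ps n) \<le> 1" unfolding ps_def norm_mult using norm_chf_le[of X "1 / x n"] by simp
      have n2: "norm (complex_of_real (w n)) \<le> 1"
        unfolding norm_of_real using elim by (simp add: w_def abs_le_iff)
      have "norm (ps n ^ n - of_real (w n) ^ n) \<le> real n * norm (ps n - of_real (w n))"
        by (rule norm_power_diff[OF n1 n2])
      also have "\<dots> = norm (of_nat n * (ps n - of_real (w n)))" by (simp add: norm_mult)
      also have "of_nat n * (ps n - of_real (w n)) = of_nat n * (ps n - 1) + of_real (t\<^sup>2 / 2)"
        using elim by (simp add: w_def algebra_simps)
      finally show ?case by simp
    qed
  qed
  moreover have "(\<lambda>n. complex_of_real (w n ^ n)) \<longlonglongrightarrow> of_real (exp (- (t\<^sup>2 / 2)))"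
    unfolding w_def by (intro tendsto_of_real tendsto_exp_limit_sequentially)
  ultimately have "(\<lambda>n. ps n ^ n) \<longlonglongrightarrow> of_real (exp (- (t\<^sup>2 / 2)))"
    using tendsto_add by fastforce
  moreover have "ps n = iexp (- (t / b n * expectation X)) * chf X (t / b n)" for n
    by (simp add: ps_def x_def \<mu>_def mult.commute)
  ultimately show ?thesis by simp
qed

end

section \<open>Convergence of powers implies slow variation\<close>

text \<open>Over an interval of length \<open>3 / e\<close> the mean value \<open>3 / 2\<close> of
  \<open>(1 - cos)^2\<close> contributes \<open>9 / (2 e)\<close>, and for \<open>|y| > e\<close>
  the oscillating parts of the primitive take away at most \<open>2 / e + 1 / (4 e)\<close>, which
  is half of it.\<close>

lemma nn_integral_one_minus_cos_squared:
  assumes e: "e > 0" and y: "\<bar>y\<bar> > e"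
  shows "ennreal (9 / (4 * e)) \<le> (\<integral>\<^sup>+t. ennreal ((1 - cos (t * y))\<^sup>2) * indicator {0..3 / e} t \<partial>lborel)"
proof -
  let ?A = "3 / e"
  let ?F = "\<lambda>t. 3 * t / 2 - 2 * sin (t * y) / y + sin (2 * (t * y)) / (4 * y)"
  have y0: "y \<noteq> 0" using e y by auto
  have "(\<integral>\<^sup>+t. ennreal ((1 - cos (t * y))\<^sup>2) * indicator {0..?A} t \<partial>lborel) = ennreal (?F ?A - ?F 0)"
  proof (rule nn_integral_FTC_Icc)
    show "DERIV ?F t :> (1 - cos (t * y))\<^sup>2" for t
      unfolding one_minus_cos_squared using y0
      by (auto intro!: derivative_eq_intros simp: field_simps)
  qed (use e in auto)
  moreover have "9 / (4 * e) \<le> ?F ?A - ?F 0"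
  proof -
    have ie: "1 / \<bar>y\<bar> \<le> 1 / e" using e y by (intro divide_left_mono) auto
    have "2 * sin (?A * y) / y \<le> \<bar>2 * sin (?A * y) / y\<bar>" by (rule abs_ge_self)
    also have "\<dots> = 2 * \<bar>sin (?A * y)\<bar> * (1 / \<bar>y\<bar>)" by (simp add: abs_mult)
    also have "\<dots> \<le> 2 * 1 * (1 / e)" using ie e by (intro mult_mono) auto
    finally have 1: "2 * sin (?A * y) / y \<le> 2 * (1 / e)" by simp
    have "- (sin (2 * (?A * y)) / (4 * y)) \<le> \<bar>sin (2 * (?A * y)) / (4 * y)\<bar>" by (rule abs_ge_minus_self)
    also have "\<dots> = \<bar>sin (2 * (?A * y))\<bar> / 4 * (1 / \<bar>y\<bar>)" by (simp add: abs_mult)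
    also have "\<dots> \<le> 1 / 4 * (1 / e)" using ie e by (intro mult_mono) auto
    finally have 2: "- (sin (2 * (?A * y)) / (4 * y)) \<le> 1 / 4 * (1 / e)" .
    have "9 / (4 * e) = 3 * ?A / 2 - 2 * (1 / e) - 1 / 4 * (1 / e)" using e by (simp add: field_simps)
    then show ?thesis using 1 2 by simp
  qed
  ultimately show ?thesis by (simp only: ennreal_leI)
qed

context prob_space
begin

text \<open>The preceding bound, integrated over the symmetrised variable with Fubini and the cosine
  identity. The combination on the right is 0 where \<open>1 - |\<phi>|^2\<close> is exactly
  quadratic, since \<open>4 t^2 - (2 t)^2 = 0\<close>, so near-quadratic behaviour forces small
  tails.\<close>

lemma prob_symmetrized_le:
  assumes X[measurable]: "X \<in> borel_measurable M" and e: "e > 0" and c: "c > 0"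
  shows "ennreal (9 / (4 * e) * measure (M \<Otimes>\<^sub>M M) {z\<in>space (M \<Otimes>\<^sub>M M). \<bar>symmetrized X z\<bar> / c > e})
    \<le> (\<integral>\<^sup>+t. ennreal ((4 * (1 - (norm (chf X (t / c)))\<^sup>2) - (1 - (norm (chf X (2 * t / c)))\<^sup>2)) / 2) * indicator {0..3 / e} t \<partial>lborel)"
proof -
  interpret P: prob_space "M \<Otimes>\<^sub>M M" by (rule prob_space_pair)
  interpret PL: pair_sigma_finite "M \<Otimes>\<^sub>M M" lborel ..
  note Z[measurable] = measurable_symmetrized[OF X]
  let ?S = "{z\<in>space (M \<Otimes>\<^sub>M M). \<bar>symmetrized X z\<bar> / c > e}"
  have S: "?S \<in> sets (M \<Otimes>\<^sub>M M)" by measurable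
  have ic: "integrable (M \<Otimes>\<^sub>M M) (\<lambda>z. 1 - cos (s * symmetrized X z))" for s
    by (intro P.integrable_const_bound[where B = 2] AE_I2) (auto simp: abs_le_iff intro: order.trans[OF _ cos_ge_minus_one])
  have inner: "(\<integral>\<^sup>+z. ennreal ((1 - cos (t * (symmetrized X z / c)))\<^sup>2) \<partial>(M \<Otimes>\<^sub>M M))
    = ennreal ((4 * (1 - (norm (chf X (t / c)))\<^sup>2) - (1 - (norm (chf X (2 * t / c)))\<^sup>2)) / 2)" for t
  proof -
    have eq: "(1 - cos (t * (symmetrized X z / c)))\<^sup>2 = (4 * (1 - cos (t / c * symmetrized X z)) - (1 - cos (2 * t / c * symmetrized X z))) / 2" for z
      unfolding one_minus_cos_squared by (simp add: mult_ac)
    have i: "integrable (M \<Otimes>\<^sub>M M) (\<lambda>z. (1 - cos (t * (symmetrized X z / c)))\<^sup>2)"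
      unfolding eq by (intro integrable_divide Bochner_Integration.integrable_diff integrable_mult_right ic)
    have J: "(\<integral>z. (1 - cos (t * (symmetrized X z / c)))\<^sup>2 \<partial>(M \<Otimes>\<^sub>M M))
      = (4 * (1 - (norm (chf X (t / c)))\<^sup>2) - (1 - (norm (chf X (2 * t / c)))\<^sup>2)) / 2"
      unfolding eq one_minus_chf_squared[OF X, symmetric]
      by (simp only: integral_divide_zero Bochner_Integration.integral_diff[OF integrable_mult_right[OF ic] ic] integral_mult_right_zero)
    have "(\<integral>\<^sup>+z. ennreal ((1 - cos (t * (symmetrized X z / c)))\<^sup>2) \<partial>(M \<Otimes>\<^sub>M M))
      = ennreal (\<integral>z. (1 - cos (t * (symmetrized X z / c)))\<^sup>2 \<partial>(M \<Otimes>\<^sub>M M))"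
      by (rule nn_integral_eq_integral[OF i]) simp
    then show ?thesis unfolding J .
  qed
  have "ennreal (9 / (4 * e) * measure (M \<Otimes>\<^sub>M M) ?S) = (\<integral>\<^sup>+z. ennreal (9 / (4 * e)) * indicator ?S z \<partial>(M \<Otimes>\<^sub>M M))"
    unfolding nn_integral_cmult_indicator[OF S] P.emeasure_eq_measure using e by (intro ennreal_mult) auto
  also have "\<dots> \<le> (\<integral>\<^sup>+z. (\<integral>\<^sup>+t. ennreal ((1 - cos (t * (symmetrized X z / c)))\<^sup>2) * indicator {0..3 / e} t \<partial>lborel) \<partial>(M \<Otimes>\<^sub>M M))"
  proof (rule nn_integral_mono)
    fix z assume "z \<in> space (M \<Otimes>\<^sub>M M)"
    show "ennreal (9 / (4 * e)) * indicator ?S z \<le> (\<integral>\<^sup>+t. ennreal ((1 - cos (t * (symmetrized X z / c)))\<^sup>2) * indicator {0..3 / e} t \<partial>lborel)"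
      using nn_integral_one_minus_cos_squared[OF e, of "symmetrized X z / c"] c
      by (cases "z \<in> ?S") (auto simp: abs_divide)
  qed
  also have "\<dots> = (\<integral>\<^sup>+t. (\<integral>\<^sup>+z. ennreal ((1 - cos (t * (symmetrized X z / c)))\<^sup>2) * indicator {0..3 / e} t \<partial>(M \<Otimes>\<^sub>M M)) \<partial>lborel)"
    by (rule PL.Fubini'[symmetric]) measurable
  also have "\<dots> = (\<integral>\<^sup>+t. ennreal ((4 * (1 - (norm (chf X (t / c)))\<^sup>2) - (1 - (norm (chf X (2 * t / c)))\<^sup>2)) / 2) * indicator {0..3 / e} t \<partial>lborel)"
    by (intro nn_integral_cong, subst nn_integral_multc) (simp_all only: inner, measurable)
  finally show ?thesis .
qed

text \<open>Weak symmetrisation: an independent copy has modulus at most \<open>x\<close> with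
  probability at least one half, and when it does, \<open>|X| > 2 x\<close> makes the difference
  exceed \<open>x\<close>.\<close>

lemma prob_tail_le_symmetrized:
  assumes X[measurable]: "X \<in> borel_measurable M" and half: "prob {\<omega>\<in>space M. \<bar>X \<omega>\<bar> > x} \<le> 1 / 2"
  shows "prob {\<omega>\<in>space M. \<bar>X \<omega>\<bar> > 2 * x} \<le> 2 * measure (M \<Otimes>\<^sub>M M) {z\<in>space (M \<Otimes>\<^sub>M M). \<bar>symmetrized X z\<bar> > x}"
proof -
  interpret P: prob_space "M \<Otimes>\<^sub>M M" by (rule prob_space_pair)
  note Z[measurable] = measurable_symmetrized[OF X]
  let ?A = "{\<omega>\<in>space M. \<bar>X \<omega>\<bar> > 2 * x}" and ?B = "{\<omega>\<in>space M. \<bar>X \<omega>\<bar> \<le> x}"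
  have A: "?A \<in> events" and B: "?B \<in> events" by measurable
  have "{\<omega>\<in>space M. \<bar>X \<omega>\<bar> > x} = space M - ?B" by auto
  then have "prob ?B \<ge> 1 / 2" using half prob_compl[OF B] by simp
  then have "prob ?A * (1 / 2) \<le> prob ?A * prob ?B" by (intro mult_left_mono) auto
  also have "\<dots> = measure (M \<Otimes>\<^sub>M M) (?A \<times> ?B)"
    using emeasure_pair_measure_Times[OF A B] by (simp add: P.emeasure_eq_measure emeasure_eq_measure ennreal_mult[symmetric])
  also have "\<dots> \<le> measure (M \<Otimes>\<^sub>M M) {z\<in>space (M \<Otimes>\<^sub>M M). \<bar>symmetrized X z\<bar> > x}"
    by (intro P.finite_measure_mono) (auto simp: symmetrized_def space_pair_measure)
  finally show ?thesis by simp
qed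

text \<open>\<open>1 - cos y\<close> is at most 2 and at most \<open>y^2 / 2\<close>, and
  \<open>(a - b)^2 \<le> 2 (a^2 + b^2)\<close> separates the two copies. Read backwards, a lower
  bound for \<open>1 - |\<phi>|^2\<close> and small tails bound the truncated moment from
  below.\<close>

lemma one_minus_chf_squared_le:
  assumes X[measurable]: "X \<in> borel_measurable M" and x: "x > 0"
  shows "1 - (norm (chf X (1 / x)))\<^sup>2 \<le> 2 * (trunc_second_moment M X x / x\<^sup>2 + 2 * prob {\<omega>\<in>space M. \<bar>X \<omega>\<bar> > x})"
proof -
  interpret P: prob_space "M \<Otimes>\<^sub>M M" by (rule prob_space_pair)
  note Z[measurable] = measurable_symmetrized[OF X]
  let ?A = "{\<omega>\<in>space M. \<bar>X \<omega>\<bar> > x}"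
  have A: "?A \<in> events" by measurable
  define g where "g \<omega> = (X \<omega>)\<^sup>2 * indicat_real {\<omega>. \<bar>X \<omega>\<bar> \<le> x} \<omega> / x\<^sup>2 + 2 * indicat_real ?A \<omega>" for \<omega>
  have i1: "integrable M (\<lambda>\<omega>. (X \<omega>)\<^sup>2 * indicat_real {\<omega>. \<bar>X \<omega>\<bar> \<le> x} \<omega> / x\<^sup>2)"
    by (intro integrable_divide integrable_trunc_second_moment X)
  have i2: "integrable M (\<lambda>\<omega>. 2 * indicat_real ?A \<omega>)" using A by (intro integrable_mult_right) (simp add: less_top[symmetric])
  have ig: "integrable M g" unfolding g_def[abs_def] by (intro Bochner_Integration.integrable_add i1 i2)
  have Eg: "expectation g = trunc_second_moment M X x / x\<^sup>2 + 2 * prob ?A"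
    unfolding g_def[abs_def] using i1 i2 A by (simp add: trunc_second_moment_def)
  have g: "min 2 ((X \<omega>)\<^sup>2 / x\<^sup>2) \<le> g \<omega>" "0 \<le> g \<omega>" if "\<omega> \<in> space M" for \<omega>
    unfolding g_def using that by (auto simp: indicator_def)
  have "1 - (norm (chf X (1 / x)))\<^sup>2 = (\<integral>z. 1 - cos (1 / x * symmetrized X z) \<partial>(M \<Otimes>\<^sub>M M))"
    by (rule one_minus_chf_squared[OF X, symmetric])
  also have "\<dots> \<le> (\<integral>z. g (fst z) + g (snd z) \<partial>(M \<Otimes>\<^sub>M M))"
  proof (rule integral_mono)
    show "integrable (M \<Otimes>\<^sub>M M) (\<lambda>z. 1 - cos (1 / x * symmetrized X z))"
      by (intro P.integrable_const_bound[where B = 2] AE_I2) (auto simp: abs_le_iff intro: order.trans[OF _ cos_ge_minus_one])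
    show "integrable (M \<Otimes>\<^sub>M M) (\<lambda>z. g (fst z) + g (snd z))"
      by (intro Bochner_Integration.integrable_add integral_pair_fst(1) integral_pair_snd(1) ig)
    fix z assume "z \<in> space (M \<Otimes>\<^sub>M M)"
    then have z: "fst z \<in> space M" "snd z \<in> space M" by (auto simp: space_pair_measure)
    let ?a = "X (fst z)" and ?b = "X (snd z)"
    have "(?a - ?b)\<^sup>2 \<le> 2 * (?a\<^sup>2 + ?b\<^sup>2)" using zero_le_power2[of "?a + ?b"] by (simp add: power2_sum power2_diff)
    then have "(?a - ?b)\<^sup>2 / x\<^sup>2 / 2 \<le> 2 * (?a\<^sup>2 + ?b\<^sup>2) / x\<^sup>2 / 2" by (intro divide_right_mono) auto
    then have "(1 / x * symmetrized X z)\<^sup>2 / 2 \<le> ?a\<^sup>2 / x\<^sup>2 + ?b\<^sup>2 / x\<^sup>2"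
      by (simp add: symmetrized_def power_divide add_divide_distrib)
    then have 1: "1 - cos (1 / x * symmetrized X z) \<le> ?a\<^sup>2 / x\<^sup>2 + ?b\<^sup>2 / x\<^sup>2"
      using one_minus_cos_le[of "1 / x * symmetrized X z"] by linarith
    have 2: "1 - cos (1 / x * symmetrized X z) \<le> 2" using cos_ge_minus_one[of "1 / x * symmetrized X z"] by linarith
    have "0 \<le> ?a\<^sup>2 / x\<^sup>2" "0 \<le> ?b\<^sup>2 / x\<^sup>2" by simp_all
    then have "1 - cos (1 / x * symmetrized X z) \<le> min 2 (?a\<^sup>2 / x\<^sup>2) + min 2 (?b\<^sup>2 / x\<^sup>2)"
      using 1 2 by linarith
    then show "1 - cos (1 / x * symmetrized X z) \<le> g (fst z) + g (snd z)" using g(1)[OF z(1)] g(1)[OF z(2)] by linarith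
  qed
  also have "\<dots> = 2 * expectation g"
    using integral_pair_fst[OF ig] integral_pair_snd[OF ig] by simp
  finally show ?thesis unfolding Eg .
qed

end

section \<open>Powers with an exponential limit\<close>

lemma power_limit_bounds:
  fixes x :: real
  assumes "0 < x" "x \<le> 1"
  shows "real n * (1 - x) \<le> - ln (x ^ n)" "x * - ln (x ^ n) \<le> real n * (1 - x)"
proof -
  have "ln x \<le> x - 1" using assms by (intro ln_le_minus_one) auto
  then have "real n * (1 - x) \<le> real n * (- ln x)" by (intro mult_left_mono) auto
  then show "real n * (1 - x) \<le> - ln (x ^ n)" using assms by (simp add: ln_realpow)
  have "ln (1 / x) \<le> 1 / x - 1" using assms by (intro ln_le_minus_one) auto
  then have "- ln x \<le> 1 / x - 1" using assms by (simp add: ln_div)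
  then have "x * - ln x \<le> x * (1 / x - 1)" using assms by (intro mult_left_mono) auto
  also have "\<dots> = 1 - x" using assms by (simp add: right_diff_distrib)
  finally have "real n * (x * - ln x) \<le> real n * (1 - x)" by (intro mult_left_mono) auto
  then show "x * - ln (x ^ n) \<le> real n * (1 - x)" using assms by (simp add: ln_realpow mult_ac)
qed

text \<open>\<open>ln y \<le> y - 1\<close> at \<open>x\<close> and at \<open>1 / x\<close> squeezes
  \<open>n (1 - x)\<close> between \<open>- x ln (x^n)\<close> and
  \<open>- ln (x^n)\<close>.\<close>

lemma power_limit_log:
  fixes x :: "nat \<Rightarrow> real"
  assumes x: "\<And>n. 0 \<le> x n" "\<And>n. x n \<le> 1" and lim: "(\<lambda>n. x n ^ n) \<longlonglongrightarrow> exp (- c)"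
  shows "(\<lambda>n. real n * (1 - x n)) \<longlonglongrightarrow> c"
proof -
  have pos: "\<forall>\<^sub>F n in sequentially. 0 < x n"
    using order_tendstoD(1)[OF lim exp_gt_zero] eventually_gt_at_top[of 0]
  proof eventually_elim
    case (elim n)
    then show ?case using x(1)[of n] by (cases "x n = 0") (auto simp: power_0_left)
  qed
  have "(\<lambda>n. - ln (x n ^ n)) \<longlonglongrightarrow> - ln (exp (- c))" by (intro tendsto_intros lim) simp
  then have L: "(\<lambda>n. - ln (x n ^ n)) \<longlonglongrightarrow> c" by simp
  have "(\<lambda>n. 1 - x n) \<longlonglongrightarrow> 0"
  proof (rule tendsto_sandwich[OF _ _ tendsto_const])
    show "\<forall>\<^sub>F n in sequentially. 0 \<le> 1 - x n" using x by simp
    show "\<forall>\<^sub>F n in sequentially. 1 - x n \<le> - ln (x n ^ n) * (1 / real n)"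
      using pos eventually_gt_at_top[of 0]
    proof eventually_elim
      case (elim n)
      then show ?case using power_limit_bounds(1)[OF elim(1) x(2), of n] by (simp add: field_simps)
    qed
    have "(\<lambda>n. 1 / real n) \<longlonglongrightarrow> 0" by real_asymp
    from tendsto_mult[OF L this] show "(\<lambda>n. - ln (x n ^ n) * (1 / real n)) \<longlonglongrightarrow> 0" by simp
  qed
  from tendsto_diff[OF tendsto_const[of 1] this] have x1: "x \<longlonglongrightarrow> 1" by simp
  show ?thesis
  proof (rule tendsto_sandwich[OF _ _ _ L])
    show "\<forall>\<^sub>F n in sequentially. x n * - ln (x n ^ n) \<le> real n * (1 - x n)"
      using pos by eventually_elim (rule power_limit_bounds(2)[OF _ x(2)])
    show "\<forall>\<^sub>F n in sequentially. real n * (1 - x n) \<le> - ln (x n ^ n)"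
      using pos by eventually_elim (rule power_limit_bounds(1)[OF _ x(2)])
    show "(\<lambda>n. x n * - ln (x n ^ n)) \<longlonglongrightarrow> c" using tendsto_mult[OF x1 L] by simp
  qed
qed

context prob_space
begin

lemma borel_measurable_chf:
  assumes [measurable]: "X \<in> borel_measurable M"
  shows "chf X \<in> borel_measurable borel"
proof -
  interpret D: real_distribution "distr M borel X" by (rule real_distribution_distr) fact
  have "chf X = char (distr M borel X)"
    by (auto simp: chf_def char_def integral_distr)
  then show ?thesis using D.char_measurable by simp
qed

text \<open>\<open>G n t = n (1 - |\<phi>(t / C n)|^2)\<close> tends to \<open>t^2\<close>. The
  combination \<open>4 G n t - G n (2 t)\<close> then tends to 0, hence so does
  \<open>n P(|X| > C n)\<close>, while \<open>G n 1\<close> keeps \<open>n l(C n) / (C n)^2\<close>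
  away from 0. So the ratio in \<open>slowly_varying_if_tail\<close> vanishes along
  \<open>C n\<close>, and \<open>C (Suc n) \<le> 2 * C n\<close> carries this to all real arguments.
  Uniformity in \<open>t\<close> serves dominated convergence and evaluation at points depending on
  \<open>n\<close>.\<close>

lemma slowly_varying_if_clt:
  assumes X[measurable]: "X \<in> borel_measurable M" and inf: "\<not> integrable M (\<lambda>\<omega>. (X \<omega>)\<^sup>2)"
    and C: "\<And>n. C n > 0" "filterlim C at_top sequentially"
    and unif: "\<And>A d. d > 0 \<Longrightarrow> \<forall>\<^sub>F n in sequentially. \<forall>t\<in>{-A..A}. \<bar>norm (chf X (t / C n)) ^ n - exp (- (t\<^sup>2 / 2))\<bar> < d"
  shows "slowly_varying (trunc_second_moment M X)"
proof -
  let ?l = "trunc_second_moment M X" and ?P = "\<lambda>x. prob {\<omega>\<in>space M. \<bar>X \<omega>\<bar> > x}"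
  define G where "G n t = real n * (1 - (norm (chf X (t / C n)))\<^sup>2)" for n t
  have N01: "0 \<le> (norm (chf X s))\<^sup>2" "(norm (chf X s))\<^sup>2 \<le> 1" for s
    using norm_chf_le[of X s] by (simp_all add: power_le_one)
  have G0: "G n t \<ge> 0" for n t unfolding G_def using N01 by simp
  have G_le: "G n t \<le> - ln (d\<^sup>2)" if "d > 0" "d \<le> norm (chf X (t / C n)) ^ n" "n > 0" for n t d
  proof -
    let ?x = "(norm (chf X (t / C n)))\<^sup>2"
    have "norm (chf X (t / C n)) \<noteq> 0" using that by (auto simp: power_0_left)
    then have x: "0 < ?x" by simp
    have "d\<^sup>2 \<le> (norm (chf X (t / C n)) ^ n)\<^sup>2" using that by (intro power_mono) auto
    also have "\<dots> = ?x ^ n" by (simp add: power_mult[symmetric] mult.commute)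
    finally have "- ln (?x ^ n) \<le> - ln (d\<^sup>2)" using that x by simp
    then show ?thesis using power_limit_bounds(1)[OF x N01(2), of n] unfolding G_def by linarith
  qed
  have G_bound: "\<forall>\<^sub>F n in sequentially. \<forall>t\<in>{-A..A}. G n t \<le> A\<^sup>2 + ln 4" for A
    using unif[of "exp (- (A\<^sup>2 / 2)) / 2" A, simplified] eventually_gt_at_top[of 0]
  proof eventually_elim
    case (elim n)
    show ?case
    proof
      fix t assume t: "t \<in> {-A..A}"
      let ?d = "exp (- (A\<^sup>2 / 2)) / 2"
      have "t\<^sup>2 \<le> A\<^sup>2" using t by (intro abs_le_square_iff[THEN iffD1]) auto
      then have "exp (- (A\<^sup>2 / 2)) \<le> exp (- (t\<^sup>2 / 2))" by simp
      moreover have "\<bar>norm (chf X (t / C n)) ^ n - exp (- (t\<^sup>2 / 2))\<bar> < ?d" using elim(1) t by auto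
      ultimately have "?d \<le> norm (chf X (t / C n)) ^ n" by linarith
      then have "G n t \<le> - ln (?d\<^sup>2)" using elim(2) by (intro G_le) auto
      also have "- ln (?d\<^sup>2) = A\<^sup>2 + ln 4"
      proof -
        have d2: "?d\<^sup>2 = exp (- A\<^sup>2) / 4" by (simp add: power_divide exp_double[symmetric])
        show ?thesis unfolding d2 by (simp add: ln_div)
      qed
      finally show "G n t \<le> A\<^sup>2 + ln 4" .
    qed
  qed
  have G_lim: "(\<lambda>n. G n t) \<longlonglongrightarrow> t\<^sup>2" for t
    unfolding G_def
  proof (rule power_limit_log[OF N01])
    have "(\<lambda>n. norm (chf X (t / C n)) ^ n) \<longlonglongrightarrow> exp (- (t\<^sup>2 / 2))"
    proof (rule tendstoI)
      fix d :: real assume "d > 0"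
      have tt: "t \<in> {- \<bar>t\<bar>..\<bar>t\<bar>}" by (simp add: abs_if)
      from unif[OF \<open>d > 0\<close>, of "\<bar>t\<bar>"] show "\<forall>\<^sub>F n in sequentially. dist (norm (chf X (t / C n)) ^ n) (exp (- (t\<^sup>2 / 2))) < d"
        by eventually_elim (use tt in \<open>auto simp: dist_real_def\<close>)
    qed
    from tendsto_power[OF this, of 2]
    show "(\<lambda>n. (norm (chf X (t / C n)))\<^sup>2 ^ n) \<longlonglongrightarrow> exp (- (t\<^sup>2))"
      by (simp add: power_mult[symmetric] mult.commute exp_double[symmetric])
  qed
  let ?Q = "\<lambda>n. measure (M \<Otimes>\<^sub>M M) {z\<in>space (M \<Otimes>\<^sub>M M). \<bar>symmetrized X z\<bar> / C n > 1 / 2}"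
  have nQ: "(\<lambda>n. real n * ?Q n) \<longlonglongrightarrow> 0"
  proof -
    note [measurable] = borel_measurable_chf[OF X]
    \<comment> \<open>The level \<open>1 / 2\<close> gives the interval length
      \<open>3 / (1 / 2) = 6\<close>; the argument \<open>2 * t\<close> then runs up to 12, the
      range put into \<open>G_bound\<close>.\<close>
    define f where "f n t = \<bar>(4 * G n t - G n (2 * t)) / 2\<bar> * indicator {0..6} t" for n t
    have fm[measurable]: "f n \<in> borel_measurable borel" for n unfolding f_def[abs_def] G_def by measurable
    have fb: "\<forall>\<^sub>F n in sequentially. \<forall>t. \<bar>f n t\<bar> \<le> 3 * (12\<^sup>2 + ln 4) * indicator {0..6} t"
      using G_bound[of 12]
    proof eventually_elim
      case (elim n)
      show ?case
      proof
        fix t :: real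
        have "\<bar>(4 * G n t - G n (2 * t)) / 2\<bar> \<le> 3 * (12\<^sup>2 + ln 4)" if "t \<in> {0..6}"
        proof -
          have "G n t \<le> 12\<^sup>2 + ln 4" "G n (2 * t) \<le> 12\<^sup>2 + ln 4" using elim that by auto
          moreover have "\<bar>(4 * g - h) / 2\<bar> \<le> 3 * K" if "0 \<le> g" "g \<le> K" "0 \<le> h" "h \<le> K" for g h K :: real
            using that by (auto simp: abs_le_iff)
          ultimately show ?thesis using G0 by blast
        qed
        then show "\<bar>f n t\<bar> \<le> 3 * (12\<^sup>2 + ln 4) * indicator {0..6} t" by (auto simp: f_def indicator_def)
      qed
    qed
    \<comment> \<open>The majorant is valid only from some index on, so dominated convergence is
      applied to the shifted sequence.\<close>
    obtain n1 where n1: "\<And>n t. n \<ge> n1 \<Longrightarrow> \<bar>f n t\<bar> \<le> 3 * (12\<^sup>2 + ln 4) * indicator {0..6} t"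
      using fb by (auto simp: eventually_sequentially)
    have dom: "integrable lborel (\<lambda>t::real. 3 * (12\<^sup>2 + ln 4) * indicator {0..6} t :: real)"
      by (intro integrable_mult_right integrable_real_indicator) auto
    have fi: "integrable lborel (f (n + n1))" for n
      by (rule Bochner_Integration.integrable_bound[OF dom]) (use n1[of "n + n1"] in \<open>auto intro: order.trans[OF _ abs_ge_self]\<close>)
    have f_lim: "(\<lambda>n. f n t) \<longlonglongrightarrow> 0" for t
    proof -
      have "(\<lambda>n. \<bar>(4 * G n t - G n (2 * t)) / 2\<bar> * indicator {0..6} t) \<longlonglongrightarrow> \<bar>(4 * t\<^sup>2 - (2 * t)\<^sup>2) / 2\<bar> * indicator {0..6} t"
        by (intro tendsto_intros G_lim) simp
      then show ?thesis by (simp add: f_def power_mult_distrib)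
    qed
    have "(\<lambda>n. \<integral>t. f (n + n1) t \<partial>lborel) \<longlonglongrightarrow> (\<integral>t. 0 \<partial>(lborel :: real measure))"
    proof (rule integral_dominated_convergence[OF _ _ dom])
      show "AE t in lborel. (\<lambda>n. f (n + n1) t) \<longlonglongrightarrow> 0" by (intro AE_I2 LIMSEQ_ignore_initial_segment f_lim)
      show "AE t in lborel. norm (f (n + n1) t) \<le> 3 * (12\<^sup>2 + ln 4) * indicator {0..6} t" for n
        by (intro AE_I2) (use n1[of "n + n1"] in simp)
    qed auto
    then have I0: "(\<lambda>n. \<integral>t. f (n + n1) t \<partial>lborel) \<longlonglongrightarrow> 0" by simp
    have Qle: "real (n + n1) * ?Q (n + n1) \<le> (\<integral>t. f (n + n1) t \<partial>lborel)" for n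
    proof -
      let ?n = "n + n1"
      have "ennreal (real ?n) * ennreal (9 / (4 * (1 / 2)) * ?Q ?n) \<le> ennreal (real ?n) * (\<integral>\<^sup>+t. ennreal ((4 * (1 - (norm (chf X (t / C ?n)))\<^sup>2) - (1 - (norm (chf X (2 * t / C ?n)))\<^sup>2)) / 2) * indicator {0..3 / (1 / 2)} t \<partial>lborel)"
        using prob_symmetrized_le[OF X _ C(1), of "1 / 2" ?n] by (intro mult_left_mono) auto
      also have "\<dots> = (\<integral>\<^sup>+t. ennreal (real ?n) * (ennreal ((4 * (1 - (norm (chf X (t / C ?n)))\<^sup>2) - (1 - (norm (chf X (2 * t / C ?n)))\<^sup>2)) / 2) * indicator {0..3 / (1 / 2)} t) \<partial>lborel)"
        by (rule nn_integral_cmult[symmetric]) measurable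
      also have "\<dots> \<le> (\<integral>\<^sup>+t. ennreal (f ?n t) \<partial>lborel)"
      proof (rule nn_integral_mono)
        fix t :: real
        let ?u = "(4 * (1 - (norm (chf X (t / C ?n)))\<^sup>2) - (1 - (norm (chf X (2 * t / C ?n)))\<^sup>2)) / 2"
        have u: "real ?n * ?u = (4 * G ?n t - G ?n (2 * t)) / 2" by (simp add: G_def algebra_simps)
        have "ennreal r * ennreal v \<le> ennreal \<bar>r * v\<bar>" if "r \<ge> 0" for r v
        proof -
          have "ennreal r * ennreal v \<le> ennreal r * ennreal \<bar>v\<bar>" by (intro mult_left_mono ennreal_leI) auto
          also have "\<dots> = ennreal (r * \<bar>v\<bar>)" using that by (simp add: ennreal_mult)
          finally show ?thesis using that by (simp add: abs_mult)
        qed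
        from this[of "real ?n" ?u] have "ennreal (real ?n) * ennreal ?u \<le> ennreal \<bar>(4 * G ?n t - G ?n (2 * t)) / 2\<bar>"
          unfolding u by simp
        then show "ennreal (real ?n) * (ennreal ?u * indicator {0..3 / (1 / 2)} t) \<le> ennreal (f ?n t)"
          by (auto simp: f_def indicator_def)
      qed
      also have "\<dots> = ennreal (\<integral>t. f ?n t \<partial>lborel)"
        by (rule nn_integral_eq_integral[OF fi]) (simp add: f_def)
      finally have "ennreal (real ?n * (9 / (4 * (1 / 2)) * ?Q ?n)) \<le> ennreal (\<integral>t. f ?n t \<partial>lborel)"
        by (subst ennreal_mult) auto
      moreover have "0 \<le> (\<integral>t. f ?n t \<partial>lborel)" by (intro integral_nonneg_AE AE_I2) (simp add: f_def)
      ultimately have *: "real ?n * (9 / (4 * (1 / 2)) * ?Q ?n) \<le> (\<integral>t. f ?n t \<partial>lborel)" by simp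
      have "real ?n * ?Q ?n \<le> real ?n * (9 / (4 * (1 / 2)) * ?Q ?n)" by (intro mult_left_mono) auto
      then show ?thesis using * by linarith
    qed
    have "(\<lambda>n. real (n + n1) * ?Q (n + n1)) \<longlonglongrightarrow> 0"
      by (rule tendsto_sandwich[OF _ _ tendsto_const I0]) (use Qle in auto)
    then show ?thesis by (rule LIMSEQ_offset)
  qed
  have nP: "(\<lambda>n. real n * ?P (C n)) \<longlonglongrightarrow> 0"
  proof (rule tendsto_sandwich[OF _ _ tendsto_const])
    obtain K where K: "K > 0" "\<And>x. x \<ge> K \<Longrightarrow> ?P x < 1 / 2" using prob_tail_small[OF X, of "1 / 2"] by auto
    have "\<forall>\<^sub>F n in sequentially. C n \<ge> 2 * K" using C(2) by (simp add: filterlim_at_top)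
    then show "\<forall>\<^sub>F n in sequentially. real n * ?P (C n) \<le> 2 * (real n * ?Q n)"
    proof eventually_elim
      case (elim n)
      have "?P (C n / 2) \<le> 1 / 2" using K(2)[of "C n / 2"] elim by simp
      from prob_tail_le_symmetrized[OF X this]
      have "?P (C n) \<le> 2 * measure (M \<Otimes>\<^sub>M M) {z\<in>space (M \<Otimes>\<^sub>M M). \<bar>symmetrized X z\<bar> > C n / 2}" by simp
      also have "{z\<in>space (M \<Otimes>\<^sub>M M). \<bar>symmetrized X z\<bar> > C n / 2} = {z\<in>space (M \<Otimes>\<^sub>M M). \<bar>symmetrized X z\<bar> / C n > 1 / 2}"
        using C(1)[of n] by (auto simp: field_simps)
      finally have "real n * ?P (C n) \<le> real n * (2 * ?Q n)" by (intro mult_left_mono) auto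
      then show ?case by simp
    qed
    show "(\<lambda>n. 2 * (real n * ?Q n)) \<longlonglongrightarrow> 0" using tendsto_mult[OF tendsto_const[of 2] nQ] by simp
  qed simp
  have G1: "\<forall>\<^sub>F n in sequentially. G n 1 > 3 / 4" using order_tendstoD(1)[OF G_lim[of 1], of "3 / 4"] by simp
  have nP16: "\<forall>\<^sub>F n in sequentially. real n * ?P (C n) < 1 / 16" using order_tendstoD(2)[OF nP, of "1 / 16"] by simp
  \<comment> \<open>\<open>G n 1 > 3 / 4\<close> and a tail term below \<open>4 / 16\<close> leave
    \<open>1 / 2\<close> for twice the quantity in question.\<close>
  have nl: "\<forall>\<^sub>F n in sequentially. real n * (?l (C n) / (C n)\<^sup>2) \<ge> 1 / 4"
    using G1 nP16
  proof eventually_elim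
    case (elim n)
    have "G n 1 \<le> real n * (2 * (?l (C n) / (C n)\<^sup>2 + 2 * ?P (C n)))"
      unfolding G_def by (intro mult_left_mono one_minus_chf_squared_le X C) simp
    then have "G n 1 \<le> 2 * (real n * (?l (C n) / (C n)\<^sup>2)) + 4 * (real n * ?P (C n))" by (simp only: distrib_left mult_ac)
    then show ?case using elim by linarith
  qed
  have ratio: "\<forall>\<^sub>F n in sequentially. C (Suc n) \<le> 2 * C n"
  proof -
    let ?d = "exp (- (1 / 8)) - exp (- (1 / 4)) :: real"
    have d: "?d > 0" by simp
    have "\<forall>\<^sub>F n in sequentially. G (Suc n) 1 > 3 / 4" using G1 eventually_sequentially_Suc[of "\<lambda>n. G n 1 > 3 / 4"] by blast
    with unif[OF d, of 1] show ?thesis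
      using eventually_ge_at_top[of 3]
    proof eventually_elim
      case (elim n)
      show ?case
      proof (rule ccontr)
        assume "\<not> C (Suc n) \<le> 2 * C n"
        then have gt: "C (Suc n) > 2 * C n" by simp
        \<comment> \<open>Rescaling gives \<open>n * G (Suc n) 1 = (n + 1) * G n \<tau>\<close>. The
          left side exceeds \<open>3 n / 4\<close>, while uniform convergence bounds
          \<open>G n \<tau>\<close> by \<open>1 / 2\<close>, which is impossible for
          \<open>n \<ge> 3\<close>.\<close>
        define \<tau> where "\<tau> = C n / C (Suc n)"
        have \<tau>: "0 < \<tau>" "\<tau> \<le> 1 / 2" using gt C(1)[of n] C(1)[of "Suc n"] by (auto simp: \<tau>_def field_simps)
        have "\<tau>\<^sup>2 \<le> (1 / 2)\<^sup>2" using \<tau> by (intro power_mono) auto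
        then have "exp (- (1 / 8)) \<le> exp (- (\<tau>\<^sup>2 / 2))" by (simp add: power2_eq_square)
        moreover have "\<bar>norm (chf X (\<tau> / C n)) ^ n - exp (- (\<tau>\<^sup>2 / 2))\<bar> < ?d" using elim(1) \<tau> by auto
        ultimately have "exp (- (1 / 4)) \<le> norm (chf X (\<tau> / C n)) ^ n" by linarith
        then have "G n \<tau> \<le> - ln ((exp (- (1 / 4)))\<^sup>2)" using elim(3) by (intro G_le) auto
        also have "(exp (- (1 / 4)) :: real)\<^sup>2 = exp (- (1 / 2))" by (simp add: exp_double[symmetric])
        finally have Gn: "G n \<tau> \<le> 1 / 2" by simp
        have "\<tau> / C n = 1 / C (Suc n)" using C(1)[of n] by (simp add: \<tau>_def)
        then have "real n * G (Suc n) 1 = real (Suc n) * G n \<tau>" by (simp only: G_def mult_ac)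
        also have "\<dots> \<le> real (Suc n) * (1 / 2)" using Gn by (intro mult_left_mono) auto
        finally have "real n * G (Suc n) 1 \<le> real (Suc n) * (1 / 2)" .
        moreover have "real n * (3 / 4) < real n * G (Suc n) 1" using elim(2,3) by (intro mult_strict_left_mono) auto
        ultimately show False using elim(3) by simp
      qed
    qed
  qed
  have pos: "\<forall>\<^sub>F x in at_top. ?l x > 0"
    using trunc_second_moment_at_top[OF X inf] by (simp add: filterlim_at_top_dense)
  show ?thesis
  proof (rule slowly_varying_if_tail[OF X pos], rule tendstoI)
    fix e :: real assume e: "e > 0"
    have "\<forall>\<^sub>F n in sequentially. real n * ?P (C n) < e / 32" using order_tendstoD(2)[OF nP, of "e / 32"] e by simp
    from eventually_conj[OF eventually_conj[OF this nl] eventually_conj[OF ratio eventually_gt_at_top[of 0]]]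
    obtain N where N: "\<And>n. n \<ge> N \<Longrightarrow> real n * ?P (C n) < e / 32" "\<And>n. n \<ge> N \<Longrightarrow> real n * (?l (C n) / (C n)\<^sup>2) \<ge> 1 / 4"
      "\<And>n. n \<ge> N \<Longrightarrow> C (Suc n) \<le> 2 * C n" "\<And>n. n \<ge> N \<Longrightarrow> n > 0"
      by (auto simp: eventually_sequentially)
    show "\<forall>\<^sub>F x in at_top. dist (x\<^sup>2 * ?P x / ?l x) 0 < e"
      using pos eventually_ge_at_top[of "C N"]
    proof eventually_elim
      case (elim x)
      obtain m where m: "\<And>n. n \<ge> m \<Longrightarrow> C n > x"
        using C(2) by (auto simp: filterlim_at_top_dense eventually_sequentially)
      let ?S = "{n. n \<ge> N \<and> C n \<le> x}"
      have "?S \<subseteq> {..<m}" using m by (auto simp: not_le[symmetric])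
      then have fin: "finite ?S" by (rule finite_subset) simp
      have ne: "?S \<noteq> {}" using elim by auto
      \<comment> \<open>Last index with \<open>C n \<le> x\<close>; it exists because
        \<open>C\<close> tends to infinity, and it places \<open>x\<close> between
        \<open>C n\<close> and \<open>2 * C n\<close>.\<close>
      define n where "n = Max ?S"
      have n: "n \<ge> N" "C n \<le> x" using Max_in[OF fin ne] by (auto simp: n_def)
      have "Suc n \<notin> ?S" using Max_ge[OF fin, of "Suc n"] unfolding n_def by auto
      then have x2: "x \<le> 2 * C n" using n N(3)[OF n(1)] by auto
      have n0: "real n > 0" using N(4)[OF n(1)] by simp
      have c0: "C n > 0" by (rule C)
      have "?P x \<le> ?P (C n)" using n by (intro finite_measure_mono) auto
      then have "x\<^sup>2 * ?P x \<le> (2 * C n)\<^sup>2 * ?P (C n)" using x2 n c0 by (intro mult_mono power_mono) auto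
      also have "\<dots> = 4 * (C n)\<^sup>2 / real n * (real n * ?P (C n))" using n0 by (simp add: power_mult_distrib)
      also have "\<dots> \<le> 4 * (C n)\<^sup>2 / real n * (e / 32)" using N(1)[OF n(1)] by (intro mult_left_mono) auto
      also have "\<dots> = e / 2 * ((C n)\<^sup>2 / real n * (1 / 4))" by simp
      also have "\<dots> \<le> e / 2 * ((C n)\<^sup>2 / real n * (real n * (?l (C n) / (C n)\<^sup>2)))"
        using N(2)[OF n(1)] e by (intro mult_left_mono) auto
      also have "\<dots> = e / 2 * ?l (C n)" using n0 c0 by simp
      also have "\<dots> \<le> e / 2 * ?l x" using trunc_second_moment_mono[OF X n(2)] e by (intro mult_left_mono) auto
      finally have "x\<^sup>2 * ?P x / ?l x \<le> e / 2" using elim(1) by (simp add: divide_le_eq)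
      moreover have "0 \<le> x\<^sup>2 * ?P x / ?l x" using elim(1) by simp
      ultimately show ?case using e unfolding dist_real_def diff_0_right by linarith
    qed
  qed
qed

end

section \<open>The limit theorem for digit sums\<close>

text \<open>Skorohod coupling: for pointwise convergent copies, \<open>|e^(itY) - e^(itZ)|\<close>
  is at most \<open>min 2 (|A| |Y - Z|)\<close>, a majorant free of \<open>t\<close>.\<close>

lemma weak_conv_char_uniform:
  assumes "\<And>n. real_distribution (\<mu> n)" "real_distribution M" "weak_conv_m \<mu> M" and d: "d > 0"
  shows "\<forall>\<^sub>F n in sequentially. \<forall>t\<in>{-A..A}. norm (char (\<mu> n) t - char M t) < d"
proof -
  obtain \<Omega> :: "real measure" and Y and Z where \<Omega>: "prob_space \<Omega>"
    and Y: "\<And>n. Y n \<in> borel_measurable \<Omega>" "\<And>n. distr \<Omega> borel (Y n) = \<mu> n"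
    and Z: "Z \<in> measurable \<Omega> lborel" "distr \<Omega> borel Z = M" and lim: "\<And>x. x \<in> space \<Omega> \<Longrightarrow> (\<lambda>n. Y n x) \<longlonglongrightarrow> Z x"
    using Skorohod[OF assms(1-3)] by blast
  interpret prob_space \<Omega> by (rule \<Omega>)
  have Z': "Z \<in> borel_measurable \<Omega>" using Z(1) by simp
  note [measurable] = Y(1) Z'
  define e where "e n = expectation (\<lambda>x. min 2 (\<bar>A\<bar> * \<bar>Y n x - Z x\<bar>))" for n
  have "e \<longlonglongrightarrow> expectation (\<lambda>x. 0)"
    unfolding e_def
  proof (rule integral_dominated_convergence[where w = "\<lambda>_. 2"])
    show "AE x in \<Omega>. (\<lambda>n. min 2 (\<bar>A\<bar> * \<bar>Y n x - Z x\<bar>)) \<longlonglongrightarrow> 0"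
    proof (rule AE_I2)
      fix x assume "x \<in> space \<Omega>"
      from lim[OF this] have "(\<lambda>n. min 2 (\<bar>A\<bar> * \<bar>Y n x - Z x\<bar>)) \<longlonglongrightarrow> min 2 (\<bar>A\<bar> * \<bar>Z x - Z x\<bar>)"
        by (intro tendsto_intros)
      then show "(\<lambda>n. min 2 (\<bar>A\<bar> * \<bar>Y n x - Z x\<bar>)) \<longlonglongrightarrow> 0" by simp
    qed
    show "AE x in \<Omega>. norm (min 2 (\<bar>A\<bar> * \<bar>Y n x - Z x\<bar>)) \<le> 2" for n
      by (rule AE_I2) (simp add: abs_le_iff)
    show "integrable \<Omega> (\<lambda>_. 2 :: real)" by simp
  qed measurable
  then have "\<forall>\<^sub>F n in sequentially. e n < d" using d by (intro order_tendstoD(2)) auto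
  then show ?thesis
  proof eventually_elim
    case (elim n)
    show ?case
    proof
      fix t assume t: "t \<in> {-A..A}"
      have i: "integrable \<Omega> (\<lambda>x. iexp (t * Y n x))" "integrable \<Omega> (\<lambda>x. iexp (t * Z x))"
        by (intro integrable_iexp_real; measurable)+
      have "char (\<mu> n) t = expectation (\<lambda>x. iexp (t * Y n x))" "char M t = expectation (\<lambda>x. iexp (t * Z x))"
        unfolding char_def Y(2)[symmetric] Z(2)[symmetric] by (subst integral_distr; simp)+
      then have eq: "char (\<mu> n) t - char M t = expectation (\<lambda>x. iexp (t * Y n x) - iexp (t * Z x))"
        using i by simp
      have "norm (char (\<mu> n) t - char M t) \<le> e n"
        unfolding eq e_def
      proof (rule order.trans[OF integral_norm_bound integral_mono])
        show "integrable \<Omega> (\<lambda>x. norm (iexp (t * Y n x) - iexp (t * Z x)))" using i by simp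
        show "integrable \<Omega> (\<lambda>x. min 2 (\<bar>A\<bar> * \<bar>Y n x - Z x\<bar>))"
          by (rule integrable_const_bound[where B = 2]) (auto simp: abs_le_iff)
        fix x
        have "norm (iexp (t * Y n x) - iexp (t * Z x)) \<le> 2"
          using norm_triangle_ineq4[of "iexp (t * Y n x)" "iexp (t * Z x)"] by simp
        moreover have "norm (iexp (t * Y n x) - iexp (t * Z x)) \<le> \<bar>A\<bar> * \<bar>Y n x - Z x\<bar>"
        proof -
          let ?y = "t * (Y n x - Z x)"
          have "iexp (t * Y n x) - iexp (t * Z x) = iexp (t * Z x) * (iexp ?y - 1)"
            by (simp add: right_diff_distrib algebra_simps flip: exp_add)
          then have "norm (iexp (t * Y n x) - iexp (t * Z x)) = norm (iexp ?y - 1)" by (simp add: norm_mult)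
          also have "\<dots> \<le> \<bar>?y\<bar>" using iexp_approx1[of ?y 0] by simp
          also have "\<dots> \<le> \<bar>A\<bar> * \<bar>Y n x - Z x\<bar>" unfolding abs_mult using t by (intro mult_right_mono) auto
          finally show ?thesis .
        qed
        ultimately show "norm (iexp (t * Y n x) - iexp (t * Z x)) \<le> min 2 (\<bar>A\<bar> * \<bar>Y n x - Z x\<bar>)" by simp
      qed
      then show "norm (char (\<mu> n) t - char M t) < d" using elim by simp
    qed
  qed
qed

lemma char_minus:
  assumes "real_distribution M" shows "char M (- t) = cnj (char M t)"
proof -
  have "cnj (iexp (t * x)) = iexp (- t * x)" for x by (simp add: exp_cnj)
  then show ?thesis unfolding char_def using Bochner_Integration.integral_cnj[of M "\<lambda>x. iexp (t * x)"] by (simp only:)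
qed

lemma exp_minus_half_ge: "exp (- (1 / 2)) \<ge> (1 / 2 :: real)"
  using exp_ge_add_one_self[of "- (1 / 2) :: real"] by simp

section \<open>Both implications for the variable attached to the first digit\<close>

locale cf_digit_function =
  fixes f :: "real \<Rightarrow> real"
begin

sublocale prob_space gauss_measure
  by (rule prob_space_gauss_measure)

definition X :: "real \<Rightarrow> real" where "X x = f (real (cf_digit 1 x))"

text \<open>Indexed by the shifted digit to match \<open>gk_digit\<close>. The agreement with
  \<open>X\<close> is only almost everywhere, because \<open>cf_digit\<close> is unspecified at
  rational points.\<close>

definition F :: "nat \<Rightarrow> real" where "F k = f (real (Suc k))"

lemma measurable_X [measurable]: "X \<in> borel_measurable gauss_measure"
  unfolding X_def by (rule measurable_f_cf_digit) simp

lemma AE_X: "AE x in gauss_measure. X x = F (gk_digit x)"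
  using AE_cf_digit_1 by eventually_elim (simp add: X_def F_def)

lemma measurable_F_digit [measurable]: "(\<lambda>x. F (gk_digit x)) \<in> borel_measurable gauss_measure"
  by (rule measurable_gauss_measure) measurable

lemma trunc_moment2_eq: "trunc_moment2 f = trunc_second_moment gauss_measure X"
  by (simp add: fun_eq_iff trunc_moment2_def trunc_second_moment_def X_def)

lemma chf_X: "chf X t = (\<integral>x. iexp (t * F (gk_digit x)) \<partial>gauss_measure)"
  unfolding chf_def
proof (rule integral_cong_AE)
  show "AE x in gauss_measure. iexp (t * X x) = iexp (t * F (gk_digit x))"
    using AE_X by eventually_elim simp
qed measurable

lemma char_law: "char (normalized_law f c d n) t = iexp (- (t / c n * d n)) * cf_char F n (t / c n)"
  unfolding char_normalized_law F_def ..

lemma norm_char_law: "norm (char (normalized_law f c d n) t) = norm (cf_char F n (t / c n))"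
  unfolding char_law norm_mult by simp

text \<open>\<open>\<eta>^2\<close> is at most a small multiple of \<open>1 - |\<phi>|^2\<close>,
  and the geometric sum in \<open>cf_char_approx\<close> is at most
  \<open>2 / (1 - |\<phi>|^2)\<close>, so their product is small for all \<open>n\<close> at once.
  This uniformity lets \<open>t\<close> depend on \<open>n\<close> afterwards.\<close>

lemma cf_char_close:
  assumes inf: "\<not> integrable gauss_measure (\<lambda>x. (X x)\<^sup>2)" and e: "e > 0"
  obtains d where "d > 0" "\<And>t n. 0 < \<bar>t\<bar> \<Longrightarrow> \<bar>t\<bar> < d \<Longrightarrow> norm (cf_char F n t - chf X t ^ n) \<le> e"
    "\<And>t. 0 < \<bar>t\<bar> \<Longrightarrow> \<bar>t\<bar> < d \<Longrightarrow> norm (chf X t) < 1"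
proof -
  \<comment> \<open>\<open>1152 = 192 + 2 * 480\<close> collects the two error terms of
    \<open>cf_char_approx\<close>; \<open>r \<le> 1\<close> allows \<open>r^2\<close> to be replaced
    by \<open>r\<close>.\<close>
  define r where "r = min 1 (e / 1152)"
  have r: "0 < r" "r \<le> 1" "1152 * r \<le> e" using e by (auto simp: r_def min_def)
  obtain d where d: "d > 0" and dU: "\<And>t. 0 < \<bar>t\<bar> \<and> \<bar>t\<bar> < d \<Longrightarrow> 0 < 1 - (norm (chf X t))\<^sup>2 \<and>
     (expectation (\<lambda>x. norm (iexp (t * X x) - 1)))\<^sup>2 \<le> r\<^sup>2 * (1 - (norm (chf X t))\<^sup>2)"
    using expectation_norm_iexp_small[OF measurable_X inf, of "r\<^sup>2"] r by auto
  show ?thesis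
  proof (rule that[OF d])
    fix t assume t: "0 < \<bar>t\<bar>" "\<bar>t\<bar> < d"
    let ?\<phi> = "chf X t"
    define U where "U = 1 - (norm ?\<phi>)\<^sup>2"
    have U: "0 < U" "U \<le> 1" using dU[OF conjI[OF t]] by (auto simp: U_def)
    show lt1: "norm ?\<phi> < 1"
    proof (rule ccontr)
      assume "\<not> norm ?\<phi> < 1"
      then have "1 \<le> (norm ?\<phi>)\<^sup>2" by (intro one_le_power) simp
      then show False using U by (simp add: U_def)
    qed
    define \<eta> where "\<eta> = (\<integral>x. norm (iexp (t * F (gk_digit x)) - 1) \<partial>gauss_measure)"
    have \<eta>_eq: "\<eta> = expectation (\<lambda>x. norm (iexp (t * X x) - 1))"
      unfolding \<eta>_def
    proof (rule integral_cong_AE)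
      show "AE x in gauss_measure. norm (iexp (t * F (gk_digit x)) - 1) = norm (iexp (t * X x) - 1)"
        using AE_X by eventually_elim simp
    qed measurable
    have \<eta>2: "\<eta>\<^sup>2 \<le> r\<^sup>2 * U" unfolding \<eta>_eq U_def using dU[OF conjI[OF t]] by (rule conjunct2)
    also have "\<dots> \<le> r\<^sup>2 * 1" using U by (intro mult_left_mono) auto
    finally have \<eta>r: "\<eta> \<le> r" using r by (intro power2_le_imp_le[of \<eta> r]) simp_all
    fix n
    have sum: "(\<Sum>k<n. norm ?\<phi> ^ k) * U \<le> 2"
    proof -
      have "(\<Sum>k<n. norm ?\<phi> ^ k) * (1 - norm ?\<phi>) = 1 - norm ?\<phi> ^ n"
        using lt1 by (simp add: sum_gp_strict)
      then have "(\<Sum>k<n. norm ?\<phi> ^ k) * (1 - norm ?\<phi>) \<le> 1" by simp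
      moreover have "U \<le> 2 * (1 - norm ?\<phi>)"
        using zero_le_power2[of "norm ?\<phi> - 1"] by (simp add: U_def power2_eq_square algebra_simps)
      then have "(\<Sum>k<n. norm ?\<phi> ^ k) * U \<le> (\<Sum>k<n. norm ?\<phi> ^ k) * (2 * (1 - norm ?\<phi>))"
        by (intro mult_left_mono sum_nonneg) auto
      ultimately show ?thesis by linarith
    qed
    have "norm (cf_char F n t - ?\<phi> ^ n) \<le> 192 * \<eta> + 480 * \<eta>\<^sup>2 * (\<Sum>k<n. norm ?\<phi> ^ k)"
      unfolding chf_X \<eta>_def by (rule cf_char_approx)
    also have "480 * \<eta>\<^sup>2 * (\<Sum>k<n. norm ?\<phi> ^ k) \<le> 480 * (r\<^sup>2 * U) * (\<Sum>k<n. norm ?\<phi> ^ k)"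
      using \<eta>2 by (intro mult_right_mono sum_nonneg) auto
    also have "480 * (r\<^sup>2 * U) * (\<Sum>k<n. norm ?\<phi> ^ k) = 480 * r\<^sup>2 * ((\<Sum>k<n. norm ?\<phi> ^ k) * U)" by simp
    also have "\<dots> \<le> 480 * r\<^sup>2 * 2" using sum by (intro mult_left_mono) auto
    also have "\<dots> \<le> 960 * r" using r by (simp add: power2_eq_square)
    finally have "norm (cf_char F n t - ?\<phi> ^ n) \<le> 192 * r + 960 * r" using \<eta>r by simp
    then show "norm (cf_char F n t - ?\<phi> ^ n) \<le> e" using r by simp
  qed
qed

text \<open>Moduli remove the centring, and the symmetry of the limit lets the sign of
  \<open>c n\<close> be dropped. \<open>cf_char_close\<close> then replaces the digit sum by the
  power of \<open>chf X\<close>, provided \<open>t / C n\<close> tends to 0; that \<open>C\<close>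
  tends to infinity has to be derived.\<close>

lemma slowly_varying_if_weak_conv:
  assumes inf: "\<not> integrable gauss_measure (\<lambda>x. (X x)\<^sup>2)"
    and c: "\<And>n. c n \<noteq> 0" and conv: "weak_conv_m (normalized_law f c d) std_normal_distribution"
  shows "slowly_varying (trunc_second_moment gauss_measure X)"
proof -
  define C where "C n = \<bar>c n\<bar>" for n
  have C: "C n > 0" for n using c by (simp add: C_def)
  have unif: "\<forall>\<^sub>F n in sequentially. \<forall>t\<in>{-A..A}. \<bar>norm (cf_char F n (t / C n)) - exp (- (t\<^sup>2 / 2))\<bar> < e" if "e > 0" for A e
    using weak_conv_char_uniform[OF real_distribution_normalized_law real_dist_normal_dist conv that, of A]
  proof eventually_elim
    case (elim n)
    show ?case
    proof
      fix t assume t: "t \<in> {-A..A}"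
      define s where "s = (if c n > 0 then t else - t)"
      have s: "s \<in> {-A..A}" "s / c n = t / C n" "s\<^sup>2 = t\<^sup>2" using t by (auto simp: s_def C_def)
      have "norm (char (normalized_law f c d n) s - exp (- (s\<^sup>2 / 2))) < e"
        using elim s(1) by (simp add: char_std_normal_distribution)
      then have "\<bar>norm (char (normalized_law f c d n) s) - norm (complex_of_real (exp (- (s\<^sup>2 / 2))))\<bar> < e"
        by (rule le_less_trans[OF norm_triangle_ineq3])
      then show "\<bar>norm (cf_char F n (t / C n)) - exp (- (t\<^sup>2 / 2))\<bar> < e"
        unfolding norm_char_law s norm_of_real by simp
    qed
  qed
  have C_top: "filterlim C at_top sequentially"
    unfolding filterlim_at_top
  proof (intro allI, rule ccontr)
    fix K0
    assume "\<not> (\<forall>\<^sub>F n in sequentially. K0 \<le> C n)"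
    then have freq: "\<exists>\<^sub>F n in sequentially. \<not> K0 \<le> C n" by (simp add: frequently_def)
    define K where "K = max 1 K0"
    have K: "K \<ge> 1" "K0 \<le> K" by (auto simp: K_def)
    obtain r where r: "r > 0" "\<And>t n. 0 < \<bar>t\<bar> \<Longrightarrow> \<bar>t\<bar> < r \<Longrightarrow> norm (cf_char F n t - chf X t ^ n) \<le> 1 / 8"
      "\<And>t. 0 < \<bar>t\<bar> \<Longrightarrow> \<bar>t\<bar> < r \<Longrightarrow> norm (chf X t) < 1"
      by (rule cf_char_close[OF inf, of "1 / 8"]) auto
    \<comment> \<open>If \<open>C n\<close> stayed below \<open>K\<close> infinitely often, then at
      the fixed small argument \<open>s\<close> the modulus would be close to
      \<open>|\<phi>(s)|^n\<close>, which tends to 0, although \<open>s * C n \<le> 1\<close> forces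
      it above \<open>exp (- 1 / 2) - 1 / 8\<close>.\<close>
    define s where "s = min (r / 2) (1 / K)"
    have s: "0 < s" "s < r" "s * K \<le> 1" using r(1) K by (auto simp: s_def min_def field_simps)
    have "(\<lambda>n. norm (chf X s) ^ n) \<longlonglongrightarrow> 0" using r(3)[of s] s by (intro LIMSEQ_power_zero) simp
    then have "\<forall>\<^sub>F n in sequentially. norm (chf X s) ^ n < 1 / 8" by (rule order_tendstoD(2)) simp
    moreover have "\<forall>\<^sub>F n in sequentially. \<forall>t\<in>{-1..1}. \<bar>norm (cf_char F n (t / C n)) - exp (- (t\<^sup>2 / 2))\<bar> < 1 / 8"
      by (rule unif) simp
    ultimately have "\<forall>\<^sub>F n in sequentially. K0 \<le> C n"
    proof eventually_elim
      case (elim n)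
      note n = elim(2,1)
      show "K0 \<le> C n"
      proof (rule ccontr)
        assume "\<not> K0 \<le> C n"
        then have "C n \<le> K" using K by simp
        then have "s * C n \<le> 1" using s by (intro order.trans[OF mult_left_mono s(3)]) auto
        moreover have "0 \<le> s * C n" using s C[of n] by simp
        ultimately have t: "s * C n \<in> {-1..1}" "(s * C n)\<^sup>2 \<le> 1" by (auto simp: abs_square_le_1)
        have "exp (- (1 / 2)) \<le> exp (- ((s * C n)\<^sup>2 / 2))" using t(2) by simp
        moreover have "\<bar>norm (cf_char F n s) - exp (- ((s * C n)\<^sup>2 / 2))\<bar> < 1 / 8"
          using bspec[OF n(1) t(1)] C[of n] by simp
        ultimately have "norm (cf_char F n s) > 3 / 8" using exp_minus_half_ge by linarith
        moreover have "norm (cf_char F n s) \<le> norm (chf X s ^ n) + norm (cf_char F n s - chf X s ^ n)"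
          by (rule norm_triangle_sub)
        ultimately show False using r(2)[of s n] s n(2) by (simp add: norm_power)
      qed
    qed
    then show False using freq by (simp add: frequently_def)
  qed
  show ?thesis
  proof (rule slowly_varying_if_clt[OF measurable_X inf C C_top])
    fix A e :: real assume e: "e > 0"
    obtain r where r: "r > 0" "\<And>t n. 0 < \<bar>t\<bar> \<Longrightarrow> \<bar>t\<bar> < r \<Longrightarrow> norm (cf_char F n t - chf X t ^ n) \<le> e / 2"
      by (rule cf_char_close[OF inf, of "e / 2"]) (use e in auto)
    have "\<forall>\<^sub>F n in sequentially. C n > \<bar>A\<bar> / r" using C_top by (simp add: filterlim_at_top_dense)
    with unif[of "e / 2" A, OF half_gt_zero[OF e]]
    show "\<forall>\<^sub>F n in sequentially. \<forall>t\<in>{-A..A}. \<bar>norm (chf X (t / C n)) ^ n - exp (- (t\<^sup>2 / 2))\<bar> < e"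
    proof eventually_elim
      case (elim n)
      show ?case
      proof
        fix t assume t: "t \<in> {-A..A}"
        show "\<bar>norm (chf X (t / C n)) ^ n - exp (- (t\<^sup>2 / 2))\<bar> < e"
        proof (cases "t = 0")
          case False
          have "\<bar>t\<bar> \<le> \<bar>A\<bar>" using t by auto
          also have "\<dots> < r * C n" using elim(2) r(1) by (simp add: field_simps)
          finally have "\<bar>t / C n\<bar> < r" using C[of n] by (simp add: field_simps)
          then have "norm (cf_char F n (t / C n) - chf X (t / C n) ^ n) \<le> e / 2"
            using False C[of n] by (intro r(2)) auto
          then have "\<bar>norm (cf_char F n (t / C n)) - norm (chf X (t / C n) ^ n)\<bar> \<le> e / 2"
            by (rule order.trans[OF norm_triangle_ineq3])
          moreover have "\<bar>norm (cf_char F n (t / C n)) - exp (- (t\<^sup>2 / 2))\<bar> < e / 2" using elim(1) t by auto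
          ultimately show ?thesis unfolding norm_power by linarith
        qed (use e in \<open>simp add: chf_zero\<close>)
      qed
    qed
  qed
qed

lemma weak_conv_if_slowly_varying:
  assumes inf: "\<not> integrable gauss_measure (\<lambda>x. (X x)\<^sup>2)"
    and sv: "slowly_varying (trunc_second_moment gauss_measure X)"
  shows "\<exists>c. (\<forall>n. c n \<noteq> 0) \<and> weak_conv_m (normalized_law f c (\<lambda>n. real n * expectation X)) std_normal_distribution"
proof -
  obtain b where b: "\<And>n. b n > 0" "filterlim b at_top sequentially"
    "(\<lambda>n. real n * trunc_second_moment gauss_measure X (b n) / (b n)\<^sup>2) \<longlonglongrightarrow> 1"
    using normalizing_sequence[OF measurable_X sv] by blast
  let ?law = "normalized_law f b (\<lambda>n. real n * expectation X)"
  have pos: "(\<lambda>n. char (?law n) t) \<longlonglongrightarrow> exp (- (t\<^sup>2 / 2))" if t: "t > 0" for t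
  proof -
    let ?p = "\<lambda>n. (iexp (- (t / b n * expectation X)) * chf X (t / b n)) ^ n"
    have lim: "?p \<longlonglongrightarrow> exp (- (t\<^sup>2 / 2))" by (rule clt_chf_power_pos[OF measurable_X sv inf b t])
    have "(\<lambda>n. char (?law n) t - ?p n) \<longlonglongrightarrow> 0"
    proof (rule tendstoI)
      fix e :: real assume e: "e > 0"
      obtain r where r: "r > 0" "\<And>t n. 0 < \<bar>t\<bar> \<Longrightarrow> \<bar>t\<bar> < r \<Longrightarrow> norm (cf_char F n t - chf X t ^ n) \<le> e / 2"
        by (rule cf_char_close[OF inf, of "e / 2"]) (use e in auto)
      have "\<forall>\<^sub>F n in sequentially. b n > t / r" using b(2) by (simp add: filterlim_at_top_dense)
      then show "\<forall>\<^sub>F n in sequentially. dist (char (?law n) t - ?p n) 0 < e"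
      proof eventually_elim
        case (elim n)
        \<comment> \<open>With \<open>d n = n E X\<close> the centring phase is itself an
          \<open>n\<close>-th power and can be moved inside.\<close>
        have "iexp (- (t / b n * (real n * expectation X))) = iexp (- (t / b n * expectation X)) ^ n"
          by (simp add: exp_of_nat_mult[symmetric] mult_ac)
        then have "char (?law n) t - ?p n = iexp (- (t / b n * (real n * expectation X))) * (cf_char F n (t / b n) - chf X (t / b n) ^ n)"
          unfolding char_law power_mult_distrib by (simp only: right_diff_distrib)
        then have "norm (char (?law n) t - ?p n) = norm (cf_char F n (t / b n) - chf X (t / b n) ^ n)"
          by (simp add: norm_mult)
        also have "\<dots> \<le> e / 2"
        proof (rule r(2))
          show "0 < \<bar>t / b n\<bar>" using t b(1)[of n] by simp
          show "\<bar>t / b n\<bar> < r" using t b(1)[of n] elim r(1) by (simp add: field_simps)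
        qed
        finally show ?case using e by (simp add: dist_norm)
      qed
    qed
    from tendsto_add[OF this lim] show ?thesis by simp
  qed
  have "weak_conv_m ?law std_normal_distribution"
  proof (rule levy_continuity[OF real_distribution_normalized_law real_dist_normal_dist])
    fix t :: real
    show "(\<lambda>n. char (?law n) t) \<longlonglongrightarrow> char std_normal_distribution t"
    proof (rule linorder_cases[of t 0])
      assume "t < 0"
      from tendsto_cnj[OF pos[of "- t"]] this show ?thesis
        unfolding char_minus[OF real_distribution_normalized_law]
        by (simp add: char_std_normal_distribution exp_cnj)
    next
      assume "t = 0"
      then show ?thesis
        by (simp add: real_distribution.char_zero[OF real_distribution_normalized_law] char_std_normal_distribution)
    qed (use pos in \<open>simp add: char_std_normal_distribution\<close>)
  qed
  then show ?thesis using b(1) by (intro exI[of _ b]) (auto simp: less_imp_neq[symmetric])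
qed

text \<open>With \<open>d n = n \<mu>\<close> the law is that of the sums of
  \<open>f - \<mu>\<close>. The witness \<open>m\<close> says that the centred digit function is not
  identically zero, which positivity of the limiting variance requires.\<close>

lemma weak_conv_if_finite_variance:
  assumes fin: "integrable gauss_measure (\<lambda>x. (X x)\<^sup>2)" and m: "F m \<noteq> expectation X"
  shows "\<exists>c. (\<forall>n. c n \<noteq> 0) \<and> weak_conv_m (normalized_law f c (\<lambda>n. real n * expectation X)) std_normal_distribution"
proof -
  define \<mu> where "\<mu> = expectation X"
  define H where "H k = F k - \<mu>" for k
  have iX: "integrable gauss_measure X" by (rule square_integrable_imp_integrable[OF measurable_X fin])
  have AE1: "AE x in gauss_measure. X x - \<mu> = H (gk_digit x)"
    using AE_X by eventually_elim (simp add: H_def)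
  have AE2: "AE x in gauss_measure. (X x - \<mu>)\<^sup>2 = (H (gk_digit x))\<^sup>2"
    using AE1 by eventually_elim simp
  have [measurable]: "(\<lambda>x. H (gk_digit x)) \<in> borel_measurable gauss_measure"
    unfolding H_def by measurable
  have i1: "integrable gauss_measure (\<lambda>x. H (gk_digit x))"
    by (rule integrable_cong_AE_imp[of _ "\<lambda>x. X x - \<mu>"]) (use iX AE1 in auto)
  have "integrable gauss_measure (\<lambda>x. (X x - \<mu>)\<^sup>2)"
    unfolding power2_diff using fin iX by simp
  then have i2: "integrable gauss_measure (\<lambda>x. (H (gk_digit x))\<^sup>2)"
    by (rule integrable_cong_AE_imp) (use AE2 in auto)
  have z: "(\<integral>x. H (gk_digit x) \<partial>gauss_measure) = 0"
  proof -
    have "(\<integral>x. H (gk_digit x) \<partial>gauss_measure) = expectation (\<lambda>x. X x - \<mu>)"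
      by (rule integral_cong_AE) (use AE1 in auto)
    then show ?thesis using iX by (simp add: \<mu>_def prob_space)
  qed
  have Hm: "H m \<noteq> 0" using m by (simp add: H_def \<mu>_def)
  obtain \<sigma> where \<sigma>: "\<sigma> > 0" "\<And>t. (\<lambda>n. cf_char H n (t / (\<sigma> * sqrt n))) \<longlonglongrightarrow> exp (- (t\<^sup>2 / 2))"
    by (rule cf_char_finite_variance[OF i2 i1 z Hm]) (rule that)
  \<comment> \<open>At \<open>n = 0\<close> the square root vanishes, whereas every
    \<open>c n\<close> has to be nonzero; the value 1 is a placeholder.\<close>
  define c where "c n = (if n = 0 then 1 else \<sigma> * sqrt (real n))" for n
  let ?law = "normalized_law f c (\<lambda>n. real n * \<mu>)"
  have law: "?law = normalized_law (\<lambda>x. f x - \<mu>) c (\<lambda>_. 0)"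
    by (simp add: fun_eq_iff normalized_law_def sum_subtractf)
  have "weak_conv_m ?law std_normal_distribution"
  proof (rule levy_continuity[OF real_distribution_normalized_law real_dist_normal_dist])
    fix t :: real
    show "(\<lambda>n. char (?law n) t) \<longlonglongrightarrow> char std_normal_distribution t"
    proof (rule Lim_transform_eventually)
      show "(\<lambda>n. cf_char H n (t / (\<sigma> * sqrt n))) \<longlonglongrightarrow> char std_normal_distribution t"
        using \<sigma>(2)[of t] by (simp add: char_std_normal_distribution)
      show "\<forall>\<^sub>F n in sequentially. cf_char H n (t / (\<sigma> * sqrt n)) = char (?law n) t"
        using eventually_gt_at_top[of 0]
        by eventually_elim (simp add: law char_normalized_law c_def H_def[abs_def] F_def)
    qed
  qed
  then show ?thesis using \<sigma>(1) unfolding \<mu>_def by (intro exI[of _ c]) (auto simp: c_def)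
qed

text \<open>Every law is a point mass, so its characteristic function has modulus 1, against
  \<open>exp (- 1 / 2)\<close> for the normal law at argument 1.\<close>

lemma no_weak_conv_if_zero:
  assumes "\<And>k. F k = 0"
  shows "\<not> weak_conv_m (normalized_law f c d) std_normal_distribution"
proof
  assume conv: "weak_conv_m (normalized_law f c d) std_normal_distribution"
  have one: "cf_char F n t = 1" for n t
  proof -
    have "cf_char F n t = (\<integral>x. iexp (t * (\<Sum>k=1..n. f (real (cf_digit k x)))) \<partial>gauss_measure)"
      unfolding integral_iexp_sum F_def ..
    also have "\<dots> = (\<integral>x. 1 \<partial>gauss_measure)"
    proof (rule integral_cong_AE)
      note [measurable] = measurable_sum_cf_digit[of f n]
      show "(\<lambda>x. iexp (t * (\<Sum>k=1..n. f (real (cf_digit k x))))) \<in> borel_measurable gauss_measure" by measurable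
      show "AE x in gauss_measure. iexp (t * (\<Sum>k=1..n. f (real (cf_digit k x)))) = 1"
        using AE_sum_cf_digit[of f n] by eventually_elim (use assms in \<open>simp add: F_def\<close>)
    qed simp
    finally show ?thesis by (simp add: prob_space)
  qed
  have "(\<lambda>n. norm (char (normalized_law f c d n) 1)) \<longlonglongrightarrow> norm (char std_normal_distribution 1)"
    by (intro tendsto_norm levy_continuity1[OF real_distribution_normalized_law real_dist_normal_dist conv])
  then have "(\<lambda>n. 1) \<longlonglongrightarrow> exp (- (1 / 2) :: real)"
    unfolding norm_char_law one by (simp add: char_std_normal_distribution norm_exp_eq_Re)
  then show False by (simp add: LIMSEQ_const_iff)
qed

end

text \<open>Functions equal to a nonzero constant \<open>r\<close> on all digits are excluded: for
  them the truncated moment is eventually \<open>r^2\<close>, hence slowly varying, although the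
  sums are deterministic and have no normal limit. Integrability belongs to the conclusion because
  the Bochner integral of a non-integrable function is 0 by convention; it makes the centring a
  genuine mean.\<close>

theorem theorem3:
  fixes f :: "real \<Rightarrow> real"
  assumes "f \<in> borel_measurable borel"
    and "\<not> (\<exists>r. r \<noteq> 0 \<and> (\<forall>k::nat. k \<ge> 1 \<longrightarrow> f (real k) = r))"
  shows "((\<exists>c d. (\<forall>n. c n \<noteq> 0) \<and> weak_conv_m (normalized_law f c d) std_normal_distribution)
            \<longleftrightarrow> slowly_varying (trunc_moment2 f))
       \<and> (slowly_varying (trunc_moment2 f) \<longrightarrow>
            integrable gauss_measure (\<lambda>x. f (real (cf_digit 1 x)))
          \<and> (\<exists>c. (\<forall>n. c n \<noteq> 0) \<and>
               weak_conv_m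
                 (normalized_law f c (\<lambda>n. real n * (\<integral>x. f (real (cf_digit 1 x)) \<partial>gauss_measure)))
                 std_normal_distribution))"
proof -
  interpret cf_digit_function f .
  let ?sv = "slowly_varying (trunc_second_moment gauss_measure X)"
  let ?clt = "\<exists>c. (\<forall>n. c n \<noteq> 0) \<and> weak_conv_m (normalized_law f c (\<lambda>n. real n * expectation X)) std_normal_distribution"
  have X_eq: "X = (\<lambda>x. f (real (cf_digit 1 x)))" by (simp add: X_def fun_eq_iff)
  have clt: ?clt if sv: ?sv
  proof (cases "integrable gauss_measure (\<lambda>x. (X x)\<^sup>2)")
    case True
    \<comment> \<open>Otherwise \<open>f\<close> is constant on the digits. The constant is 0 by the
      exclusion of nonzero ones, and the truncated moment vanishes identically, against its eventual
      positivity.\<close>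
    have "\<exists>m. F m \<noteq> expectation X"
    proof (rule ccontr)
      assume "\<not> (\<exists>m. F m \<noteq> expectation X)"
      then have const: "F m = expectation X" for m by simp
      have "f (real k) = expectation X" if "k \<ge> 1" for k
        using const[of "k - 1"] that by (simp add: F_def)
      then have "expectation X = 0" using assms(2) by blast
      then have "AE x in gauss_measure. X x = 0" using AE_X const by (auto elim: eventually_mono)
      then have "trunc_second_moment gauss_measure X t = 0" for t
        unfolding trunc_second_moment_def by (intro integral_eq_zero_AE) (auto elim: eventually_mono)
      then show False using sv by (simp add: slowly_varying_def)
    qed
    then show ?thesis using weak_conv_if_finite_variance[OF True] by blast
  next
    case False
    then show ?thesis by (rule weak_conv_if_slowly_varying[OF _ sv])
  qed
  have sv: ?sv if c: "\<And>n. c n \<noteq> 0" and conv: "weak_conv_m (normalized_law f c d) std_normal_distribution" for c d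
  proof (cases "integrable gauss_measure (\<lambda>x. (X x)\<^sup>2)")
    case True
    obtain m where m: "F m \<noteq> 0" using no_weak_conv_if_zero conv by blast
    \<comment> \<open>Every digit has positive probability, so a single
      \<open>F m \<noteq> 0\<close> gives a positive second moment; the positive
      \<open>gk_weight m 0\<close> expresses this through \<open>wnorm\<close>.\<close>
    have "expectation (\<lambda>x. (X x)\<^sup>2) \<noteq> 0"
    proof
      assume "expectation (\<lambda>x. (X x)\<^sup>2) = 0"
      then have "AE x in gauss_measure. (X x)\<^sup>2 = 0" using integral_nonneg_eq_0_iff_AE[OF True] by simp
      then have "AE x in gauss_measure. F (gk_digit x) = 0"
        using AE_X by eventually_elim simp
      then have z: "(\<integral>x. norm (F (gk_digit x)) \<partial>gauss_measure) = 0" by (intro integral_eq_zero_AE) auto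
      have "integrable gauss_measure (\<lambda>x. F (gk_digit x))"
        by (rule integrable_cong_AE_imp[of _ "\<lambda>x. 0"]) (use \<open>AE x in gauss_measure. F (gk_digit x) = 0\<close> in auto)
      then have ws: "wsummable F" by (rule wsummable_if_integrable)
      have "gk_weight m 0 * norm (F m) \<le> wnorm F"
        unfolding wnorm_def using sum_le_suminf[OF ws[unfolded wsummable_def], of "{m}"] by (simp add: gk_weight_nonneg)
      also have "\<dots> \<le> 0" using wnorm_le[OF ws] z by simp
      finally show False using m gk_weight_pos[of 0 m] by (simp add: mult_le_0_iff)
    qed
    moreover have "expectation (\<lambda>x. (X x)\<^sup>2) \<ge> 0" by (intro integral_nonneg_AE AE_I2) simp
    ultimately show ?thesis by (intro slowly_varying_if_finite[OF measurable_X True]) linarith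
  next
    case False
    then show ?thesis by (rule slowly_varying_if_weak_conv[OF _ c conv])
  qed
  have "integrable gauss_measure X" if ?sv by (rule slowly_varying_integrable[OF measurable_X that])
  then show ?thesis unfolding trunc_moment2_eq X_eq[symmetric] using clt sv by blast
qed

end
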